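(* Let $\Omega\subset\mathbb{C}$ be a bounded simply connected domain, $a,b\in L_\infty(\Omega;\mathbb{B})$, $1<p<\infty$. Let $q$ be a finite exponent with $q\geqslant p$ and $q>2$, let $V\in L_q(\Omega;\mathbb{B})$, and let $W\in\overline{\mathfrak{D}}_p(\Omega;\mathbb{B})$ be a weak solution of $\overline{\boldsymbol{\partial}}W-aW-b\overline{W}=V$ in $\Omega$. For $p<2$ put $p^*=\frac{2p}{2-p}$. Then: (i) If $p<2$, then $W\in C_{locdisk}^{0,1-\frac{2}{r}}(\Omega;\mathbb{B})$ for all $2<r<\min\{p^*,q\}$. (ii) If $p\geqslant 2$, then $W\in C_{locdisk}^{0,1-\frac{2}{q}}(\Omega;\mathbb{B})$. (iii) $\mathcal{A}_{(a,b)}^p(\Omega;\mathbb{B})\subset C_{locdisk}^{0,1-\frac{2}{r}}(\Omega;\mathbb{B})$ for all $2<r<p^*$ if $p<2$, and for all $p<r<\infty$ if $p\geqslant 2$.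
   Context: $\mathbb{B}=\{u+\mathbf{j}v : u,v\in\mathbb{C}\}$ is the commutative $\mathbb{C}$-algebra of bicomplex numbers, with $\mathbf{j}^2=-1$ and $i\mathbf{j}=\mathbf{j}i$. For $W=u+\mathbf{j}v$: $\operatorname{Sc}W=u$, $\operatorname{Vec}W=v$, $\overline{W}=u-\mathbf{j}v$, $|W|_{\mathbb{B}}=\sqrt{|u|^2+|v|^2}$. A function $F:\Omega\to\mathbb{B}$ belongs to $\mathscr{F}(\Omega;\mathbb{B})$ (for a space $\mathscr{F}(\Omega)$ of complex-valued functions) iff $\operatorname{Sc}F,\operatorname{Vec}F\in\mathscr{F}(\Omega)$. With $z=x+iy$, $\overline{\boldsymbol{\partial}}=\frac12\left(\frac{\partial}{\partial x}+\mathbf{j}\frac{\partial}{\partial y}\right)$. A function $V\in L_{1,loc}(\Omega;\mathbb{B})$ is the weak $\overline{\boldsymbol{\partial}}$-derivative of $W\in L_p(\Omega;\mathbb{B})$ if $\iint_\Omega W\,\overline{\boldsymbol{\partial}}\phi\,dA=-\iint_\Omega V\phi\,dA$ for all $\phi\in C_0^\infty(\Omega;\mathbb{B})$. $\overline{\mathfrak{D}}_p(\Omega;\mathbb{B})=\{W\in L_p(\Omega;\mathbb{B}) : \overline{\boldsymbol{\partial}}W\in L_p(\Omega;\mathbb{B})\}$ (weak derivative). The Vekua-Bergman space $\mathcal{A}_{(a,b)}^p(\Omega;\mathbb{B})$ is the set of all weak solutions $W\in L_p(\Omega;\mathbb{B})$ of $\overline{\boldsymbol{\partial}}W=aW+b\overline{W}$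 in $\Omega$. $W\in C^{0,\epsilon}_{locdisk}(\Omega;\mathbb{B})$ means that $W$ (after modification on a null set) satisfies $W|_D\in C^{0,\epsilon}(\overline{D};\mathbb{B})$, i.e. is Hölder continuous with exponent $\epsilon$ on $\overline D$, for every open disk $D$ with $\overline{D}\subset\Omega$. *)

theory Defs
  imports "HOL-Analysis.Analysis"
begin

text \<open>The pair \<open>(u, v)\<close> stands for \<open>u + \<^bold>j v\<close>. Addition, real scaling, topology and norm
  are those of the product; its norm is exactly \<open>sqrt (|u|\<^sup>2 + |v|\<^sup>2)\<close>. The product type carries no
  multiplication in the library, so the bicomplex one gets its own symbol.\<close>

type_synonym bicomplex = "complex \<times> complex"

abbreviation Sc :: "bicomplex \<Rightarrow> complex" where "Sc \<equiv> fst"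
abbreviation Vec :: "bicomplex \<Rightarrow> complex" where "Vec \<equiv> snd"

definition bc_mult :: "bicomplex \<Rightarrow> bicomplex \<Rightarrow> bicomplex"  (infixl "*\<^sub>B" 70) where
  "U *\<^sub>B V = (Sc U * Sc V - Vec U * Vec V, Sc U * Vec V + Vec U * Sc V)"

definition bc_j :: bicomplex where
  "bc_j = (0, 1)"

definition bc_cnj :: "bicomplex \<Rightarrow> bicomplex" where
  "bc_cnj W = (Sc W, - Vec W)"

lemma bc_j_square: "bc_j *\<^sub>B bc_j = (-1, 0)"
  by (simp add: bc_mult_def bc_j_def)

lemma bc_mult_commute: "U *\<^sub>B V = V *\<^sub>B U"
  by (simp add: bc_mult_def mult.commute add.commute)

lemma bc_mult_assoc: "(U *\<^sub>B V) *\<^sub>B W = U *\<^sub>B (V *\<^sub>B W)"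
  by (simp add: bc_mult_def algebra_simps)

lemma norm_bicomplex: "norm (W :: bicomplex) = sqrt ((cmod (Sc W))\<^sup>2 + (cmod (Vec W))\<^sup>2)"
  by (cases W) (simp add: norm_Pair)

definition bc_space :: "(complex \<Rightarrow> complex) set \<Rightarrow> (complex \<Rightarrow> bicomplex) set" where
  "bc_space \<F> = {F. (\<lambda>z. Sc (F z)) \<in> \<F> \<and> (\<lambda>z. Vec (F z)) \<in> \<F>}"

text \<open>A function on \<open>\<Omega>\<close> is a total function on \<^typ>\<open>complex\<close> whose values outside \<open>\<Omega>\<close> are
  irrelevant; only test functions are required to vanish there. Elements of the Lebesgue spaces are
  functions, not classes modulo null sets.\<close>

definition L_space :: "real \<Rightarrow> complex set \<Rightarrow> (complex \<Rightarrow> complex) set" where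
  "L_space p \<Omega> = {f. f \<in> borel_measurable (lebesgue_on \<Omega>) \<and>
                      integrable (lebesgue_on \<Omega>) (\<lambda>z. norm (f z) powr p)}"

definition L_inf :: "complex set \<Rightarrow> (complex \<Rightarrow> complex) set" where
  "L_inf \<Omega> = {f. f \<in> borel_measurable (lebesgue_on \<Omega>) \<and>
                  (\<exists>C. AE z in lebesgue_on \<Omega>. norm (f z) \<le> C)}"

definition L_loc :: "real \<Rightarrow> complex set \<Rightarrow> (complex \<Rightarrow> complex) set" where
  "L_loc p \<Omega> = {f. \<forall>K. compact K \<and> K \<subseteq> \<Omega> \<longrightarrow> f \<in> L_space p K}"

definition partial_x :: "(complex \<Rightarrow> 'a::real_normed_vector) \<Rightarrow> complex \<Rightarrow> 'a" where
  "partial_x f z = frechet_derivative f (at z) 1"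

definition partial_y :: "(complex \<Rightarrow> 'a::real_normed_vector) \<Rightarrow> complex \<Rightarrow> 'a" where
  "partial_y f z = frechet_derivative f (at z) \<i>"

text \<open>Differentiability here is real differentiability: \<^const>\<open>differentiable\<close> on \<^typ>\<open>complex\<close>
  refers to the Frechet derivative over the reals.\<close>

primrec C_k :: "nat \<Rightarrow> (complex \<Rightarrow> complex) \<Rightarrow> bool" where
  "C_k 0 f \<longleftrightarrow> continuous_on UNIV f"
| "C_k (Suc k) f \<longleftrightarrow> (\<forall>z. f differentiable (at z)) \<and> C_k k (partial_x f) \<and> C_k k (partial_y f)"

definition test_functions :: "complex set \<Rightarrow> (complex \<Rightarrow> complex) set" where
  "test_functions \<Omega> = {\<phi>. (\<forall>k. C_k k \<phi>) \<and>
                           compact (closure {z. \<phi> z \<noteq> 0}) \<and> closure {z. \<phi> z \<noteq> 0} \<subseteq> \<Omega>}"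

definition hoelder :: "real \<Rightarrow> complex set \<Rightarrow> (complex \<Rightarrow> complex) set" where
  "hoelder \<epsilon> S = {f. \<exists>C. \<forall>z\<in>S. \<forall>w\<in>S. dist (f z) (f w) \<le> C * dist z w powr \<epsilon>}"

text \<open>A single modification on a null set has to serve all disks simultaneously; the Hoelder
  constant may depend on the disk.\<close>

definition C_locdisk :: "real \<Rightarrow> complex set \<Rightarrow> (complex \<Rightarrow> bicomplex) set" where
  "C_locdisk \<epsilon> \<Omega> = {W. \<exists>W'. (AE z in lebesgue_on \<Omega>. W z = W' z) \<and>
     (\<forall>c r. r > 0 \<and> cball c r \<subseteq> \<Omega> \<longrightarrow> W' \<in> bc_space (hoelder \<epsilon> (cball c r)))}"

definition dbar :: "(complex \<Rightarrow> bicomplex) \<Rightarrow> complex \<Rightarrow> bicomplex" where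
  "dbar \<phi> z = (1/2) *\<^sub>R (partial_x \<phi> z + bc_j *\<^sub>B partial_y \<phi> z)"

definition weak_dbar ::
  "real \<Rightarrow> complex set \<Rightarrow> (complex \<Rightarrow> bicomplex) \<Rightarrow> (complex \<Rightarrow> bicomplex) \<Rightarrow> bool" where
  "weak_dbar p \<Omega> W V \<longleftrightarrow>
     W \<in> bc_space (L_space p \<Omega>) \<and> V \<in> bc_space (L_loc 1 \<Omega>) \<and>
     (\<forall>\<phi> \<in> bc_space (test_functions \<Omega>).
        integral\<^sup>L (lebesgue_on \<Omega>) (\<lambda>z. W z *\<^sub>B dbar \<phi> z)
          = - integral\<^sup>L (lebesgue_on \<Omega>) (\<lambda>z. V z *\<^sub>B \<phi> z))"

definition D_space :: "real \<Rightarrow> complex set \<Rightarrow> (complex \<Rightarrow> bicomplex) set" where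
  "D_space p \<Omega> = {W. W \<in> bc_space (L_space p \<Omega>) \<and>
                      (\<exists>U. weak_dbar p \<Omega> W U \<and> U \<in> bc_space (L_space p \<Omega>))}"

definition weak_solution ::
  "real \<Rightarrow> complex set \<Rightarrow> (complex \<Rightarrow> bicomplex) \<Rightarrow> (complex \<Rightarrow> bicomplex) \<Rightarrow>
   (complex \<Rightarrow> bicomplex) \<Rightarrow> (complex \<Rightarrow> bicomplex) \<Rightarrow> bool" where
  "weak_solution p \<Omega> a b V W \<longleftrightarrow>
     (\<exists>U. weak_dbar p \<Omega> W U \<and>
          (AE z in lebesgue_on \<Omega>. U z - a z *\<^sub>B W z - b z *\<^sub>B bc_cnj (W z) = V z))"

definition vekua_bergman ::
  "real \<Rightarrow> complex set \<Rightarrow> (complex \<Rightarrow> bicomplex) \<Rightarrow> (complex \<Rightarrow> bicomplex) \<Rightarrow>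
   (complex \<Rightarrow> bicomplex) set" where
  "vekua_bergman p \<Omega> a b =
     {W. W \<in> bc_space (L_space p \<Omega>) \<and> weak_solution p \<Omega> a b (\<lambda>_. 0) W}"

end

theory Submission
  imports Defs
begin

text \<open>The idempotents of the bicomplex algebra split the equation into two scalar equations
  \<open>dbar f = g\<close> (one of them after complex conjugation), coupled only through
  \<open>|g| \<le> C |W| + |V|\<close>. Testing with a cutoff \<open>\<chi>\<close> times the mollified Cauchy kernel
  \<open>cnj u / (|u|\<^sup>2 + e\<^sup>2)\<close> gives, for every point and every \<open>e > 0\<close>, an exact identity between
  \<open>\<chi> f\<close> smoothed by an approximate identity and the mollified Cauchy transform of
  \<open>H = \<chi> g + f dbar \<chi>\<close>; letting \<open>e\<close> tend to 0 represents \<open>\<chi> f\<close> as a multiple of the Cauchy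
  transform of \<open>H\<close>. That transform maps \<open>L\<^sup>s\<close>, \<open>1 < s < 2\<close>, to \<open>L\<^sup>t\<close> locally for
  \<open>t < 2s/(2-s)\<close>, and \<open>L\<^sup>r\<close>, \<open>r > 2\<close>, to Hoelder functions of exponent \<open>1 - 2/r\<close>. Two steps
  suffice: the first raises \<open>W\<close>, hence the right-hand side, to exponent \<open>r\<close> on a smaller disk,
  the second gives Hoelder continuity. For \<open>p \<ge> 2\<close> one starts from an exponent \<open>s < 2\<close> close
  to 2, which is possible since the domain is bounded.\<close>

section \<open>Smooth test functions\<close>

text \<open>The weak equation speaks only through test functions that are smooth to every order, and
  the Cauchy kernel is singular at its pole. Regularising the kernel, rather than \<open>W\<close>,
  keeps the argument exact at each \<open>e > 0\<close>: the cutoff times the kernel is admissible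
  and its dbar derivative is known in closed form, so nothing has to be known about derivatives of
  \<open>W\<close>. The number of steps is fixed by arithmetic: \<open>2s/(2-s) > 2\<close> exactly
  when \<open>s > 1\<close>, so one gain of integrability passes the threshold 2 above which the
  potential is Hoelder continuous. The two scalar components have to be improved together, because
  each right-hand side involves both. The strict bound \<open>t < 2s/(2-s)\<close> comes from
  Young's inequality for convolutions with \<open>|u|\<close> to the power \<open>-m\<close>, which
  is locally integrable only for \<open>m < 2\<close>. As \<open>s\<close> tends to 2 this bound
  tends to infinity, so for \<open>p >= 2\<close> only the exponent of \<open>V\<close> limits the
  result. Finally, \<open>C_locdisk\<close> asks for one modification of \<open>W\<close> for all
  disks, which a disk-by-disk construction does not give by itself.\<close>

definition expinv :: "nat \<Rightarrow> real \<Rightarrow> real" where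
  "expinv m t = (if t > 0 then exp (- inverse t) / t ^ m else 0)"

lemma expinv_pos: "t > 0 \<Longrightarrow> expinv m t > 0"
  by (simp add: expinv_def)

lemma expinv_tendsto_0: "(expinv m \<longlongrightarrow> 0) (at 0)"
proof -
  have "((\<lambda>t. inverse t ^ m / exp (inverse t)) \<longlongrightarrow> (0::real)) (at_right 0)"
    by (rule filterlim_compose[OF tendsto_power_div_exp_0 filterlim_inverse_at_top_right])
  moreover have "eventually (\<lambda>t. inverse t ^ m / exp (inverse t) = expinv m t) (at_right 0)"
    using eventually_at_right_less[of "0::real"]
    by eventually_elim (simp add: expinv_def exp_minus field_simps)
  ultimately have r: "(expinv m \<longlongrightarrow> 0) (at_right 0)"
    by (rule Lim_transform_eventually)
  have "eventually (\<lambda>t::real. t < 0) (at_left 0)"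
    by (simp add: eventually_at_filter)
  then have l: "(expinv m \<longlongrightarrow> 0) (at_left 0)"
    by (intro tendsto_eventually) (auto elim!: eventually_mono simp: expinv_def)
  show ?thesis
    using l r by (simp add: filterlim_split_at)
qed

text \<open>The powers of \<open>t\<close> in the denominator are there for this formula:
  differentiation maps the family indexed by \<open>m\<close> into its own linear span, so the
  classical bump function is smooth without any computation of higher derivatives.\<close>

lemma expinv_has_derivative:
  "(expinv m has_real_derivative (expinv (m + 2) t - real m * expinv (m + 1) t)) (at t)"
proof -
  consider "t > 0" | "t = 0" | "t < 0" by linarith
  then show ?thesis
  proof cases
    case 1
    have "((\<lambda>t. exp (- inverse t) / t ^ m) has_real_derivative
        (exp (- inverse t) * inverse (t^2) * t ^ m - exp (- inverse t) * (real m * t ^ (m - 1))) / (t ^ m * t ^ m)) (at t)"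
      using 1 by (auto intro!: derivative_eq_intros simp: power2_eq_square)
    moreover have "(exp (- inverse t) * inverse (t^2) * t ^ m - exp (- inverse t) * (real m * t ^ (m - 1))) / (t ^ m * t ^ m)
        = expinv (m + 2) t - real m * expinv (m + 1) t"
      using 1 by (cases m) (auto simp: expinv_def field_simps power2_eq_square)
    ultimately show ?thesis
      using 1 by (auto intro: has_field_derivative_transform_within_open[where S="{0<..}"] simp: expinv_def)
  next
    case 2
    \<comment> \<open>At 0 the difference quotient of \<open>expinv m\<close> is
      \<open>expinv (m + 1)\<close>, whose limit is already known to be 0.\<close>
    have "((\<lambda>h. (expinv m (0 + h) - expinv m 0) / h) \<longlongrightarrow> 0) (at 0)"
      by (rule Lim_transform_eventually[OF expinv_tendsto_0[of "m + 1"]])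
         (auto simp: expinv_def eventually_at_filter)
    then show ?thesis using 2 by (simp add: DERIV_def) (simp add: expinv_def)
  next
    case 3
    then show ?thesis
      by (auto intro: has_field_derivative_transform_within_open[of "\<lambda>_. 0" _ _ "{..<0}"] simp: expinv_def)
  qed
qed

text \<open>The induction on \<open>k\<close> treats all members of \<open>S\<close> at once,
  because the two coefficient functions of a derivative are members again. They multiply
  \<open>Re h\<close> and \<open>Im h\<close> since differentiability is over the reals.\<close>

lemma C_k_coinduct:
  assumes "\<And>f. f \<in> S \<Longrightarrow> \<exists>f1\<in>S. \<exists>f2\<in>S.
      \<forall>z. (f has_derivative (\<lambda>h. of_real (Re h) * f1 z + of_real (Im h) * f2 z)) (at z)"
    and "f \<in> S"
  shows "C_k k f"
  using assms(2)
proof (induction k arbitrary: f)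
  case 0
  obtain f1 f2 where "\<And>z. (f has_derivative (\<lambda>h. of_real (Re h) * f1 z + of_real (Im h) * f2 z)) (at z)"
    using assms(1)[OF 0] by blast
  then have "isCont f z" for z
    by (rule has_derivative_continuous)
  then show ?case
    by (simp add: continuous_at_imp_continuous_on)
next
  case (Suc k)
  obtain f1 f2 where S: "f1 \<in> S" "f2 \<in> S" and d:
    "\<And>z. (f has_derivative (\<lambda>h. of_real (Re h) * f1 z + of_real (Im h) * f2 z)) (at z)"
    using assms(1)[OF Suc.prems] by blast
  have "frechet_derivative f (at z) = (\<lambda>h. of_real (Re h) * f1 z + of_real (Im h) * f2 z)" for z
    by (rule frechet_derivative_at[OF d, symmetric])
  then have "partial_x f = f1" "partial_y f = f2"
    by (simp_all add: partial_x_def partial_y_def fun_eq_iff)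
  moreover have "f differentiable (at z)" for z
    using d by (rule differentiableI)
  ultimately show ?case using Suc.IH[OF S(1)] Suc.IH[OF S(2)] by simp
qed

text \<open>The partial derivatives of a generator are polynomials in generators, so this algebra is
  closed under both and its elements are smooth by \<open>C_k_coinduct\<close>.\<close>

inductive_set smooth_alg :: "real \<Rightarrow> complex \<Rightarrow> complex \<Rightarrow> real \<Rightarrow> (complex \<Rightarrow> complex) set"
  for R c \<zeta> e where
  const: "(\<lambda>_. k) \<in> smooth_alg R c \<zeta> e"
| re: "(\<lambda>z. of_real (Re z)) \<in> smooth_alg R c \<zeta> e"
| im: "(\<lambda>z. of_real (Im z)) \<in> smooth_alg R c \<zeta> e"
| bump: "(\<lambda>z. of_real (expinv m (R\<^sup>2 - (norm (z - c))\<^sup>2))) \<in> smooth_alg R c \<zeta> e"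
| rat: "(\<lambda>z. of_real (1 / ((norm (z - \<zeta>))\<^sup>2 + e\<^sup>2))) \<in> smooth_alg R c \<zeta> e"
| add: "f \<in> smooth_alg R c \<zeta> e \<Longrightarrow> g \<in> smooth_alg R c \<zeta> e \<Longrightarrow> (\<lambda>z. f z + g z) \<in> smooth_alg R c \<zeta> e"
| mult: "f \<in> smooth_alg R c \<zeta> e \<Longrightarrow> g \<in> smooth_alg R c \<zeta> e \<Longrightarrow> (\<lambda>z. f z * g z) \<in> smooth_alg R c \<zeta> e"

text \<open>The squared norm is a polynomial in the two real coordinates, so the chain rule also
  applies at the centre, where the norm itself is not differentiable. Serves both the bump and the
  rational generator.\<close>

lemma grad_radial: assumes e: "(f has_real_derivative d) (at ((norm (z - c))\<^sup>2))"
 shows "((\<lambda>z. of_real (f ((norm (z - c))\<^sup>2)) :: complex) has_derivative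
    (\<lambda>h. of_real (Re h) * (of_real (2 * (Re z - Re c)) * of_real d)
       + of_real (Im h) * (of_real (2 * (Im z - Im c)) * of_real d))) (at z)"
proof -
  have n: "(norm (z - c))\<^sup>2 = (Re z - Re c)\<^sup>2 + (Im z - Im c)\<^sup>2" for z
    by (simp add: cmod_power2)
  have "((\<lambda>z. (Re z - Re c)\<^sup>2 + (Im z - Im c)\<^sup>2) has_derivative
     (\<lambda>h. 2 * Re h * (Re z - Re c) + 2 * Im h * (Im z - Im c))) (at z)"
    by (auto intro!: derivative_eq_intros simp: fun_eq_iff)
  then have "((\<lambda>z. (norm (z - c))\<^sup>2) has_derivative
     (\<lambda>h. 2 * Re h * (Re z - Re c) + 2 * Im h * (Im z - Im c))) (at z)"
    unfolding n .
  then have "((\<lambda>z. f ((norm (z - c))\<^sup>2)) has_derivative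
     (\<lambda>h. d * (2 * Re h * (Re z - Re c) + 2 * Im h * (Im z - Im c)))) (at z)"
    using has_derivative_compose[of "\<lambda>z. (norm (z - c))\<^sup>2" _ z UNIV f "times d"] e
    by (simp add: has_field_derivative_def)
  then have "((\<lambda>z. complex_of_real (f ((norm (z - c))\<^sup>2))) has_derivative
     (\<lambda>h. complex_of_real (d * (2 * Re h * (Re z - Re c) + 2 * Im h * (Im z - Im c))))) (at z)"
    by (rule has_derivative_of_real)
  moreover have "(\<lambda>h. complex_of_real (d * (2 * Re h * (Re z - Re c) + 2 * Im h * (Im z - Im c)))) =
   (\<lambda>h. of_real (Re h) * (of_real (2 * (Re z - Re c)) * of_real d)
       + of_real (Im h) * (of_real (2 * (Im z - Im c)) * of_real d))"
    by (rule ext, simp only: of_real_mult[symmetric] of_real_add[symmetric] of_real_eq_iff, simp add: algebra_simps)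
  ultimately show ?thesis by (simp only:)
qed

lemma bump_has_derivative:
  "((\<lambda>z. of_real (expinv m (R\<^sup>2 - (norm (z - c))\<^sup>2)) :: complex) has_derivative
    (\<lambda>h. of_real (Re h) * (of_real (2 * (Re z - Re c)) *
          of_real (real m * expinv (m + 1) (R\<^sup>2 - (norm (z - c))\<^sup>2) - expinv (m + 2) (R\<^sup>2 - (norm (z - c))\<^sup>2)))
      + of_real (Im h) * (of_real (2 * (Im z - Im c)) *
          of_real (real m * expinv (m + 1) (R\<^sup>2 - (norm (z - c))\<^sup>2) - expinv (m + 2) (R\<^sup>2 - (norm (z - c))\<^sup>2))))) (at z)"
proof -
  have "((\<lambda>t. expinv m (R\<^sup>2 - t)) has_real_derivative
     (expinv (m + 2) (R\<^sup>2 - t) - real m * expinv (m + 1) (R\<^sup>2 - t)) * (0 - 1)) (at t)" for t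
    by (rule DERIV_chain2[OF expinv_has_derivative]) (auto intro!: derivative_eq_intros)
  then have "((\<lambda>t. expinv m (R\<^sup>2 - t)) has_real_derivative
     (real m * expinv (m + 1) (R\<^sup>2 - t) - expinv (m + 2) (R\<^sup>2 - t))) (at t)" for t
    by simp
  then show ?thesis by (rule grad_radial)
qed

lemma rat_has_derivative:
  assumes "e > 0"
  shows "((\<lambda>z. of_real (1 / ((norm (z - \<zeta>))\<^sup>2 + e\<^sup>2)) :: complex) has_derivative
    (\<lambda>h. of_real (Re h) * (of_real (2 * (Re z - Re \<zeta>)) *
          of_real (- (1 / ((norm (z - \<zeta>))\<^sup>2 + e\<^sup>2) * (1 / ((norm (z - \<zeta>))\<^sup>2 + e\<^sup>2)))))
      + of_real (Im h) * (of_real (2 * (Im z - Im \<zeta>)) *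
          of_real (- (1 / ((norm (z - \<zeta>))\<^sup>2 + e\<^sup>2) * (1 / ((norm (z - \<zeta>))\<^sup>2 + e\<^sup>2))))))) (at z)"
proof -
  have "((\<lambda>t. 1 / (t + e\<^sup>2)) has_real_derivative - (1 / (t + e\<^sup>2) * (1 / (t + e\<^sup>2)))) (at t)" if "t \<ge> 0" for t
  proof -
    have "t + e\<^sup>2 \<noteq> 0" using that assms by (smt (verit) zero_less_power)
    then show ?thesis by (auto intro!: derivative_eq_intros)
  qed
  then have "((\<lambda>t. 1 / (t + e\<^sup>2)) has_real_derivative
     - (1 / ((norm (z - \<zeta>))\<^sup>2 + e\<^sup>2) * (1 / ((norm (z - \<zeta>))\<^sup>2 + e\<^sup>2)))) (at ((norm (z - \<zeta>))\<^sup>2))" by simp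
  then show ?thesis by (rule grad_radial)
qed

lemma smooth_alg_diff:
  "f \<in> smooth_alg R c \<zeta> e \<Longrightarrow> g \<in> smooth_alg R c \<zeta> e \<Longrightarrow> (\<lambda>z. f z - g z) \<in> smooth_alg R c \<zeta> e"
  using smooth_alg.add[OF _ smooth_alg.mult[OF smooth_alg.const[of "-1"]]] by fastforce

lemma smooth_alg_minus: "f \<in> smooth_alg R c \<zeta> e \<Longrightarrow> (\<lambda>z. - f z) \<in> smooth_alg R c \<zeta> e"
  using smooth_alg_diff[OF smooth_alg.const[of 0]] by simp

lemma smooth_alg_smooth:
  assumes e: "e > 0" and f: "f \<in> smooth_alg R c \<zeta> e"
  shows "C_k k f"
proof (rule C_k_coinduct[OF _ f])
  fix f
  have grad: "\<exists>f1\<in>smooth_alg R c \<zeta> e. \<exists>f2\<in>smooth_alg R c \<zeta> e.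
      \<forall>z. (f has_derivative (\<lambda>h. of_real (Re h) * f1 z + of_real (Im h) * f2 z)) (at z)"
    if "\<And>z. (f has_derivative (\<lambda>h. of_real (Re h) * f1 z + of_real (Im h) * f2 z)) (at z)"
      "f1 \<in> smooth_alg R c \<zeta> e" "f2 \<in> smooth_alg R c \<zeta> e" for f f1 f2
    using that by blast
  assume "f \<in> smooth_alg R c \<zeta> e"
  then show "\<exists>f1\<in>smooth_alg R c \<zeta> e. \<exists>f2\<in>smooth_alg R c \<zeta> e.
      \<forall>z. (f has_derivative (\<lambda>h. of_real (Re h) * f1 z + of_real (Im h) * f2 z)) (at z)"
  proof induction
    case (const k)
    show ?case
      by (rule grad[where ?f1.0="\<lambda>_. 0" and ?f2.0="\<lambda>_. 0"]) (auto intro: smooth_alg.const)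
  next
    case re
    show ?case
      by (rule grad[where ?f1.0="\<lambda>_. 1" and ?f2.0="\<lambda>_. 0"])
         (auto intro!: smooth_alg.const derivative_eq_intros)
  next
    case im
    show ?case
      by (rule grad[where ?f1.0="\<lambda>_. 0" and ?f2.0="\<lambda>_. 1"])
         (auto intro!: smooth_alg.const derivative_eq_intros)
  next
    case (bump m)
    show ?case
      by (rule grad, rule bump_has_derivative)
         (simp_all only: of_real_mult of_real_diff,
          (intro smooth_alg.mult smooth_alg_diff smooth_alg.const smooth_alg.re smooth_alg.im smooth_alg.bump)+)
  next
    case rat
    show ?case
      by (rule grad, rule rat_has_derivative[OF e])
         (simp_all only: of_real_mult of_real_minus of_real_diff,
          (intro smooth_alg.mult smooth_alg_diff smooth_alg.const smooth_alg.re smooth_alg.im smooth_alg.rat smooth_alg_minus)+)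
  next
    case (add f g)
    then obtain f1 f2 g1 g2 where S: "f1 \<in> smooth_alg R c \<zeta> e" "f2 \<in> smooth_alg R c \<zeta> e"
        "g1 \<in> smooth_alg R c \<zeta> e" "g2 \<in> smooth_alg R c \<zeta> e"
      and d: "\<And>z. (f has_derivative (\<lambda>h. of_real (Re h) * f1 z + of_real (Im h) * f2 z)) (at z)"
        "\<And>z. (g has_derivative (\<lambda>h. of_real (Re h) * g1 z + of_real (Im h) * g2 z)) (at z)"
      by blast
    show ?case
      by (rule grad[where ?f1.0="\<lambda>z. f1 z + g1 z" and ?f2.0="\<lambda>z. f2 z + g2 z"])
         (auto intro!: smooth_alg.add S has_derivative_eq_rhs[OF has_derivative_add[OF d]] simp: algebra_simps)
  next
    case (mult f g)
    then obtain f1 f2 g1 g2 where S: "f1 \<in> smooth_alg R c \<zeta> e" "f2 \<in> smooth_alg R c \<zeta> e"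
        "g1 \<in> smooth_alg R c \<zeta> e" "g2 \<in> smooth_alg R c \<zeta> e"
      and d: "\<And>z. (f has_derivative (\<lambda>h. of_real (Re h) * f1 z + of_real (Im h) * f2 z)) (at z)"
        "\<And>z. (g has_derivative (\<lambda>h. of_real (Re h) * g1 z + of_real (Im h) * g2 z)) (at z)"
      by blast
    show ?case
      by (rule grad[where ?f1.0="\<lambda>z. f z * g1 z + f1 z * g z" and ?f2.0="\<lambda>z. f z * g2 z + f2 z * g z"])
         (auto intro!: smooth_alg.add smooth_alg.mult S mult.hyps has_derivative_eq_rhs[OF has_derivative_mult[OF d]] simp: algebra_simps)
  qed
qed

text \<open>No plateau on which the cutoff equals 1 is required: it is positive on the open ball,
  and the localised function is recovered by dividing by it.\<close>

definition cutoff :: "complex \<Rightarrow> real \<Rightarrow> complex \<Rightarrow> real" where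
  "cutoff c R z = expinv 0 (R\<^sup>2 - (norm (z - c))\<^sup>2)"

definition cauchy_reg :: "real \<Rightarrow> complex \<Rightarrow> complex" where
  "cauchy_reg e u = cnj u / of_real ((norm u)\<^sup>2 + e\<^sup>2)"

lemma cutoff_eq_0: "norm (z - c) \<ge> R \<Longrightarrow> R \<ge> 0 \<Longrightarrow> cutoff c R z = 0"
  by (simp add: cutoff_def expinv_def) (meson abs_norm_cancel not_less power_mono)

text \<open>Expanded in real coordinates, the conjugate in the kernel becomes a combination of the
  generators \<open>re\<close> and \<open>im\<close>, so the product lies in
  \<open>smooth_alg\<close>. The support stays in the closed ball because of the cutoff.\<close>

lemma test_function_cutoff:
  assumes "e > 0" "R > 0" "cball c R \<subseteq> \<Omega>"
  shows "(\<lambda>z. of_real (cutoff c R z) * cauchy_reg e (\<zeta> - z)) \<in> test_functions \<Omega>"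
proof -
  have cn: "cauchy_reg e (\<zeta> - z) = ((of_real (Re \<zeta>) - of_real (Re z)) - \<i> * (of_real (Im \<zeta>) - of_real (Im z)))
      * of_real (1 / ((norm (z - \<zeta>))\<^sup>2 + e\<^sup>2))" for z
    by (simp add: cauchy_reg_def complex_eq_iff norm_minus_commute[of \<zeta>])
  have A: "(\<lambda>z. of_real (cutoff c R z) * cauchy_reg e (\<zeta> - z)) \<in> smooth_alg R c \<zeta> e"
    unfolding cn cutoff_def
    by (intro smooth_alg.mult smooth_alg_diff smooth_alg.const smooth_alg.re smooth_alg.im
        smooth_alg.rat smooth_alg.bump)
  have "{z. of_real (cutoff c R z) * cauchy_reg e (\<zeta> - z) \<noteq> 0} \<subseteq> cball c R"
    using cutoff_eq_0[of R _ c] assms(2) by (force simp: dist_norm norm_minus_commute)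
  then have "closure {z. of_real (cutoff c R z) * cauchy_reg e (\<zeta> - z) \<noteq> 0} \<subseteq> cball c R"
    by (simp add: closure_minimal)
  then show ?thesis
    using assms smooth_alg_smooth[OF assms(1) A]
    by (auto simp: test_functions_def compact_eq_bounded_closed intro: bounded_subset)
qed

text \<open>The factor multiplying the cutoff is \<open>\<psi>(u/e) / e\<^sup>2\<close> with \<open>\<psi>(w) = 1 / (1 + |w|\<^sup>2)\<^sup>2\<close>, an
  approximate identity up to normalisation.\<close>
lemma dbar_cutoff:
  fixes \<zeta> c :: complex and R :: real
  assumes "e > 0"
  defines "\<phi> \<equiv> \<lambda>z. of_real (cutoff c R z) * cauchy_reg e (\<zeta> - z)"
  shows "(partial_x \<phi> z + \<i> * partial_y \<phi> z) / 2 =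
     (c - z) * of_real (expinv 2 (R\<^sup>2 - (norm (z - c))\<^sup>2)) * cauchy_reg e (\<zeta> - z)
     - of_real (cutoff c R z * (e\<^sup>2 / ((norm (z - \<zeta>))\<^sup>2 + e\<^sup>2)\<^sup>2))"
proof -
  define B where "B = complex_of_real (expinv 0 (R\<^sup>2 - (norm (z - c))\<^sup>2))"
  define E where "E = complex_of_real (expinv 2 (R\<^sup>2 - (norm (z - c))\<^sup>2))"
  define Q where "Q = complex_of_real (1 / ((norm (z - \<zeta>))\<^sup>2 + e\<^sup>2))"
  let ?D = "\<lambda>h. (of_real (Re h) * (of_real (2 * (Re z - Re c)) * - E) + of_real (Im h) * (of_real (2 * (Im z - Im c)) * - E))"
  let ?DQ = "\<lambda>h. of_real (Re h) * (of_real (2 * (Re z - Re \<zeta>)) * - (Q * Q)) + of_real (Im h) * (of_real (2 * (Im z - Im \<zeta>)) * - (Q * Q))"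
  have phi: "\<phi> = (\<lambda>z. of_real (expinv 0 (R\<^sup>2 - (norm (z - c))\<^sup>2)) * (cnj (\<zeta> - z) * of_real (1 / ((norm (z - \<zeta>))\<^sup>2 + e\<^sup>2))))"
    by (simp add: \<phi>_def cutoff_def cauchy_reg_def norm_minus_commute[of \<zeta>])
  \<comment> \<open>For \<open>m = 0\<close> only the term with \<open>expinv 2\<close> survives in
    the derivative, whence \<open>E\<close>.\<close>
  have 1: "((\<lambda>z. of_real (expinv 0 (R\<^sup>2 - (norm (z - c))\<^sup>2))) has_derivative ?D) (at z)"
    by (rule has_derivative_eq_rhs[OF bump_has_derivative]) (simp add: E_def fun_eq_iff numeral_2_eq_2)
  have 2: "((\<lambda>z. cnj (\<zeta> - z)) has_derivative (\<lambda>h. - cnj h)) (at z)"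
    by (auto intro!: derivative_eq_intros)
  have 3: "((\<lambda>z. of_real (1 / ((norm (z - \<zeta>))\<^sup>2 + e\<^sup>2))) has_derivative ?DQ) (at z)"
    by (rule has_derivative_eq_rhs[OF rat_has_derivative[OF assms(1)]]) (simp add: Q_def fun_eq_iff)
  have d: "(\<phi> has_derivative (\<lambda>h. B * (cnj (\<zeta> - z) * ?DQ h + - cnj h * Q) + ?D h * (cnj (\<zeta> - z) * Q))) (at z)"
    unfolding phi B_def Q_def by (rule has_derivative_mult[OF 1 has_derivative_mult[OF 2 3[unfolded Q_def]]])
  have F: "frechet_derivative \<phi> (at z) = (\<lambda>h. B * (cnj (\<zeta> - z) * ?DQ h + - cnj h * Q) + ?D h * (cnj (\<zeta> - z) * Q))"
    by (rule frechet_derivative_at[OF d, symmetric])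
  have zc: "of_real (Re z - Re c) + \<i> * of_real (Im z - Im c) = z - c"
      "of_real (Re \<zeta> - Re z) + \<i> * of_real (Im \<zeta> - Im z) = \<zeta> - z"
    by (simp_all add: complex_eq_iff)
  have "partial_x \<phi> z + \<i> * partial_y \<phi> z = 2 * (B * (cnj (\<zeta> - z) * (of_real (Re \<zeta> - Re z) + \<i> * of_real (Im \<zeta> - Im z)) * (Q * Q) - Q)
     - (of_real (Re z - Re c) + \<i> * of_real (Im z - Im c)) * E * (cnj (\<zeta> - z) * Q))"
    unfolding partial_x_def partial_y_def F by (simp add: algebra_simps)
  then have "(partial_x \<phi> z + \<i> * partial_y \<phi> z) / 2 = B * (cnj (\<zeta> - z) * (of_real (Re \<zeta> - Re z) + \<i> * of_real (Im \<zeta> - Im z)) * (Q * Q) - Q)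
     - (of_real (Re z - Re c) + \<i> * of_real (Im z - Im c)) * E * (cnj (\<zeta> - z) * Q)"
    by simp
  also have "\<dots> = B * ((cnj (\<zeta> - z) * (\<zeta> - z)) * (Q * Q) - Q) + (c - z) * E * (cnj (\<zeta> - z) * Q)"
    by (simp only: zc mult.assoc) (simp add: algebra_simps)
  also have "cnj (\<zeta> - z) * (\<zeta> - z) = of_real ((norm (z - \<zeta>))\<^sup>2)"
    using complex_norm_square[of "\<zeta> - z"] norm_minus_commute[of \<zeta> z] by (simp add: mult.commute)
  \<comment> \<open>With \<open>S\<close> the denominator, the squared distance is
    \<open>S - e^2\<close> and \<open>Q = 1/S\<close>, so the terms cancel up to
    \<open>- e^2 / S^2\<close>. The Cauchy kernel is holomorphic off its pole; what the
    regularisation adds is this concentrating remainder.\<close>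
  also have "of_real ((norm (z - \<zeta>))\<^sup>2) * (Q * Q) - Q = - of_real (e\<^sup>2 / ((norm (z - \<zeta>))\<^sup>2 + e\<^sup>2)\<^sup>2)"
  proof -
    have *: "(norm (z - \<zeta>))\<^sup>2 + e\<^sup>2 > 0" using assms by (intro add_nonneg_pos) auto
    have "(norm (z - \<zeta>))\<^sup>2 * (1 / ((norm (z - \<zeta>))\<^sup>2 + e\<^sup>2) * (1 / ((norm (z - \<zeta>))\<^sup>2 + e\<^sup>2))) - 1 / ((norm (z - \<zeta>))\<^sup>2 + e\<^sup>2)
        = - (e\<^sup>2 / ((norm (z - \<zeta>))\<^sup>2 + e\<^sup>2)\<^sup>2)"
    proof -
      have "(S - d) * (1 / S * (1 / S)) - 1 / S = - (d / S\<^sup>2)" if "S \<noteq> 0" for S d :: real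
        using that by (simp add: field_simps power2_eq_square)
      from this[of "(norm (z - \<zeta>))\<^sup>2 + e\<^sup>2" "e\<^sup>2"] * show ?thesis
        by (metis add_diff_cancel_right' order_less_irrefl)
    qed
    then show ?thesis unfolding Q_def
      by (simp only: of_real_mult[symmetric] of_real_diff[symmetric] of_real_minus[symmetric] of_real_eq_iff)
  qed
  finally show ?thesis by (simp add: cutoff_def cauchy_reg_def norm_minus_commute[of \<zeta>] B_def E_def Q_def)
qed

section \<open>Integrals of singular kernels\<close>

lemma nn_integral_affine:
  fixes f :: "'a::euclidean_space \<Rightarrow> ennreal"
  assumes [measurable]: "f \<in> borel_measurable borel" and c: "c \<noteq> 0"
  shows "(\<integral>\<^sup>+x. f x \<partial>lborel) = ennreal (\<bar>c\<bar> ^ DIM('a)) * (\<integral>\<^sup>+x. f (t + c *\<^sub>R x) \<partial>lborel)"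
  by (subst lborel_affine[OF c, of t])
     (simp add: nn_integral_density nn_integral_distr nn_integral_cmult)

lemma integral_affine:
  fixes f :: "'a::euclidean_space \<Rightarrow> 'b::{banach,second_countable_topology}"
  assumes [measurable]: "f \<in> borel_measurable borel" and c: "c \<noteq> 0"
  shows "(\<integral>x. f x \<partial>lborel) = \<bar>c\<bar> ^ DIM('a) *\<^sub>R (\<integral>x. f (t + c *\<^sub>R x) \<partial>lborel)"
  by (subst lborel_affine[OF c, of t])
     (simp add: integral_density integral_distr)

text \<open>A dyadic decomposition in place of polar coordinates. The annuli \<open>c ^ k\<close>
  times \<open>A\<close> cover the region, and scaling turns the integral over the k-th one into
  \<open>(c powr (2 - \<alpha>)) ^ k\<close> times the one for \<open>k = 0\<close>, the 2 being the
  real dimension; the geometric series converges by the hypothesis on \<open>c\<close>. The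
  condition on \<open>log c (norm w)\<close> describes the punctured closed unit disk for
  \<open>c = 1/2\<close> and the complement of the open unit disk for \<open>c = 2\<close>.\<close>

lemma nn_integral_powr_dyadic:
  fixes c \<alpha> :: real
  assumes c: "c = 1 / 2 \<or> c = 2" and q: "c powr (2 - \<alpha>) < 1"
  shows "(\<integral>\<^sup>+w. indicator {w::complex. w \<noteq> 0 \<and> log c (norm w) \<ge> 0} w * ennreal (norm w powr - \<alpha>) \<partial>lborel) < \<infinity>"
proof -
  \<comment> \<open>Wide enough for both values of \<open>c\<close>. Neighbouring annuli overlap,
    which is harmless because the sum is only an upper bound.\<close>
  define A where "A = {w::complex. 1 / 2 \<le> norm w \<and> norm w \<le> 2}"
  define F where "F k w = (indicator A ((1 / c ^ k) *\<^sub>R w) * ennreal (norm w powr - \<alpha>))" for k :: nat and w :: complex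
  have cpos: "c > 0" "c \<noteq> 1" and c2: "1 / 2 \<le> c" "c \<le> 2" using c by auto
  have [measurable]: "A \<in> sets borel" unfolding A_def by measurable
  have [measurable]: "F k \<in> borel_measurable borel" for k unfolding F_def by measurable
  have cover: "\<exists>k. w \<in> {w. (1 / c ^ k) *\<^sub>R w \<in> A}" if "w \<noteq> 0" "log c (norm w) \<ge> 0" for w
  proof -
    define l where "l = log c (norm w)"
    \<comment> \<open>With the integer part of the logarithm, \<open>norm w / c ^ k\<close> is
      \<open>c\<close> to a power between 0 and 1.\<close>
    define k where "k = nat \<lfloor>l\<rfloor>"
    have k: "0 \<le> l - real k" "l - real k \<le> 1" using that unfolding k_def l_def by linarith+
    have "norm w = c powr (real k + (l - real k))" using that cpos by (simp add: l_def)
    also have "\<dots> = c ^ k * c powr (l - real k)" unfolding powr_add using cpos by (simp add: powr_realpow)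
    finally have n: "norm w / c ^ k = c powr (l - real k)" using cpos by simp
    have "1 / 2 \<le> c powr (l - real k) \<and> c powr (l - real k) \<le> 2"
      using c
    proof
      assume *: "c = 1 / 2"
      have "(1/2::real) powr 1 \<le> (1/2::real) powr (l - real k)" using k by (intro powr_mono') auto
      moreover have "(1/2::real) powr (l - real k) \<le> (1/2) powr 0" using k by (intro powr_mono') auto
      ultimately show ?thesis unfolding * by simp
    next
      assume *: "c = 2"
      have "2 powr 0 \<le> (2::real) powr (l - real k)" using k by (intro powr_mono) auto
      moreover have "(2::real) powr (l - real k) \<le> 2 powr 1" using k by (intro powr_mono) auto
      ultimately show ?thesis using * by simp
    qed
    moreover have m: "norm ((1 / c ^ k) *\<^sub>R w) = c powr (l - real k)"
      using n cpos by simp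
    ultimately have "(1 / c ^ k) *\<^sub>R w \<in> A"
      unfolding A_def mem_Collect_eq m by simp
    then show ?thesis by blast
  qed
  have scale: "(\<integral>\<^sup>+w. F k w \<partial>lborel) = ennreal ((c powr (2 - \<alpha>)) ^ k) * (\<integral>\<^sup>+w. F 0 w \<partial>lborel)" for k
  proof -
    have "(\<integral>\<^sup>+w. F k w \<partial>lborel) = ennreal ((c ^ k)\<^sup>2) * (\<integral>\<^sup>+w. F k (0 + (c ^ k) *\<^sub>R w) \<partial>lborel)"
      using nn_integral_affine[of "F k" "c ^ k" 0] cpos by simp
    also have "(\<integral>\<^sup>+w. F k (0 + (c ^ k) *\<^sub>R w) \<partial>lborel) = (\<integral>\<^sup>+w. ennreal ((c ^ k) powr - \<alpha>) * F 0 w \<partial>lborel)"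
      using cpos by (intro nn_integral_cong) (simp add: F_def powr_mult ennreal_mult' mult_ac)
    also have "\<dots> = ennreal ((c ^ k) powr - \<alpha>) * (\<integral>\<^sup>+w. F 0 w \<partial>lborel)"
      by (rule nn_integral_cmult) simp
    also have "ennreal ((c ^ k)\<^sup>2) * (ennreal ((c ^ k) powr - \<alpha>) * (\<integral>\<^sup>+w. F 0 w \<partial>lborel)) =
        ennreal ((c ^ k)\<^sup>2 * (c ^ k) powr - \<alpha>) * (\<integral>\<^sup>+w. F 0 w \<partial>lborel)"
      by (simp add: ennreal_mult' mult.assoc)
    also have "(c ^ k)\<^sup>2 * (c ^ k) powr - \<alpha> = (c powr (2 - \<alpha>)) ^ k"
    proof -
      have "(c ^ k)\<^sup>2 * (c ^ k) powr - \<alpha> = (c ^ k) powr 2 * (c ^ k) powr - \<alpha>" using cpos by (simp add: powr_numeral)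
      also have "\<dots> = (c ^ k) powr (2 - \<alpha>)" by (simp add: powr_add[symmetric])
      also have "\<dots> = (c powr (2 - \<alpha>)) ^ k" using cpos by (simp add: powr_realpow[symmetric] powr_powr mult.commute)
      finally show ?thesis .
    qed
    finally show ?thesis .
  qed
  have fin0: "(\<integral>\<^sup>+w. F 0 w \<partial>lborel) < \<infinity>"
  proof -
    have "(\<integral>\<^sup>+w. F 0 w \<partial>lborel) \<le> (\<integral>\<^sup>+w. ennreal (2 powr \<bar>\<alpha>\<bar>) * indicator (cball 0 2) w \<partial>(lborel :: complex measure))"
    proof (rule nn_integral_mono)
      fix w :: complex
      have "norm w powr - \<alpha> \<le> 2 powr \<bar>\<alpha>\<bar>" if "w \<in> A"
      proof -
        have *: "1/2 \<le> norm w" "norm w \<le> 2" using that by (auto simp: A_def)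
        then have pos: "0 < norm w" by linarith
        have a: "ln (norm w) \<le> ln 2" using * pos by simp
        have "ln (1 / 2) \<le> ln (norm w)" using * pos by (subst ln_le_cancel_iff) auto
        then have b: "- ln (norm w) \<le> ln 2" by (simp add: ln_div)
        have l: "\<bar>ln (norm w)\<bar> \<le> ln 2" by (rule abs_leI[OF a b])
        have "- \<alpha> * ln (norm w) \<le> \<bar>\<alpha>\<bar> * \<bar>ln (norm w)\<bar>" using abs_ge_self[of "- \<alpha> * ln (norm w)"] by (simp add: abs_mult)
        also have "\<dots> \<le> \<bar>\<alpha>\<bar> * ln 2" using l by (intro mult_left_mono) auto
        finally show ?thesis using pos by (auto simp: powr_def)
      qed
      then show "F 0 w \<le> ennreal (2 powr \<bar>\<alpha>\<bar>) * indicator (cball 0 2) w"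
        by (auto simp: F_def A_def indicator_def intro!: ennreal_leI)
    qed
    also have "\<dots> = ennreal (2 powr \<bar>\<alpha>\<bar>) * emeasure (lborel :: complex measure) (cball 0 2)"
      by (simp add: nn_integral_cmult_indicator)
    also have "\<dots> < \<infinity>"
      using emeasure_lborel_cball_finite[of "0::complex" 2] by (simp add: ennreal_mult_less_top)
    finally show ?thesis .
  qed
  have "(\<integral>\<^sup>+w. indicator {w::complex. w \<noteq> 0 \<and> log c (norm w) \<ge> 0} w * ennreal (norm w powr - \<alpha>) \<partial>lborel)
      \<le> (\<integral>\<^sup>+w. (\<Sum>k. F k w) \<partial>lborel)"
  proof (rule nn_integral_mono)
    fix w :: complex
    show "indicator {w::complex. w \<noteq> 0 \<and> log c (norm w) \<ge> 0} w * ennreal (norm w powr - \<alpha>) \<le> (\<Sum>k. F k w)"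
    proof (cases "w \<noteq> 0 \<and> log c (norm w) \<ge> 0")
      case True
      then obtain k where k: "(1 / c ^ k) *\<^sub>R w \<in> A" using cover by blast
      have "F k w \<le> (\<Sum>k. F k w)" using sum_le_suminf[of "\<lambda>k. F k w" "{k}"] by simp
      with True k show ?thesis by (auto simp: F_def)
    qed auto
  qed
  also have "\<dots> = (\<Sum>k. \<integral>\<^sup>+w. F k w \<partial>lborel)"
    by (rule nn_integral_suminf) simp
  also have "\<dots> = (\<Sum>k. ennreal ((c powr (2 - \<alpha>)) ^ k)) * (\<integral>\<^sup>+w. F 0 w \<partial>lborel)"
    by (subst scale, rule ennreal_suminf_multc)
  also have "\<dots> < \<infinity>"
  proof -
    have "(\<Sum>k. ennreal ((c powr (2 - \<alpha>)) ^ k)) < \<infinity>"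
      using q by (subst suminf_ennreal2) (auto intro!: summable_geometric)
    then show ?thesis using fin0 by (simp add: ennreal_mult_less_top)
  qed
  finally show ?thesis .
qed

lemma nn_integral_powr_near:
  assumes "\<alpha> < 2"
  shows "(\<integral>\<^sup>+w. indicator (ball 0 1) w * ennreal (norm w powr - \<alpha>) \<partial>(lborel :: complex measure)) < \<infinity>"
proof -
  have "(1 / 2 :: real) powr (2 - \<alpha>) < (1 / 2) powr 0"
    using assms by (intro powr_less_mono') auto
  then have *: "(\<integral>\<^sup>+w. indicator {w::complex. w \<noteq> 0 \<and> log (1/2) (norm w) \<ge> 0} w * ennreal (norm w powr - \<alpha>) \<partial>lborel) < \<infinity>"
    by (intro nn_integral_powr_dyadic) auto
  have "log (1/2) (norm w) \<ge> 0" if "norm w < 1" "w \<noteq> 0" for w :: complex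
    using that by (simp add: log_def ln_div divide_nonpos_pos)
  then show ?thesis
    by (intro le_less_trans[OF nn_integral_mono *]) (auto simp: indicator_def)
qed

lemma nn_integral_powr_far:
  assumes "\<alpha> > 2"
  shows "(\<integral>\<^sup>+w. indicator (- ball 0 1) w * ennreal (norm w powr - \<alpha>) \<partial>(lborel :: complex measure)) < \<infinity>"
proof -
  have "(2 :: real) powr (2 - \<alpha>) < 2 powr 0"
    using assms by (intro powr_less_mono) auto
  then have *: "(\<integral>\<^sup>+w. indicator {w::complex. w \<noteq> 0 \<and> log 2 (norm w) \<ge> 0} w * ennreal (norm w powr - \<alpha>) \<partial>lborel) < \<infinity>"
    by (intro nn_integral_powr_dyadic) auto
  show ?thesis
    by (rule le_less_trans[OF nn_integral_mono *]) (auto simp: indicator_def log_def)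
qed

lemma ball_borel [measurable]: "ball c r \<in> sets borel"
  by simp

lemma cball_borel [measurable]: "cball c r \<in> sets borel"
  by simp

text \<open>Within distance 1 of \<zeta> a translation removes \<zeta>; farther away the kernel is
  at most 1, as \<alpha> is nonnegative. The bound is uniform in \<zeta>, on which the later
  interchanges of integrals rely.\<close>

lemma nn_integral_powr_finite_measure:
  fixes \<zeta> :: complex
  assumes "0 \<le> \<alpha>" and S[measurable]: "S \<in> sets borel"
  shows "(\<integral>\<^sup>+z. indicator S z * ennreal (norm (\<zeta> - z) powr - \<alpha>) \<partial>lborel)
      \<le> (\<integral>\<^sup>+w. indicator (ball 0 1) w * ennreal (norm w powr - \<alpha>) \<partial>(lborel :: complex measure)) + emeasure lborel S"
proof -
  have "(\<integral>\<^sup>+z. indicator S z * ennreal (norm (\<zeta> - z) powr - \<alpha>) \<partial>lborel) \<le>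
    (\<integral>\<^sup>+z. indicator (ball 0 1) (\<zeta> - z) * ennreal (norm (\<zeta> - z) powr - \<alpha>) + indicator S z \<partial>lborel)"
  proof (rule nn_integral_mono)
    fix z
    show "indicator S z * ennreal (norm (\<zeta> - z) powr - \<alpha>) \<le>
      indicator (ball 0 1) (\<zeta> - z) * ennreal (norm (\<zeta> - z) powr - \<alpha>) + indicator S z"
    proof (cases "norm (\<zeta> - z) < 1")
      case False
      then have "norm (\<zeta> - z) powr - \<alpha> \<le> norm (\<zeta> - z) powr 0"
        using assms by (intro powr_mono) auto
      then have "ennreal (norm (\<zeta> - z) powr - \<alpha>) \<le> 1"
        using False by (auto simp: powr_def split: if_splits)
      then show ?thesis using False by (auto simp: indicator_def)
    qed (auto simp: indicator_def)
  qed
  also have "\<dots> = (\<integral>\<^sup>+z. indicator (ball 0 1) (\<zeta> - z) * ennreal (norm (\<zeta> - z) powr - \<alpha>) \<partial>lborel) + emeasure lborel S"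
    by (subst nn_integral_add) auto
  also have "(\<integral>\<^sup>+z. indicator (ball 0 1) (\<zeta> - z) * ennreal (norm (\<zeta> - z) powr - \<alpha>) \<partial>lborel)
    = (\<integral>\<^sup>+w. indicator (ball 0 1) w * ennreal (norm w powr - \<alpha>) \<partial>(lborel :: complex measure))"
    using nn_integral_affine[of "\<lambda>w. indicator (ball 0 1) w * ennreal (norm w powr - \<alpha>)" "-1" \<zeta>] by simp
  finally show ?thesis .
qed

text \<open>At every point the farther pole is at least half the distance of the poles away, so the
  product is controlled by the nearer pole alone. The resulting majorant is homogeneous, and
  rescaling by the distance produces the power \<open>2 - 2 * \<alpha>\<close>. Its integral is
  finite near the pole because \<open>\<alpha> < 2\<close>, and at infinity because
  \<open>2 * \<alpha> > 2\<close>.\<close>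

lemma nn_integral_two_poles:
  assumes "1 < \<alpha>" "\<alpha> < 2"
  shows "\<exists>M\<ge>0. \<forall>z1 z2. z1 \<noteq> z2 \<longrightarrow>
    (\<integral>\<^sup>+w. ennreal ((norm (z1 - w) * norm (z2 - w)) powr - \<alpha>) \<partial>(lborel :: complex measure))
      \<le> ennreal (M * norm (z1 - z2) powr (2 - 2 * \<alpha>))"
proof -
  \<comment> \<open>Here \<open>u\<close> is the offset from the nearer pole, and
    \<open>max (norm u) \<delta>\<close> is a lower bound for the distance to the farther
    one.\<close>
  define G where "G \<delta> u = norm u powr - \<alpha> * max (norm u) \<delta> powr - \<alpha>" for \<delta> :: real and u :: complex
  have [measurable]: "G \<delta> \<in> borel_measurable borel" for \<delta> unfolding G_def by measurable
  have G0: "G \<delta> u \<ge> 0" for \<delta> u by (simp add: G_def)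
  define K where "K = (\<integral>\<^sup>+u. ennreal (G 1 u) \<partial>lborel)"
  have "K \<le> (\<integral>\<^sup>+u. indicator (ball 0 1) u * ennreal (norm u powr - \<alpha>)
      + indicator (- ball 0 1) u * ennreal (norm u powr - (2 * \<alpha>)) \<partial>(lborel :: complex measure))"
    unfolding K_def
  proof (rule nn_integral_mono)
    fix u :: complex
    show "ennreal (G 1 u) \<le> indicator (ball 0 1) u * ennreal (norm u powr - \<alpha>)
      + indicator (- ball 0 1) u * ennreal (norm u powr - (2 * \<alpha>))"
      by (cases "norm u < 1") (auto simp: G_def powr_add[symmetric] max_def)
  qed
  also have "\<dots> = (\<integral>\<^sup>+u. indicator (ball 0 1) u * ennreal (norm u powr - \<alpha>) \<partial>(lborel :: complex measure))
      + (\<integral>\<^sup>+u. indicator (- ball 0 1) u * ennreal (norm u powr - (2 * \<alpha>)) \<partial>(lborel :: complex measure))"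
    by (subst nn_integral_add) auto
  also have "\<dots> < \<infinity>"
    using nn_integral_powr_near[of \<alpha>] nn_integral_powr_far[of "2 * \<alpha>"] assms by simp
  finally have "K < \<infinity>" .
  then obtain k where k: "K = ennreal k" "k \<ge> 0"
    by (cases K) auto
  have scale: "(\<integral>\<^sup>+u. ennreal (G \<delta> (z - u)) \<partial>lborel) = ennreal (\<delta> powr (2 - 2 * \<alpha>) * k)" if "\<delta> > 0" for \<delta> z
  proof -
    have "(\<integral>\<^sup>+u. ennreal (G \<delta> (z - u)) \<partial>lborel) = (\<integral>\<^sup>+u. ennreal (G \<delta> u) \<partial>lborel)"
      using nn_integral_affine[of "\<lambda>u. ennreal (G \<delta> u)" "-1" z] by simp
    also have "\<dots> = ennreal (\<delta>\<^sup>2) * (\<integral>\<^sup>+u. ennreal (G \<delta> (0 + \<delta> *\<^sub>R u)) \<partial>lborel)"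
      using nn_integral_affine[of "\<lambda>u. ennreal (G \<delta> u)" \<delta> 0] that by simp
    also have "(\<integral>\<^sup>+u. ennreal (G \<delta> (0 + \<delta> *\<^sub>R u)) \<partial>lborel) = (\<integral>\<^sup>+u. ennreal (\<delta> powr (- 2 * \<alpha>)) * ennreal (G 1 u) \<partial>lborel)"
    proof (rule nn_integral_cong)
      fix u :: complex
      have m: "max (\<delta> * norm u) \<delta> = \<delta> * max (norm u) 1" using that by (simp add: max_mult_distrib_left)
      have "G \<delta> (0 + \<delta> *\<^sub>R u) = \<delta> powr (- 2 * \<alpha>) * G 1 u"
        using that by (simp add: G_def m powr_mult powr_add[symmetric])
      then show "ennreal (G \<delta> (0 + \<delta> *\<^sub>R u)) = ennreal (\<delta> powr (- 2 * \<alpha>)) * ennreal (G 1 u)"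
        by (simp add: ennreal_mult' G0)
    qed
    also have "\<dots> = ennreal (\<delta> powr (- 2 * \<alpha>)) * K"
      unfolding K_def by (rule nn_integral_cmult) simp
    also have "ennreal (\<delta>\<^sup>2) * (ennreal (\<delta> powr (- 2 * \<alpha>)) * K) = ennreal (\<delta>\<^sup>2 * \<delta> powr (- 2 * \<alpha>) * k)"
      using k by (simp add: ennreal_mult' mult.assoc)
    also have "\<delta>\<^sup>2 * \<delta> powr (- 2 * \<alpha>) = \<delta> powr (2 - 2 * \<alpha>)"
      using that by (simp add: powr_numeral[symmetric] powr_add[symmetric] del: powr_numeral)
    finally show ?thesis .
  qed
  have "(\<integral>\<^sup>+w. ennreal ((norm (z1 - w) * norm (z2 - w)) powr - \<alpha>) \<partial>lborel)
      \<le> ennreal (2 * 2 powr (2 * \<alpha> - 2) * k * norm (z1 - z2) powr (2 - 2 * \<alpha>))" if "z1 \<noteq> z2" for z1 z2 :: complex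
  proof -
    \<comment> \<open>Half the distance of the poles: two distances with sum at least
      \<open>2 * \<delta>\<close> cannot both be below \<delta>.\<close>
    define \<delta> where "\<delta> = norm (z1 - z2) / 2"
    have \<delta>: "\<delta> > 0" using that by (simp add: \<delta>_def)
    have *: "(norm a * norm b) powr - \<alpha> \<le> G \<delta> a" if "norm a \<le> norm b" "2 * \<delta> \<le> norm a + norm b" for a b :: complex
    proof -
      have "norm b powr - \<alpha> \<le> max (norm a) \<delta> powr - \<alpha>"
        using that assms \<delta> by (intro powr_mono2') auto
      then show ?thesis by (simp add: powr_mult G_def mult_left_mono)
    qed
    have "(\<integral>\<^sup>+w. ennreal ((norm (z1 - w) * norm (z2 - w)) powr - \<alpha>) \<partial>lborel) \<le>
      (\<integral>\<^sup>+w. ennreal (G \<delta> (z1 - w)) + ennreal (G \<delta> (z2 - w)) \<partial>lborel)"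
    proof (rule nn_integral_mono)
      fix w
      have d: "2 * \<delta> \<le> norm (z1 - w) + norm (z2 - w)"
        unfolding \<delta>_def using norm_triangle_ineq4[of "z1 - w" "z2 - w"] by simp
      have "(norm (z1 - w) * norm (z2 - w)) powr - \<alpha> \<le> G \<delta> (z1 - w) + G \<delta> (z2 - w)"
        using *[of "z1 - w" "z2 - w"] *[of "z2 - w" "z1 - w"] d G0[of \<delta> "z1 - w"] G0[of \<delta> "z2 - w"]
        by (cases "norm (z1 - w) \<le> norm (z2 - w)") (auto simp: mult.commute)
      then show "ennreal ((norm (z1 - w) * norm (z2 - w)) powr - \<alpha>) \<le> ennreal (G \<delta> (z1 - w)) + ennreal (G \<delta> (z2 - w))"
        by (metis G0 ennreal_leI ennreal_plus)
    qed
    also have "\<dots> = (\<integral>\<^sup>+w. ennreal (G \<delta> (z1 - w)) \<partial>lborel) + (\<integral>\<^sup>+w. ennreal (G \<delta> (z2 - w)) \<partial>lborel)"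
      by (rule nn_integral_add) auto
    also have "\<dots> = ennreal (\<delta> powr (2 - 2 * \<alpha>) * k + \<delta> powr (2 - 2 * \<alpha>) * k)"
      unfolding scale[OF \<delta>] using k by (subst ennreal_plus) auto
    also have "\<delta> powr (2 - 2 * \<alpha>) * k + \<delta> powr (2 - 2 * \<alpha>) * k = 2 * 2 powr (2 * \<alpha> - 2) * k * norm (z1 - z2) powr (2 - 2 * \<alpha>)"
    proof -
      have "(2::real) powr (2 * \<alpha> - 2) = 1 / 2 powr (2 - 2 * \<alpha>)"
        using powr_minus_divide[of 2 "2 - 2 * \<alpha>"] by simp
      then show ?thesis by (simp add: \<delta>_def powr_divide)
    qed
    finally show ?thesis .
  qed
  moreover have "2 * 2 powr (2 * \<alpha> - 2) * k \<ge> 0" using k by simp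
  ultimately show ?thesis by blast
qed

text \<open>The value is pi, but only its finiteness and positivity are used. It normalises the
  approximate identity \<open>e^2 / (|u|^2 + e^2)^2\<close>.\<close>

definition poisson_mass :: real where
  "poisson_mass = (\<integral>w. 1 / (1 + (norm w)\<^sup>2)\<^sup>2 \<partial>(lborel :: complex measure))"

lemma integrable_poisson: "integrable (lborel :: complex measure) (\<lambda>w. 1 / (1 + (norm w)\<^sup>2)\<^sup>2)"
proof (rule integrableI_bounded)
  have "(\<integral>\<^sup>+w. ennreal (norm (1 / (1 + (norm w)\<^sup>2)\<^sup>2)) \<partial>(lborel :: complex measure)) \<le>
     (\<integral>\<^sup>+w. indicator (ball 0 1) w + indicator (- ball 0 1) w * ennreal (norm w powr - 4) \<partial>(lborel :: complex measure))"
  proof (rule nn_integral_mono)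
    fix w :: complex
    show "ennreal (norm (1 / (1 + (norm w)\<^sup>2)\<^sup>2)) \<le> indicator (ball 0 1) w + indicator (- ball 0 1) w * ennreal (norm w powr - 4)"
    proof (cases "norm w < 1")
      case True
      have "1 / (1 + (norm w)\<^sup>2)\<^sup>2 \<le> 1" by (simp add: divide_simps)
      then show ?thesis using True by auto
    next
      case False
      then have "norm w powr - 4 = 1 / ((norm w)\<^sup>2)\<^sup>2"
        by (auto simp: powr_minus powr_numeral divide_simps)
      moreover have "((norm w)\<^sup>2)\<^sup>2 \<le> (1 + (norm w)\<^sup>2)\<^sup>2" by (intro power_mono) auto
      ultimately have "1 / (1 + (norm w)\<^sup>2)\<^sup>2 \<le> norm w powr - 4"
        using False by (auto intro!: divide_left_mono mult_pos_pos zero_less_power add_pos_nonneg)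
      then show ?thesis using False by (auto intro!: ennreal_leI)
    qed
  qed
  also have "\<dots> = emeasure (lborel :: complex measure) (ball 0 1) + (\<integral>\<^sup>+w. indicator (- ball 0 1) w * ennreal (norm w powr - 4) \<partial>(lborel :: complex measure))"
    by (subst nn_integral_add) (auto intro!: borel_measurable_indicator)
  also have "\<dots> < \<infinity>"
    using nn_integral_powr_far[of 4] emeasure_lborel_ball_finite[of "0::complex" 1] by simp
  finally show "(\<integral>\<^sup>+w. ennreal (norm (1 / (1 + (norm w)\<^sup>2)\<^sup>2)) \<partial>(lborel :: complex measure)) < \<infinity>" .
qed simp

lemma poisson_mass_pos: "poisson_mass > 0"
proof -
  have p: "1 / (1 + (norm w)\<^sup>2)\<^sup>2 > 0" for w :: complex
    by (intro divide_pos_pos zero_less_power add_pos_nonneg) auto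
  have "poisson_mass \<ge> 0" unfolding poisson_mass_def by (intro Bochner_Integration.integral_nonneg) (simp add: p less_imp_le)
  moreover have "poisson_mass \<noteq> 0"
  proof
    assume "poisson_mass = 0"
    then have "AE w::complex in lborel. 1 / (1 + (norm w)\<^sup>2)\<^sup>2 = 0"
      unfolding poisson_mass_def
      by (subst (asm) integral_nonneg_eq_0_iff_AE[OF integrable_poisson]) (auto simp: p less_imp_le)
    then have "AE w::complex in lborel. False" using p by (auto elim!: eventually_mono simp: less_le)
    then show False by (simp add: AE_iff_null_sets[symmetric] ae_filter_eq_bot_iff)
  qed
  ultimately show ?thesis by simp
qed

text \<open>The substitution replacing the variable by \<open>z + e *\<^sub>R w\<close> has Jacobian
  \<open>e^2\<close>, which turns the kernel into a fixed profile and moves all dependence on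
  \<open>e\<close> into the indicator. Indicators of boxes are enough, since integrals over boxes
  determine an integrable function almost everywhere.\<close>

lemma poisson_box:
  fixes B :: "complex set"
  assumes e: "e > 0" and [measurable]: "B \<in> sets borel"
  shows "(\<integral>\<zeta>. indicator B \<zeta> * (e\<^sup>2 / ((norm (z - \<zeta>))\<^sup>2 + e\<^sup>2)\<^sup>2) \<partial>lborel)
       = (\<integral>w. indicator B (z + e *\<^sub>R w) * (1 / (1 + (norm w)\<^sup>2)\<^sup>2) \<partial>lborel)"
proof -
  have "(\<integral>\<zeta>. indicator B \<zeta> * (e\<^sup>2 / ((norm (z - \<zeta>))\<^sup>2 + e\<^sup>2)\<^sup>2) \<partial>lborel)
     = e\<^sup>2 * (\<integral>w. indicator B (z + e *\<^sub>R w) * (e\<^sup>2 / ((norm (z - (z + e *\<^sub>R w)))\<^sup>2 + e\<^sup>2)\<^sup>2) \<partial>lborel)"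
    using integral_affine[of "\<lambda>\<zeta>. indicator B \<zeta> * (e\<^sup>2 / ((norm (z - \<zeta>))\<^sup>2 + e\<^sup>2)\<^sup>2)" e z] e by simp
  also have "\<dots> = (\<integral>w. e\<^sup>2 * (indicator B (z + e *\<^sub>R w) * (e\<^sup>2 / ((norm (z - (z + e *\<^sub>R w)))\<^sup>2 + e\<^sup>2)\<^sup>2)) \<partial>lborel)"
    by (rule integral_mult_right_zero[symmetric])
  also have "\<dots> = (\<integral>w. indicator B (z + e *\<^sub>R w) * (1 / (1 + (norm w)\<^sup>2)\<^sup>2) \<partial>lborel)"
  proof (rule Bochner_Integration.integral_cong[OF refl])
    fix w :: complex
    have "(norm (z - (z + e *\<^sub>R w)))\<^sup>2 + e\<^sup>2 = e\<^sup>2 * (1 + (norm w)\<^sup>2)"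
      by (simp add: power_mult_distrib algebra_simps)
    then have "e\<^sup>2 * (e\<^sup>2 / ((norm (z - (z + e *\<^sub>R w)))\<^sup>2 + e\<^sup>2)\<^sup>2) = 1 / (1 + (norm w)\<^sup>2)\<^sup>2"
      using e by (simp only: power_mult_distrib) (simp add: power2_eq_square)
    then show "e\<^sup>2 * (indicator B (z + e *\<^sub>R w) * (e\<^sup>2 / ((norm (z - (z + e *\<^sub>R w)))\<^sup>2 + e\<^sup>2)\<^sup>2))
      = indicator B (z + e *\<^sub>R w) * (1 / (1 + (norm w)\<^sup>2)\<^sup>2)"
      by (metis mult.left_commute)
  qed
  finally show ?thesis .
qed

lemma poisson_box_le:
  fixes B :: "complex set"
  assumes e: "e > 0" and [measurable]: "B \<in> sets borel"
  shows "\<bar>\<integral>\<zeta>. indicator B \<zeta> * (e\<^sup>2 / ((norm (z - \<zeta>))\<^sup>2 + e\<^sup>2)\<^sup>2) \<partial>lborel\<bar> \<le> poisson_mass"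
proof -
  have "\<bar>\<integral>w. indicator B (z + e *\<^sub>R w) * (1 / (1 + (norm w)\<^sup>2)\<^sup>2) \<partial>lborel\<bar>
    \<le> (\<integral>w. \<bar>indicator B (z + e *\<^sub>R w) * (1 / (1 + (norm w)\<^sup>2)\<^sup>2)\<bar> \<partial>lborel)"
    by (rule integral_abs_bound)
  also have "\<dots> \<le> poisson_mass"
    unfolding poisson_mass_def
    by (rule integral_mono_AE'[OF integrable_poisson]) (auto simp: indicator_def)
  finally show ?thesis using poisson_box[OF assms] by simp
qed

text \<open>Off the boundary of the box the indicator is locally constant, so for each
  \<open>w\<close> its value at \<open>z + e n *\<^sub>R w\<close> is eventually its value at
  \<open>z\<close>; the profile itself dominates.\<close>

lemma poisson_box_tendsto:
  fixes l u z :: complex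
  assumes z: "z \<notin> cbox l u - box l u" and e: "\<And>n. e n > 0" "e \<longlonglongrightarrow> 0"
  shows "(\<lambda>n. \<integral>\<zeta>. indicator (box l u) \<zeta> * ((e n)\<^sup>2 / ((norm (z - \<zeta>))\<^sup>2 + (e n)\<^sup>2)\<^sup>2) \<partial>lborel)
     \<longlonglongrightarrow> poisson_mass * indicator (box l u) z"
proof -
  have "(\<lambda>n. \<integral>w. indicator (box l u) (z + e n *\<^sub>R w) * (1 / (1 + (norm w)\<^sup>2)\<^sup>2) \<partial>lborel)
    \<longlonglongrightarrow> (\<integral>w. indicator (box l u) z * (1 / (1 + (norm w)\<^sup>2)\<^sup>2) \<partial>(lborel :: complex measure))"
  proof (rule integral_dominated_convergence[OF _ _ integrable_poisson])
    show "AE w in lborel. (\<lambda>n. indicator (box l u) (z + e n *\<^sub>R w) * (1 / (1 + (norm w)\<^sup>2)\<^sup>2))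
       \<longlonglongrightarrow> indicator (box l u) z * (1 / (1 + (norm w)\<^sup>2)\<^sup>2)"
    proof (intro AE_I2 tendsto_mult tendsto_const)
      fix w :: complex
      have t: "(\<lambda>n. z + e n *\<^sub>R w) \<longlonglongrightarrow> z"
        using tendsto_add[OF tendsto_const[of z] tendsto_scaleR[OF e(2) tendsto_const[of w]]] by simp
      show "(\<lambda>n. indicator (box l u) (z + e n *\<^sub>R w) :: real) \<longlonglongrightarrow> indicator (box l u) z"
      proof (cases "z \<in> box l u")
        case True
        then have "eventually (\<lambda>n. z + e n *\<^sub>R w \<in> box l u) sequentially"
          using topological_tendstoD[OF t open_box] by blast
        then show ?thesis
          by (intro tendsto_eventually) (auto elim!: eventually_mono simp: True)
      next
        case False
        then have "z \<in> - cbox l u" using z by auto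
        then have "eventually (\<lambda>n. z + e n *\<^sub>R w \<in> - cbox l u) sequentially"
          using topological_tendstoD[OF t, of "- cbox l u"] by (auto simp: open_Compl closed_cbox)
        then show ?thesis using box_subset_cbox[of l u]
          by (intro tendsto_eventually) (auto elim!: eventually_mono simp: False indicator_def)
      qed
    qed
  qed (auto simp: indicator_def)
  also have "(\<integral>w. indicator (box l u) z * (1 / (1 + (norm w)\<^sup>2)\<^sup>2) \<partial>(lborel :: complex measure))
    = poisson_mass * indicator (box l u) z"
    unfolding poisson_mass_def by (subst integral_mult_right_zero) (rule mult.commute)
  finally show ?thesis
    by (simp only: poisson_box[OF e(1) borel_open[OF open_box]])
qed

section \<open>The Cauchy potential\<close>

text \<open>Young's inequality for the normalised functions \<open>f / a\<close> and
  \<open>g / b\<close>, integrated.\<close>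

lemma Hoelder_integral:
  fixes f g :: "'a \<Rightarrow> real"
  assumes pq: "p > 1" "q > 1" "1 / p + 1 / q = 1"
    and [measurable]: "f \<in> borel_measurable M" "g \<in> borel_measurable M"
    and nn: "\<And>x. f x \<ge> 0" "\<And>x. g x \<ge> 0"
    and f: "integrable M (\<lambda>x. f x powr p)" and g: "integrable M (\<lambda>x. g x powr q)"
  shows "integrable M (\<lambda>x. f x * g x)"
    and "(\<integral>x. f x * g x \<partial>M) \<le> (\<integral>x. f x powr p \<partial>M) powr (1 / p) * (\<integral>x. g x powr q \<partial>M) powr (1 / q)"
proof -
  show int: "integrable M (\<lambda>x. f x * g x)"
  proof (rule Bochner_Integration.integrable_bound)
    show "integrable M (\<lambda>x. f x powr p / p + g x powr q / q)"
      using f g by simp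
    show "AE x in M. norm (f x * g x) \<le> norm (f x powr p / p + g x powr q / q)"
      using Youngs_inequality[OF pq] nn by (intro AE_I2) (smt (verit) mult_nonneg_nonneg real_norm_def)
  qed simp
  define A where "A = (\<integral>x. f x powr p \<partial>M)"
  define B where "B = (\<integral>x. g x powr q \<partial>M)"
  have A0: "A \<ge> 0" and B0: "B \<ge> 0" by (auto simp: A_def B_def)
  have "(\<integral>x. f x * g x \<partial>M) \<le> A powr (1 / p) * B powr (1 / q)"
  proof (cases "A = 0 \<or> B = 0")
    \<comment> \<open>Normalising is impossible here, but one of the functions, and with it the
      product, vanishes almost everywhere.\<close>
    case True
    have "AE x in M. f x * g x = 0"
    proof (cases "A = 0")
      case True
      then have "AE x in M. f x powr p = 0"
        unfolding A_def using f by (subst (asm) integral_nonneg_eq_0_iff_AE) auto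
      then show ?thesis by eventually_elim simp
    next
      case False
      then have "AE x in M. g x powr q = 0"
        using \<open>A = 0 \<or> B = 0\<close> g unfolding B_def by (subst (asm) integral_nonneg_eq_0_iff_AE) auto
      then show ?thesis by eventually_elim simp
    qed
    then have "(\<integral>x. f x * g x \<partial>M) = 0" by (rule integral_eq_zero_AE)
    then show ?thesis by simp
  next
    case False
    define a where "a = A powr (1 / p)"
    define b where "b = B powr (1 / q)"
    have ab: "a > 0" "b > 0" and AB: "a powr p = A" "b powr q = B"
      using False A0 B0 pq by (auto simp: a_def b_def powr_powr)
    have "(\<integral>x. f x * g x \<partial>M) / (a * b) = (\<integral>x. (f x / a) * (g x / b) \<partial>M)"
      by simp
    also have "\<dots> \<le> (\<integral>x. (f x powr p / A) / p + (g x powr q / B) / q \<partial>M)"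
    proof (rule integral_mono)
      show "integrable M (\<lambda>x. (f x / a) * (g x / b))" using int by simp
      show "integrable M (\<lambda>x. (f x powr p / A) / p + (g x powr q / B) / q)" using f g by simp
      show "(f x / a) * (g x / b) \<le> (f x powr p / A) / p + (g x powr q / B) / q" for x
        using Youngs_inequality[OF pq, of "f x / a" "g x / b"] nn[of x] ab AB by (simp add: powr_divide)
    qed
    also have "\<dots> = (A / A) / p + (B / B) / q"
      using f g by (simp add: A_def B_def)
    also have "\<dots> = 1" using False pq(3) by simp
    finally show ?thesis using ab by (simp add: a_def b_def divide_simps)
  qed
  then show "(\<integral>x. f x * g x \<partial>M) \<le> (\<integral>x. f x powr p \<partial>M) powr (1 / p) * (\<integral>x. g x powr q \<partial>M) powr (1 / q)"
    by (simp add: A_def B_def)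
qed

text \<open>The usual factor \<open>1 / pi\<close> of the Cauchy transform is omitted;
  \<open>poisson_mass\<close> on the other side of the representation makes up for it.\<close>

definition cauchy_potential :: "(complex \<Rightarrow> complex) \<Rightarrow> complex \<Rightarrow> complex" where
  "cauchy_potential H \<zeta> = (\<integral>z. H z / (\<zeta> - z) \<partial>lborel)"

lemma cauchy_potential_measurable [measurable]:
  assumes [measurable]: "H \<in> borel_measurable borel"
  shows "cauchy_potential H \<in> borel_measurable borel"
  unfolding cauchy_potential_def by measurable

lemma integrable_powr_finite_measure:
  fixes \<zeta> :: complex
  assumes \<alpha>: "0 \<le> \<alpha>" "\<alpha> < 2" and S[measurable]: "S \<in> sets borel" and fin: "emeasure lborel S < \<infinity>"
  shows "integrable lborel (\<lambda>z. indicator S z * norm (\<zeta> - z) powr - \<alpha>)"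
proof (rule integrableI_bounded)
  have "(\<integral>\<^sup>+z. ennreal (norm (indicator S z * norm (\<zeta> - z) powr - \<alpha>)) \<partial>lborel)
      = (\<integral>\<^sup>+z. indicator S z * ennreal (norm (\<zeta> - z) powr - \<alpha>) \<partial>lborel)"
    by (intro nn_integral_cong) (auto simp: indicator_def)
  also have "\<dots> < \<infinity>"
    by (rule le_less_trans[OF nn_integral_powr_finite_measure[OF \<alpha>(1) S]])
       (use nn_integral_powr_near[OF \<alpha>(2)] fin in simp)
  finally show "(\<integral>\<^sup>+z. ennreal (norm (indicator S z * norm (\<zeta> - z) powr - \<alpha>)) \<partial>lborel) < \<infinity>" .
qed simp

text \<open>The difference of the two kernels is the increment \<open>\<zeta>2 - \<zeta>1\<close>
  over the product of the two poles. Hoelder's inequality with the conjugate exponent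
  \<open>q'\<close>, which is below 2 because \<open>q > 2\<close>, leads to the two-pole integral;
  the increment and that integral together give the exponent
  \<open>1 + (2 - 2 * q') / q' = 1 - 2 / q\<close>.\<close>

lemma cauchy_potential_hoelder:
  fixes H :: "complex \<Rightarrow> complex"
  assumes q: "q > 2" and [measurable]: "H \<in> borel_measurable borel"
    and supp: "\<And>z. z \<notin> ball c R \<Longrightarrow> H z = 0"
    and H: "integrable lborel (\<lambda>z. norm (H z) powr q)"
  shows "\<exists>C\<ge>0. \<forall>\<zeta>1 \<zeta>2. norm (cauchy_potential H \<zeta>1 - cauchy_potential H \<zeta>2) \<le> C * norm (\<zeta>1 - \<zeta>2) powr (1 - 2 / q)"
proof -
  define q' where "q' = q / (q - 1)"
  have q': "1 < q'" "q' < 2" "1 / q + 1 / q' = 1" "q > 1"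
    using q by (auto simp: q'_def field_simps)
  obtain M where M: "M \<ge> 0" "\<And>z1 z2. z1 \<noteq> z2 \<Longrightarrow>
    (\<integral>\<^sup>+w. ennreal ((norm (z1 - w) * norm (z2 - w)) powr - q') \<partial>(lborel :: complex measure))
      \<le> ennreal (M * norm (z1 - z2) powr (2 - 2 * q'))"
    using nn_integral_two_poles[OF q'(1,2)] by blast
  have int: "integrable lborel (\<lambda>z. H z / (\<zeta> - z))" for \<zeta>
  proof -
    have "integrable lborel (\<lambda>z. norm (H z) * (indicator (ball c R) z * norm (\<zeta> - z) powr -1))"
    proof (rule Hoelder_integral(1)[OF q'(4,1,3)])
      have "(\<lambda>z. (indicator (ball c R) z * norm (\<zeta> - z) powr -1) powr q') =
        (\<lambda>z. indicator (ball c R) z * norm (\<zeta> - z) powr - q')"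
      proof
        fix z
        have "(norm (\<zeta> - z) powr -1) powr q' = norm (\<zeta> - z) powr - q'"
          by (simp only: powr_powr) simp
        then show "(indicator (ball c R) z * norm (\<zeta> - z) powr -1) powr q' = indicator (ball c R) z * norm (\<zeta> - z) powr - q'"
          by (cases "z \<in> ball c R") (simp_all only: indicator_simps mult_1_left mult_zero_left, simp)
      qed
      then show "integrable lborel (\<lambda>z. (indicator (ball c R) z * norm (\<zeta> - z) powr -1) powr q')"
        using integrable_powr_finite_measure[of q' "ball c R" \<zeta>] q' emeasure_lborel_ball_finite[of c R] by simp
    qed (use H in auto)
    then show ?thesis
      by (rule Bochner_Integration.integrable_bound)
         (use supp in \<open>auto simp: norm_divide norm_mult norm_inverse powr_minus divide_inverse indicator_def\<close>)
  qed
  define N where "N = (\<integral>z. norm (H z) powr q \<partial>lborel) powr (1 / q)"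
  have "norm (cauchy_potential H \<zeta>1 - cauchy_potential H \<zeta>2) \<le> (N * M powr (1 / q')) * norm (\<zeta>1 - \<zeta>2) powr (1 - 2 / q)" for \<zeta>1 \<zeta>2
  proof (cases "\<zeta>1 = \<zeta>2")
    case False
    define d where "d = norm (\<zeta>1 - \<zeta>2)"
    have d: "d > 0" using False by (simp add: d_def)
    define g where "g z = (norm (\<zeta>1 - z) * norm (\<zeta>2 - z)) powr -1" for z
    have [measurable]: "g \<in> borel_measurable borel" unfolding g_def by measurable
    have gq: "g z powr q' = (norm (\<zeta>1 - z) * norm (\<zeta>2 - z)) powr - q'" for z
      by (simp only: g_def powr_powr) simp
    have gi: "integrable lborel (\<lambda>z. g z powr q')"
      by (rule integrableI_bounded) (use M(2)[OF False] in \<open>auto simp: gq intro: le_less_trans\<close>)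
    have gb: "(\<integral>z. g z powr q' \<partial>lborel) \<le> M * d powr (2 - 2 * q')"
      using M(2)[OF False] M(1) gi
      by (subst (asm) gq[symmetric]) (simp add: nn_integral_eq_integral d_def)
    have ne: "AE z in lborel. z \<noteq> \<zeta>1 \<and> z \<noteq> \<zeta>2"
      using AE_lborel_singleton[of \<zeta>1] AE_lborel_singleton[of \<zeta>2] by eventually_elim auto
    have *: "norm (H z / (\<zeta>1 - z) - H z / (\<zeta>2 - z)) = d * (norm (H z) * g z)" if "z \<noteq> \<zeta>1 \<and> z \<noteq> \<zeta>2" for z
    proof -
      have "H z / (\<zeta>1 - z) - H z / (\<zeta>2 - z) = H z * (\<zeta>2 - \<zeta>1) / ((\<zeta>1 - z) * (\<zeta>2 - z))"
        using that by (subst diff_frac_eq) (auto simp: right_diff_distrib[symmetric])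
      then show ?thesis
        by (simp add: norm_divide norm_mult norm_inverse g_def d_def powr_minus divide_inverse norm_minus_commute[of \<zeta>2 \<zeta>1] mult_ac)
    qed
    have hg: "integrable lborel (\<lambda>z. norm (H z) * g z)"
      "(\<integral>z. norm (H z) * g z \<partial>lborel) \<le> N * (\<integral>z. g z powr q' \<partial>lborel) powr (1 / q')"
      unfolding N_def using H gi by (intro Hoelder_integral[OF q'(4,1,3)]; simp add: g_def)+
    have "norm (cauchy_potential H \<zeta>1 - cauchy_potential H \<zeta>2) = norm (\<integral>z. H z / (\<zeta>1 - z) - H z / (\<zeta>2 - z) \<partial>lborel)"
      unfolding cauchy_potential_def using int by simp
    also have "\<dots> \<le> (\<integral>z. norm (H z / (\<zeta>1 - z) - H z / (\<zeta>2 - z)) \<partial>lborel)"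
      by (rule integral_norm_bound)
    also have "\<dots> = (\<integral>z. d * (norm (H z) * g z) \<partial>lborel)"
    proof (rule integral_cong_AE)
      show "AE z in lborel. norm (H z / (\<zeta>1 - z) - H z / (\<zeta>2 - z)) = d * (norm (H z) * g z)"
        using ne by eventually_elim (rule *)
    qed simp_all
    also have "\<dots> = d * (\<integral>z. norm (H z) * g z \<partial>lborel)" by simp
    also have "\<dots> \<le> d * (N * (\<integral>z. g z powr q' \<partial>lborel) powr (1 / q'))"
      using hg(2) d by (intro mult_left_mono) auto
    also have "\<dots> \<le> d * (N * (M * d powr (2 - 2 * q')) powr (1 / q'))"
      using gb d q' by (intro mult_left_mono powr_mono2) (auto simp: N_def)
    also have "\<dots> = N * M powr (1 / q') * (d powr 1 * d powr ((2 - 2 * q') / q'))"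
      using d M(1) by (simp add: powr_mult powr_powr)
    also have "d powr 1 * d powr ((2 - 2 * q') / q') = d powr (1 - 2 / q)"
    proof -
      have "1 + (2 - 2 * q') / q' = 2 * (1 / q') - 1" using q' by (simp add: field_simps)
      also have "\<dots> = 1 - 2 / q" using q'(3) by (simp add: algebra_simps)
      finally show ?thesis by (simp only: powr_add[symmetric])
    qed
    finally show ?thesis by (simp add: d_def)
  qed simp
  moreover have "N * M powr (1 / q') \<ge> 0" by (simp add: N_def)
  ultimately show ?thesis by blast
qed

text \<open>Young's convolution inequality with \<open>1 / s + 1 / m = 1 + 1 / t\<close>. The upper
  bound on \<open>t\<close> says exactly that \<open>m < 2\<close>, so that the kernel to the power
  \<open>m\<close> is locally integrable; \<open>s < t\<close> corresponds to
  \<open>m > 1\<close>.\<close>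

lemma cauchy_potential_gain:
  fixes H :: "complex \<Rightarrow> complex"
  assumes s: "1 < s" "s < 2" "s < t" "t < 2 * s / (2 - s)"
    and [measurable]: "H \<in> borel_measurable borel"
    and supp: "\<And>z. z \<notin> ball c R \<Longrightarrow> H z = 0"
    and H: "integrable lborel (\<lambda>z. norm (H z) powr s)"
  shows "integrable lborel (\<lambda>\<zeta>. indicator (cball c R) \<zeta> * norm (cauchy_potential H \<zeta>) powr t)"
proof -
  define m where "m = 1 / (1 + 1 / t - 1 / s)"
  define t' where "t' = t / (t - 1)"
  have t: "t > 1" using s by simp
  have ts: "1 / t < 1 / s" using s by (simp add: divide_simps)
  moreover have "1 / t > 1 / s - 1 / 2"
    using s t by (simp add: divide_simps) (simp add: algebra_simps)
  moreover define D where "D = 1 + 1 / t - 1 / s"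
  ultimately have "1 / 2 < D" "D < 1" by linarith+
  then have m: "1 < m" "m < 2"
    unfolding m_def D_def[symmetric] by (simp_all add: field_simps)
  have msum: "1 / s + 1 / m = 1 + 1 / t" by (simp add: m_def)
  have t': "1 < t'" "1 / t + 1 / t' = 1" using t by (auto simp: t'_def field_simps)
  define \<theta>1 where "\<theta>1 = t' * (1 / s - 1 / t)"
  define \<theta>2 where "\<theta>2 = t' * (1 / m - 1 / t)"
  have e: "(1 - s / t) * t' = s * \<theta>1" "(1 - m / t) * t' = m * \<theta>2"
    using s m by (simp_all add: \<theta>1_def \<theta>2_def right_diff_distrib left_diff_distrib)
  have "\<theta>1 + \<theta>2 = t' * ((1 / s + 1 / m) - 2 / t)"
    by (simp add: \<theta>1_def \<theta>2_def algebra_simps)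
  also have "\<dots> = t' * (1 - 1 / t)" unfolding msum by (simp add: algebra_simps)
  also have "\<dots> = 1" using t by (simp add: t'_def field_simps)
  finally have \<theta>sum: "\<theta>1 + \<theta>2 = 1" .
  have "1 / s < 1" using s by simp
  then have tm: "1 / t < 1 / m" using msum by linarith
  have \<theta>: "\<theta>1 > 0" "\<theta>2 > 0"
    using ts tm t' by (auto simp: \<theta>1_def \<theta>2_def intro!: mult_pos_pos)
  \<comment> \<open>A crude weighted mean inequality: bounding both factors by powers of
    \<open>x + y\<close> makes a third application of Hoelder's inequality unnecessary.\<close>
  have amgm: "x powr \<theta>1 * y powr \<theta>2 \<le> x + y" if "x \<ge> 0" "y \<ge> 0" for x y :: real
  proof -
    have "x powr \<theta>1 * y powr \<theta>2 \<le> (x + y) powr \<theta>1 * (x + y) powr \<theta>2"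
      using that \<theta> by (intro mult_mono powr_mono2) auto
    also have "\<dots> = x + y" using that by (simp add: powr_add[symmetric] \<theta>sum)
    finally show ?thesis .
  qed
  define N where "N = enn2real (\<integral>\<^sup>+w. indicator (ball 0 1) w * ennreal (norm w powr - m) \<partial>(lborel :: complex measure)) + measure lborel (cball c R)"
  have N: "(\<integral>\<^sup>+z. indicator S z * ennreal (norm (\<zeta> - z) powr - m) \<partial>lborel) \<le> ennreal N" if "S \<subseteq> cball c R" "S \<in> sets borel" for S \<zeta>
  proof -
    have "(\<integral>\<^sup>+z. indicator S z * ennreal (norm (\<zeta> - z) powr - m) \<partial>lborel)
      \<le> (\<integral>\<^sup>+w. indicator (ball 0 1) w * ennreal (norm w powr - m) \<partial>(lborel :: complex measure)) + emeasure lborel S"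
      using that m by (intro nn_integral_powr_finite_measure) auto
    also have "\<dots> \<le> (\<integral>\<^sup>+w. indicator (ball 0 1) w * ennreal (norm w powr - m) \<partial>(lborel :: complex measure)) + emeasure lborel (cball c R)"
      using that by (intro add_left_mono emeasure_mono) auto
    also have "\<dots> = ennreal N"
      using nn_integral_powr_near[of m] m emeasure_lborel_cball_finite[of c R]
      by (simp add: N_def ennreal_plus emeasure_eq_ennreal_measure)
    finally show ?thesis .
  qed
  have N0: "N \<ge> 0" by (simp add: N_def)
  define A where "A = (\<integral>z. norm (H z) powr s \<partial>lborel)"
  \<comment> \<open>The added 1 keeps \<open>K\<close> positive, so that the bound below remains
    true where \<open>J \<zeta>\<close> is infinite.\<close>
  define K where "K = (A + N + 1) powr (t / t')"
  have A0: "A \<ge> 0" by (simp add: A_def)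
  have K: "K > 0" using A0 N0 by (simp add: K_def)
  define J where "J \<zeta> = (\<integral>\<^sup>+z. ennreal (norm (H z) powr s * norm (\<zeta> - z) powr - m) \<partial>lborel)" for \<zeta>
  have [measurable]: "J \<in> borel_measurable borel" unfolding J_def by measurable
  have bound: "ennreal (norm (cauchy_potential H \<zeta>) powr t) \<le> ennreal K * J \<zeta>" for \<zeta>
  proof (cases "J \<zeta> = \<infinity>")
    case True
    then show ?thesis using K by (simp add: ennreal_mult_top)
  next
    case False
    \<comment> \<open>The integrand is split as \<open>f * g\<close> with
      \<open>f powr t = X\<close>. The exponents left for \<open>g\<close> make
      \<open>g powr t'\<close> a weighted geometric mean of \<open>norm (H z) powr s\<close> and the
      kernel to the power \<open>m\<close>, with weights \<theta>1 and \<theta>2 of sum 1.\<close>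
    define X where "X z = (norm (H z) powr s * norm (\<zeta> - z) powr - m)" for z
    define f where "f z = X z powr (1 / t)" for z
    define g where "g z = norm (H z) powr (1 - s / t) * norm (\<zeta> - z) powr - (1 - m / t)" for z
    have [measurable]: "X \<in> borel_measurable borel" "f \<in> borel_measurable borel" "g \<in> borel_measurable borel"
      unfolding f_def g_def X_def by measurable
    have X0: "X z \<ge> 0" for z by (simp add: X_def)
    have Xi: "integrable lborel X"
      by (rule integrableI_bounded) (use False X0 in \<open>auto simp: J_def X_def less_top\<close>)
    have JX: "J \<zeta> = ennreal (\<integral>z. X z \<partial>lborel)"
      using nn_integral_eq_integral[OF Xi] X0 by (simp add: J_def X_def[symmetric])
    have ft: "f z powr t = X z" for z using t X0[of z] by (simp add: f_def powr_powr)
    have fg: "f z * g z = norm (H z / (\<zeta> - z))" for z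
    proof -
      have "f z * g z = norm (H z) powr (s / t + (1 - s / t)) * norm (\<zeta> - z) powr (- m / t + - (1 - m / t))"
        unfolding f_def g_def X_def powr_add using t by (simp add: powr_mult powr_powr)
      then show ?thesis by (simp add: norm_divide norm_mult norm_inverse powr_minus divide_inverse)
    qed
    have gt: "g z powr t' \<le> norm (H z) powr s + indicator (ball c R) z * norm (\<zeta> - z) powr - m" for z
    proof (cases "z \<in> ball c R")
      case True
      have "g z powr t' = (norm (H z) powr s) powr \<theta>1 * (norm (\<zeta> - z) powr - m) powr \<theta>2"
        by (simp only: g_def powr_mult powr_powr minus_mult_left[symmetric] e)
      also have "\<dots> \<le> norm (H z) powr s + norm (\<zeta> - z) powr - m" by (rule amgm) auto
      finally show ?thesis using True by simp
    qed (simp add: g_def supp)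
    have ki: "integrable lborel (\<lambda>z. indicator (ball c R) z * norm (\<zeta> - z) powr - m)"
      using m emeasure_lborel_ball_finite[of c R] by (intro integrable_powr_finite_measure) auto
    have kb: "(\<integral>z. indicator (ball c R) z * norm (\<zeta> - z) powr - m \<partial>lborel) \<le> N"
    proof -
      have "ennreal (\<integral>z. indicator (ball c R) z * norm (\<zeta> - z) powr - m \<partial>lborel)
        = (\<integral>\<^sup>+z. indicator (ball c R) z * ennreal (norm (\<zeta> - z) powr - m) \<partial>lborel)"
        by (subst nn_integral_eq_integral[OF ki, symmetric]) (auto intro!: nn_integral_cong simp: indicator_def)
      also have "\<dots> \<le> ennreal N" by (rule N) auto
      finally show ?thesis using N0 by simp
    qed
    have bi: "integrable lborel (\<lambda>z. norm (H z) powr s + indicator (ball c R) z * norm (\<zeta> - z) powr - m)"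
      using H ki by simp
    have gi: "integrable lborel (\<lambda>z. g z powr t')"
      by (rule Bochner_Integration.integrable_bound[OF bi])
         (use gt in \<open>auto intro!: AE_I2 order_trans[OF _ abs_ge_self]\<close>)
    have gb: "(\<integral>z. g z powr t' \<partial>lborel) \<le> A + N"
    proof -
      have "(\<integral>z. g z powr t' \<partial>lborel) \<le> (\<integral>z. norm (H z) powr s + indicator (ball c R) z * norm (\<zeta> - z) powr - m \<partial>lborel)"
        by (rule integral_mono[OF gi bi gt])
      also have "\<dots> \<le> A + N" using H ki kb by (simp add: A_def)
      finally show ?thesis .
    qed
    have "norm (cauchy_potential H \<zeta>) \<le> (\<integral>z. f z * g z \<partial>lborel)"
      unfolding cauchy_potential_def fg by (rule integral_norm_bound)
    also have "\<dots> \<le> (\<integral>z. f z powr t \<partial>lborel) powr (1 / t) * (\<integral>z. g z powr t' \<partial>lborel) powr (1 / t')"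
      by (rule Hoelder_integral(2)[OF t t'(1) t'(2)]) (use gi Xi ft in \<open>auto simp: f_def g_def\<close>)
    also have "\<dots> \<le> (\<integral>z. X z \<partial>lborel) powr (1 / t) * (A + N + 1) powr (1 / t')"
      unfolding ft using gb t' by (intro mult_left_mono powr_mono2) auto
    finally have "norm (cauchy_potential H \<zeta>) powr t \<le> ((\<integral>z. X z \<partial>lborel) powr (1 / t) * (A + N + 1) powr (1 / t')) powr t"
      using t by (intro powr_mono2) auto
    also have "\<dots> = K * (\<integral>z. X z \<partial>lborel)"
      using t A0 N0 by (simp add: powr_mult powr_powr K_def X0)
    finally show ?thesis unfolding JX using K by (simp add: ennreal_mult'[symmetric] ennreal_leI)
  qed
  show ?thesis
  proof (rule integrableI_bounded)
    have "(\<integral>\<^sup>+\<zeta>. ennreal (norm (indicator (cball c R) \<zeta> * norm (cauchy_potential H \<zeta>) powr t)) \<partial>lborel)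
      \<le> (\<integral>\<^sup>+\<zeta>. ennreal K * (indicator (cball c R) \<zeta> * J \<zeta>) \<partial>lborel)"
      using bound by (intro nn_integral_mono) (auto simp: indicator_def)
    also have "\<dots> = ennreal K * (\<integral>\<^sup>+\<zeta>. indicator (cball c R) \<zeta> * J \<zeta> \<partial>lborel)"
      by (rule nn_integral_cmult) simp
    also have "(\<integral>\<^sup>+\<zeta>. indicator (cball c R) \<zeta> * J \<zeta> \<partial>lborel)
      = (\<integral>\<^sup>+\<zeta>. \<integral>\<^sup>+z. indicator (cball c R) \<zeta> * ennreal (norm (H z) powr s * norm (\<zeta> - z) powr - m) \<partial>lborel \<partial>lborel)"
      unfolding J_def by (intro nn_integral_cong nn_integral_cmult[symmetric]) simp
    \<comment> \<open>Tonelli: with \<zeta> as the inner variable, the kernel integrates to at most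
      \<open>N\<close>, uniformly in \<open>z\<close>.\<close>
    also have "\<dots> = (\<integral>\<^sup>+z. \<integral>\<^sup>+\<zeta>. indicator (cball c R) \<zeta> * ennreal (norm (H z) powr s * norm (\<zeta> - z) powr - m) \<partial>lborel \<partial>lborel)"
      by (rule lborel_pair.Fubini'[symmetric]) simp
    also have "\<dots> = (\<integral>\<^sup>+z. ennreal (norm (H z) powr s) * (\<integral>\<^sup>+\<zeta>. indicator (cball c R) \<zeta> * ennreal (norm (z - \<zeta>) powr - m) \<partial>lborel) \<partial>lborel)"
      by (intro nn_integral_cong, subst nn_integral_cmult[symmetric])
         (auto intro!: nn_integral_cong simp: ennreal_mult' norm_minus_commute mult_ac)
    also have "\<dots> \<le> (\<integral>\<^sup>+z. ennreal (norm (H z) powr s) * ennreal N \<partial>lborel)"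
      by (intro nn_integral_mono mult_left_mono N) auto
    also have "\<dots> = ennreal A * ennreal N"
      by (subst nn_integral_multc) (auto simp: nn_integral_eq_integral[OF H] A_def)
    finally have "(\<integral>\<^sup>+\<zeta>. ennreal (norm (indicator (cball c R) \<zeta> * norm (cauchy_potential H \<zeta>) powr t)) \<partial>lborel)
       \<le> ennreal K * (ennreal A * ennreal N)" by (simp add: mult_left_mono)
    also have "\<dots> < \<infinity>" by (simp add: ennreal_mult_less_top)
    finally show "(\<integral>\<^sup>+\<zeta>. ennreal (norm (indicator (cball c R) \<zeta> * norm (cauchy_potential H \<zeta>) powr t)) \<partial>lborel) < \<infinity>" .
  qed simp
qed

text \<open>Boxes form an intersection-stable generator of the Borel sets, so a Dynkin argument
  extends the vanishing to every Borel set. The complement step uses the integral over the whole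
  space, obtained first by exhausting it with boxes.\<close>

lemma AE_zero_if_box_integrals_zero:
  fixes F :: "'a::euclidean_space \<Rightarrow> 'b::{banach,second_countable_topology}"
  assumes F: "integrable lborel F"
    and box: "\<And>l u. set_lebesgue_integral lborel (box l u) F = 0"
  shows "AE x in lborel. F x = 0"
proof (rule sigma_finite_measure.density_zero[OF sigma_finite_lborel F])
  have si: "set_integrable lborel A F" if "A \<in> sets borel" for A
    using that F by (simp add: set_integrable_def integrable_mult_indicator)
  let ?A = "\<lambda>n::nat. box (- (real n *\<^sub>R One)) (real n *\<^sub>R One) :: 'a set"
  have UN: "(\<Union>n. ?A n) = UNIV" by (rule UN_box_eq_UNIV)
  have "(\<lambda>n. set_lebesgue_integral lborel (?A n) F) \<longlonglongrightarrow> set_lebesgue_integral lborel (\<Union>n. ?A n) F"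
  proof (rule set_integral_cont_up)
    show "incseq ?A"
      by (auto simp: incseq_def box_def inner_sum_left inner_Basis intro: less_le_trans le_less_trans)
    show "set_integrable lborel (\<Union>n. ?A n) F" by (rule si) simp
  qed simp
  then have univ: "set_lebesgue_integral lborel UNIV F = 0"
    unfolding UN by (simp add: box LIMSEQ_const_iff)
  fix A :: "'a set" assume "A \<in> sets lborel"
  then have A: "A \<in> sigma_sets UNIV (range (\<lambda>(l, u). box l u))" by (simp add: borel_eq_box)
  have "Int_stable (range (\<lambda>(l, u). box l u :: 'a set))" "range (\<lambda>(l, u). box l u :: 'a set) \<subseteq> Pow UNIV"
    by (auto simp: Int_stable_def box_Int_box)
  then show "set_lebesgue_integral lborel A F = 0"
    using A
  proof (induction rule: sigma_sets_induct_disjoint)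
    case (compl A)
    then have A: "A \<in> sets borel" by (simp add: borel_eq_box)
    have "set_lebesgue_integral lborel (A \<union> (UNIV - A)) F = set_lebesgue_integral lborel A F + set_lebesgue_integral lborel (UNIV - A) F"
      using A by (intro set_integral_Un si) auto
    then show ?case using compl univ by (simp add: Un_Diff_cancel)
  next
    case (union A)
    then have A: "A i \<in> sets borel" for i by (auto simp: borel_eq_box)
    have "set_lebesgue_integral lborel (\<Union>i. A i) F = (\<Sum>i. set_lebesgue_integral lborel (A i) F)"
      using A union(1) by (intro lebesgue_integral_countable_add si) (auto simp: disjoint_family_on_def)
    then show ?case using union by simp
  next
    case (basic A)
    then show ?case using box by auto
  qed (simp add: set_lebesgue_integral_def)
qed

text \<open>One criterion for all applications of Fubini below: \<open>K\<close> is in turn the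
  singular kernel, the regularised kernel and the approximate identity, each with a bound on a box
  that is uniform in \<open>z\<close>.\<close>

lemma integrable_pair_kernel:
  fixes K :: "complex \<Rightarrow> complex \<Rightarrow> complex" and h :: "complex \<Rightarrow> complex"
  assumes h: "integrable lborel h" and [measurable]: "B \<in> sets borel"
    "case_prod K \<in> borel_measurable (borel \<Otimes>\<^sub>M borel)"
    and N: "\<And>z. (\<integral>\<^sup>+\<zeta>. indicator B \<zeta> * ennreal (norm (K \<zeta> z)) \<partial>lborel) \<le> ennreal N"
  shows "integrable (lborel \<Otimes>\<^sub>M lborel) (\<lambda>(\<zeta>, z). indicator B \<zeta> *\<^sub>R (h z * K \<zeta> z))"
proof (rule integrableI_bounded)
  have [measurable]: "h \<in> borel_measurable borel" using h by auto
  have sp: "sets (lborel \<Otimes>\<^sub>M lborel :: (complex \<times> complex) measure) = sets (borel \<Otimes>\<^sub>M borel)"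
    by (intro sets_pair_measure_cong) auto
  show "(\<lambda>(\<zeta>, z). indicator B \<zeta> *\<^sub>R (h z * K \<zeta> z)) \<in> borel_measurable (lborel \<Otimes>\<^sub>M lborel)"
    unfolding measurable_cong_sets[OF sp refl] by measurable
  then have m: "(\<lambda>(\<zeta>, z). ennreal (norm (indicator B \<zeta> *\<^sub>R (h z * K \<zeta> z)))) \<in> borel_measurable (lborel \<Otimes>\<^sub>M lborel)"
    by (simp add: case_prod_unfold)
  have "(\<integral>\<^sup>+x. ennreal (norm (case x of (\<zeta>, z) \<Rightarrow> indicator B \<zeta> *\<^sub>R (h z * K \<zeta> z))) \<partial>(lborel \<Otimes>\<^sub>M lborel))
    = (\<integral>\<^sup>+z. \<integral>\<^sup>+\<zeta>. ennreal (norm (indicator B \<zeta> *\<^sub>R (h z * K \<zeta> z))) \<partial>lborel \<partial>lborel)"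
    using lborel_pair.nn_integral_snd[OF m] by (simp add: case_prod_unfold)
  also have "\<dots> = (\<integral>\<^sup>+z. ennreal (norm (h z)) * (\<integral>\<^sup>+\<zeta>. indicator B \<zeta> * ennreal (norm (K \<zeta> z)) \<partial>lborel) \<partial>lborel)"
    by (intro nn_integral_cong, subst nn_integral_cmult[symmetric])
       (auto intro!: nn_integral_cong simp: norm_mult ennreal_mult' indicator_def)
  also have "\<dots> \<le> (\<integral>\<^sup>+z. ennreal (norm (h z)) * ennreal N \<partial>lborel)"
    by (intro nn_integral_mono mult_left_mono N) auto
  also have "\<dots> = (\<integral>\<^sup>+z. ennreal (norm (h z)) \<partial>lborel) * ennreal N"
    by (rule nn_integral_multc) simp
  also have "\<dots> < \<infinity>"
    using h by (simp add: ennreal_mult_less_top integrable_iff_bounded)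
  finally show "(\<integral>\<^sup>+x. ennreal (norm (case x of (\<zeta>, z) \<Rightarrow> indicator B \<zeta> *\<^sub>R (h z * K \<zeta> z))) \<partial>(lborel \<Otimes>\<^sub>M lborel)) < \<infinity>" .
qed

section \<open>Removal of the regularisation and the representation formula\<close>

lemma norm_cauchy_reg_le: "norm (cauchy_reg e u) \<le> 1 / norm u"
proof (cases "u = 0")
  case False
  then have n: "norm u > 0" by simp
  have "norm (cauchy_reg e u) = norm u / ((norm u)\<^sup>2 + e\<^sup>2)"
    unfolding cauchy_reg_def norm_divide norm_of_real by simp
  also have "\<dots> \<le> norm u / (norm u)\<^sup>2"
    using n by (intro divide_left_mono mult_pos_pos) (auto simp: add_pos_nonneg)
  finally show ?thesis using n by (simp add: power2_eq_square)
qed (simp add: cauchy_reg_def)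

text \<open>Valid at \<open>u = 0\<close> as well, where both sides are 0 because
  \<open>1 / 0 = 0\<close>; the dominated convergence below therefore holds at every point of the
  product space.\<close>

lemma cauchy_reg_tendsto:
  assumes "e \<longlonglongrightarrow> 0"
  shows "(\<lambda>n. cauchy_reg (e n) u) \<longlonglongrightarrow> 1 / u"
proof (cases "u = 0")
  case False
  have "(\<lambda>n. (norm u)\<^sup>2 + (e n)\<^sup>2) \<longlonglongrightarrow> (norm u)\<^sup>2 + 0\<^sup>2"
    by (intro tendsto_intros assms)
  then have "(\<lambda>n. cnj u / of_real ((norm u)\<^sup>2 + (e n)\<^sup>2)) \<longlonglongrightarrow> cnj u / of_real ((norm u)\<^sup>2 + 0\<^sup>2)"
    using False by (intro tendsto_divide tendsto_const tendsto_of_real) auto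
  moreover have "cnj u / of_real ((norm u)\<^sup>2 + 0\<^sup>2) = 1 / u"
    using False complex_norm_square[of u] by (simp add: field_simps)
  ultimately show ?thesis by (simp add: cauchy_reg_def)
qed (simp add: cauchy_reg_def)

lemma cauchy_reg_measurable [measurable]: "cauchy_reg e \<in> borel_measurable borel"
  unfolding cauchy_reg_def by (intro borel_measurable_continuous_onI borel_measurable_divide) (auto intro!: continuous_intros)

text \<open>Integrating the regularised identity over a box and letting the regularisation tend to 0
  identifies both sides as functions.\<close>
lemma cauchy_potential_representation:
  fixes h H :: "complex \<Rightarrow> complex"
  assumes h: "integrable lborel h" and H: "integrable lborel H"
    and eq: "\<And>\<zeta> e. e > 0 \<Longrightarrow> (\<integral>z. h z * of_real (e\<^sup>2 / ((norm (z - \<zeta>))\<^sup>2 + e\<^sup>2)\<^sup>2) \<partial>lborel)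
                 = (\<integral>z. H z * cauchy_reg e (\<zeta> - z) \<partial>lborel)"
  shows "AE \<zeta> in lborel. of_real poisson_mass * h \<zeta> = cauchy_potential H \<zeta>"
proof -
  have [measurable]: "h \<in> borel_measurable borel" "H \<in> borel_measurable borel" using h H by auto
  define e where "e n = 1 / real (Suc n)" for n
  have e: "e n > 0" "e \<longlonglongrightarrow> 0" for n
    unfolding e_def by (simp, rule LIMSEQ_Suc[OF lim_1_over_n])
  define P where "P n u = (e n)\<^sup>2 / ((norm u)\<^sup>2 + (e n)\<^sup>2)\<^sup>2" for n and u :: complex
  have [measurable]: "P n \<in> borel_measurable borel" for n unfolding P_def by measurable
  have Pe: "P n u \<ge> 0" for n u by (simp add: P_def)
  have sp: "sets (lborel \<Otimes>\<^sub>M lborel :: (complex \<times> complex) measure) = sets (borel \<Otimes>\<^sub>M borel)"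
    by (intro sets_pair_measure_cong) auto
  have near: "(\<integral>\<^sup>+w. indicator (ball 0 1) w * ennreal (norm w powr - 1) \<partial>(lborel :: complex measure)) < \<infinity>"
    by (rule nn_integral_powr_near) simp
  \<comment> \<open>A box has finite measure, so the singular kernel, and hence every regularised
    one, has an integral over it that is bounded independently of the pole.\<close>
  have kern: "\<exists>N. \<forall>z. (\<integral>\<^sup>+\<zeta>. indicator (box l u) \<zeta> * ennreal (1 / norm (\<zeta> - z)) \<partial>lborel) \<le> ennreal N" for l u :: complex
  proof -
    define N where "N = enn2real ((\<integral>\<^sup>+w. indicator (ball 0 1) w * ennreal (norm w powr - 1) \<partial>(lborel :: complex measure)) + emeasure lborel (box l u))"
    have "(\<integral>\<^sup>+\<zeta>. indicator (box l u) \<zeta> * ennreal (1 / norm (\<zeta> - z)) \<partial>lborel) \<le> ennreal N" for z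
    proof -
      have "(\<integral>\<^sup>+\<zeta>. indicator (box l u) \<zeta> * ennreal (norm (z - \<zeta>) powr - 1) \<partial>lborel)
        \<le> (\<integral>\<^sup>+w. indicator (ball 0 1) w * ennreal (norm w powr - 1) \<partial>(lborel :: complex measure)) + emeasure lborel (box l u)"
        by (rule nn_integral_powr_finite_measure) auto
      also have "\<dots> = ennreal N"
        using near emeasure_lborel_box_finite[of l u] by (simp add: N_def)
      finally show ?thesis by (simp add: norm_minus_commute)
    qed
    then show ?thesis by blast
  qed
  have pair0: "integrable (lborel \<Otimes>\<^sub>M lborel) (\<lambda>(\<zeta>, z). indicator (box l u) \<zeta> *\<^sub>R (H z * (1 / (\<zeta> - z))))" for l u :: complex
  proof -
    obtain N where "\<forall>z. (\<integral>\<^sup>+\<zeta>. indicator (box l u) \<zeta> * ennreal (1 / norm (\<zeta> - z)) \<partial>lborel) \<le> ennreal N"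
      using kern by blast
    then show ?thesis
      by (intro integrable_pair_kernel[OF H, where N = N]) (auto simp: norm_divide)
  qed
  have pairH: "integrable (lborel \<Otimes>\<^sub>M lborel) (\<lambda>(\<zeta>, z). indicator (box l u) \<zeta> *\<^sub>R (H z * cauchy_reg (e n) (\<zeta> - z)))" for l u :: complex and n
  proof -
    obtain N where N: "\<forall>z. (\<integral>\<^sup>+\<zeta>. indicator (box l u) \<zeta> * ennreal (1 / norm (\<zeta> - z)) \<partial>lborel) \<le> ennreal N"
      using kern by blast
    show ?thesis
    proof (rule integrable_pair_kernel[OF H, where N = N])
      fix z
      have "(\<integral>\<^sup>+\<zeta>. indicator (box l u) \<zeta> * ennreal (norm (cauchy_reg (e n) (\<zeta> - z))) \<partial>lborel)
        \<le> (\<integral>\<^sup>+\<zeta>. indicator (box l u) \<zeta> * ennreal (1 / norm (\<zeta> - z)) \<partial>lborel)"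
        by (intro nn_integral_mono mult_left_mono ennreal_leI norm_cauchy_reg_le) auto
      with N show "(\<integral>\<^sup>+\<zeta>. indicator (box l u) \<zeta> * ennreal (norm (cauchy_reg (e n) (\<zeta> - z))) \<partial>lborel) \<le> ennreal N"
        using order_trans by blast
    qed auto
  qed
  have pairh: "integrable (lborel \<Otimes>\<^sub>M lborel) (\<lambda>(\<zeta>, z). indicator (box l u) \<zeta> *\<^sub>R (h z * of_real (P n (z - \<zeta>))))" for l u :: complex and n
  proof (rule integrable_pair_kernel[OF h])
    fix z
    have "P n u \<le> 1 / (e n)\<^sup>2" for u
    proof -
      have "((e n)\<^sup>2)\<^sup>2 \<le> ((norm u)\<^sup>2 + (e n)\<^sup>2)\<^sup>2" by (intro power_mono) auto
      then have "P n u \<le> (e n)\<^sup>2 / ((e n)\<^sup>2)\<^sup>2"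
        unfolding P_def using e(1)[of n] by (intro divide_left_mono mult_pos_pos zero_less_power add_nonneg_pos) auto
      also have "\<dots> = 1 / (e n)\<^sup>2" using e(1)[of n] by (simp add: power2_eq_square)
      finally show ?thesis .
    qed
    then have "(\<integral>\<^sup>+\<zeta>. indicator (box l u) \<zeta> * ennreal (norm (complex_of_real (P n (z - \<zeta>)))) \<partial>lborel)
      \<le> (\<integral>\<^sup>+\<zeta>. indicator (box l u) \<zeta> * ennreal (1 / (e n)\<^sup>2) \<partial>lborel)"
      using Pe by (intro nn_integral_mono mult_left_mono ennreal_leI) auto
    also have "\<dots> = ennreal (1 / (e n)\<^sup>2 * measure lborel (box l u))"
      using emeasure_lborel_box_finite[of l u]
      by (subst nn_integral_multc) (auto simp: emeasure_eq_ennreal_measure ennreal_mult'[symmetric] mult.commute)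
    finally show "(\<integral>\<^sup>+\<zeta>. indicator (box l u) \<zeta> * ennreal (norm (complex_of_real (P n (z - \<zeta>)))) \<partial>lborel)
       \<le> ennreal (1 / (e n)\<^sup>2 * measure lborel (box l u))" .
  qed auto
  have main: "(\<integral>\<zeta>. indicator (box l u) \<zeta> *\<^sub>R cauchy_potential H \<zeta> \<partial>lborel)
      = (\<integral>z. indicator (box l u) z *\<^sub>R (of_real poisson_mass * h z) \<partial>lborel)"
    and pot: "integrable lborel (\<lambda>\<zeta>. indicator (box l u) \<zeta> *\<^sub>R cauchy_potential H \<zeta>)" for l u
  proof -
    have cp: "(\<integral>z. indicator (box l u) \<zeta> *\<^sub>R (H z * (1 / (\<zeta> - z))) \<partial>lborel) = indicator (box l u) \<zeta> *\<^sub>R cauchy_potential H \<zeta>" for \<zeta>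
      by (simp add: cauchy_potential_def)
    show "integrable lborel (\<lambda>\<zeta>. indicator (box l u) \<zeta> *\<^sub>R cauchy_potential H \<zeta>)"
      using lborel_pair.integrable_fst[OF pair0[of l u]] unfolding cp .
    have potint: "(\<integral>\<zeta>. indicator (box l u) \<zeta> *\<^sub>R cauchy_potential H \<zeta> \<partial>lborel)
      = integral\<^sup>L (lborel \<Otimes>\<^sub>M lborel) (\<lambda>(\<zeta>, z). indicator (box l u) \<zeta> *\<^sub>R (H z * (1 / (\<zeta> - z))))"
      using lborel_pair.integral_fst[OF pair0[of l u]] unfolding cp .
    define I where "I n = integral\<^sup>L (lborel \<Otimes>\<^sub>M lborel) (\<lambda>(\<zeta>, z). indicator (box l u) \<zeta> *\<^sub>R (H z * cauchy_reg (e n) (\<zeta> - z)))" for n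
    \<comment> \<open>The unregularised integrand is itself the majorant, by
      \<open>norm_cauchy_reg_le\<close>.\<close>
    have lim1: "I \<longlonglongrightarrow> integral\<^sup>L (lborel \<Otimes>\<^sub>M lborel) (\<lambda>(\<zeta>, z). indicator (box l u) \<zeta> *\<^sub>R (H z * (1 / (\<zeta> - z))))"
      unfolding I_def
    proof (rule integral_dominated_convergence[OF _ _ integrable_norm[OF pair0[of l u]]])
      show "AE x in lborel \<Otimes>\<^sub>M lborel. (\<lambda>n. case x of (\<zeta>, z) \<Rightarrow> indicator (box l u) \<zeta> *\<^sub>R (H z * cauchy_reg (e n) (\<zeta> - z)))
         \<longlonglongrightarrow> (case x of (\<zeta>, z) \<Rightarrow> indicator (box l u) \<zeta> *\<^sub>R (H z * (1 / (\<zeta> - z))))"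
        by (intro AE_I2) (auto split: prod.split intro!: tendsto_scaleR tendsto_mult tendsto_const cauchy_reg_tendsto e simp del: times_divide_eq_right mult_1_right)
      show "AE x in lborel \<Otimes>\<^sub>M lborel. norm (case x of (\<zeta>, z) \<Rightarrow> indicator (box l u) \<zeta> *\<^sub>R (H z * cauchy_reg (e n) (\<zeta> - z)))
         \<le> norm (case x of (\<zeta>, z) \<Rightarrow> indicator (box l u) \<zeta> *\<^sub>R (H z * (1 / (\<zeta> - z))))" for n
      proof (intro AE_I2)
        fix x :: "complex \<times> complex"
        have "norm (H z) * norm (cauchy_reg (e n) (\<zeta> - z)) \<le> norm (H z) * (1 / norm (\<zeta> - z))" for \<zeta> z
          by (intro mult_left_mono norm_cauchy_reg_le) auto
        then show "norm (case x of (\<zeta>, z) \<Rightarrow> indicator (box l u) \<zeta> *\<^sub>R (H z * cauchy_reg (e n) (\<zeta> - z)))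
         \<le> norm (case x of (\<zeta>, z) \<Rightarrow> indicator (box l u) \<zeta> *\<^sub>R (H z * (1 / (\<zeta> - z))))"
          by (cases x) (auto simp: indicator_def norm_mult norm_divide)
      qed
    qed (rule borel_measurable_integrable, rule pair0 pairH)+
    \<comment> \<open>At fixed \<open>n\<close> the assumed identity is inserted under the outer
      integral. Swapping the order then places the box indicator on the approximate identity, where
      its limit is known.\<close>
    have In: "I n = (\<integral>z. h z * of_real (\<integral>\<zeta>. indicator (box l u) \<zeta> * P n (z - \<zeta>) \<partial>lborel) \<partial>lborel)" for n
    proof -
      have "I n = (\<integral>\<zeta>. (\<integral>z. indicator (box l u) \<zeta> *\<^sub>R (H z * cauchy_reg (e n) (\<zeta> - z)) \<partial>lborel) \<partial>lborel)"
        unfolding I_def by (rule lborel_pair.integral_fst[OF pairH, symmetric])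
      also have "\<dots> = (\<integral>\<zeta>. (\<integral>z. indicator (box l u) \<zeta> *\<^sub>R (h z * of_real (P n (z - \<zeta>))) \<partial>lborel) \<partial>lborel)"
        using eq[OF e(1)] by (simp add: P_def)
      also have "\<dots> = (\<integral>z. (\<integral>\<zeta>. indicator (box l u) \<zeta> *\<^sub>R (h z * of_real (P n (z - \<zeta>))) \<partial>lborel) \<partial>lborel)"
        by (rule lborel_pair.Fubini_integral[OF pairh, symmetric])
      also have "\<dots> = (\<integral>z. h z * of_real (\<integral>\<zeta>. indicator (box l u) \<zeta> * P n (z - \<zeta>) \<partial>lborel) \<partial>lborel)"
      proof (rule Bochner_Integration.integral_cong[OF refl])
        fix z
        have "(\<integral>\<zeta>. indicator (box l u) \<zeta> *\<^sub>R (h z * of_real (P n (z - \<zeta>))) \<partial>lborel)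
           = (\<integral>\<zeta>. h z * complex_of_real (indicator (box l u) \<zeta> * P n (z - \<zeta>)) \<partial>lborel)"
          by (rule Bochner_Integration.integral_cong) (auto simp: indicator_def)
        also have "\<dots> = h z * of_real (\<integral>\<zeta>. indicator (box l u) \<zeta> * P n (z - \<zeta>) \<partial>lborel)"
          by (simp only: integral_mult_right_zero integral_complex_of_real)
        finally show "(\<integral>\<zeta>. indicator (box l u) \<zeta> *\<^sub>R (h z * of_real (P n (z - \<zeta>))) \<partial>lborel)
          = h z * of_real (\<integral>\<zeta>. indicator (box l u) \<zeta> * P n (z - \<zeta>) \<partial>lborel)" .
      qed
      finally show ?thesis .
    qed
    \<comment> \<open>The boundary of the box, where the pointwise limit may fail, is a null set;
      \<open>poisson_mass\<close> bounds the smoothed indicators for all \<open>n\<close>.\<close>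
    have lim2: "I \<longlonglongrightarrow> (\<integral>z. h z * of_real (poisson_mass * indicator (box l u) z) \<partial>lborel)"
      unfolding In
    proof (rule integral_dominated_convergence[where w = "\<lambda>z. norm (h z) * poisson_mass"])
      have "AE z in lborel. z \<notin> cbox l u - box l u"
        using null_sets_cbox_Diff_box by (rule AE_not_in)
      then show "AE z in lborel. (\<lambda>n. h z * of_real (\<integral>\<zeta>. indicator (box l u) \<zeta> * P n (z - \<zeta>) \<partial>lborel))
         \<longlonglongrightarrow> h z * of_real (poisson_mass * indicator (box l u) z)"
        by eventually_elim (intro tendsto_intros poisson_box_tendsto[OF _ e, folded P_def])
      show "AE z in lborel. norm (h z * complex_of_real (\<integral>\<zeta>. indicator (box l u) \<zeta> * P n (z - \<zeta>) \<partial>lborel)) \<le> norm (h z) * poisson_mass" for n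
        unfolding P_def norm_mult norm_of_real
        by (intro AE_I2 mult_left_mono poisson_box_le e) auto
      show "(\<lambda>z. h z * complex_of_real (\<integral>\<zeta>. indicator (box l u) \<zeta> * P n (z - \<zeta>) \<partial>lborel)) \<in> borel_measurable lborel" for n
        by measurable
    qed (use h in auto)
    show "(\<integral>\<zeta>. indicator (box l u) \<zeta> *\<^sub>R cauchy_potential H \<zeta> \<partial>lborel)
      = (\<integral>z. indicator (box l u) z *\<^sub>R (of_real poisson_mass * h z) \<partial>lborel)"
      unfolding potint using LIMSEQ_unique[OF lim1 lim2]
      by (auto intro!: Bochner_Integration.integral_cong simp: indicator_def)
  qed
  \<comment> \<open>Integrability of the potential has been shown only over boxes, so the two sides
    are compared inside an increasing sequence of boxes, which exhausts the plane.\<close>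
  have "AE \<zeta> in lborel. \<zeta> \<in> box (- (real n *\<^sub>R One)) (real n *\<^sub>R One) \<longrightarrow> of_real poisson_mass * h \<zeta> = cauchy_potential H \<zeta>" for n
  proof -
    let ?B = "box (- (real n *\<^sub>R One)) (real n *\<^sub>R One) :: complex set"
    have ih: "integrable lborel (\<lambda>\<zeta>. indicator ?B \<zeta> *\<^sub>R (of_real poisson_mass * h \<zeta>))"
      using h by (intro integrable_mult_indicator) auto
    have "AE \<zeta> in lborel. indicator ?B \<zeta> *\<^sub>R cauchy_potential H \<zeta> - indicator ?B \<zeta> *\<^sub>R (of_real poisson_mass * h \<zeta>) = 0"
    proof (rule AE_zero_if_box_integrals_zero)
      show "integrable lborel (\<lambda>\<zeta>. indicator ?B \<zeta> *\<^sub>R cauchy_potential H \<zeta> - indicator ?B \<zeta> *\<^sub>R (of_real poisson_mass * h \<zeta>))"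
        using pot ih by simp
      fix l u :: complex
      \<comment> \<open>The intersection of two boxes is a box, so \<open>main\<close> covers the
        truncated functions too.\<close>
      obtain l' u' where lu: "box l u \<inter> ?B = box l' u'" unfolding box_Int_box by blast
      have "indicator (box l u) \<zeta> *\<^sub>R (indicator ?B \<zeta> *\<^sub>R x) = indicator (box l' u') \<zeta> *\<^sub>R x" for \<zeta> and x :: complex
        by (simp add: lu[symmetric] indicator_inter_arith)
      then have "set_lebesgue_integral lborel (box l u) (\<lambda>\<zeta>. indicator ?B \<zeta> *\<^sub>R cauchy_potential H \<zeta> - indicator ?B \<zeta> *\<^sub>R (of_real poisson_mass * h \<zeta>))
        = (\<integral>\<zeta>. indicator (box l' u') \<zeta> *\<^sub>R cauchy_potential H \<zeta> - indicator (box l' u') \<zeta> *\<^sub>R (of_real poisson_mass * h \<zeta>) \<partial>lborel)"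
        unfolding set_lebesgue_integral_def scaleR_diff_right by (simp only:)
      also have "\<dots> = 0"
        using h by (subst Bochner_Integration.integral_diff[OF pot]) (auto intro!: integrable_mult_indicator simp: main)
      finally show "set_lebesgue_integral lborel (box l u) (\<lambda>\<zeta>. indicator ?B \<zeta> *\<^sub>R cauchy_potential H \<zeta> - indicator ?B \<zeta> *\<^sub>R (of_real poisson_mass * h \<zeta>)) = 0" .
    qed
    then show ?thesis by eventually_elim (auto simp: indicator_def)
  qed
  then have "AE \<zeta> in lborel. \<forall>n. \<zeta> \<in> box (- (real n *\<^sub>R One)) (real n *\<^sub>R One) \<longrightarrow> of_real poisson_mass * h \<zeta> = cauchy_potential H \<zeta>"
    unfolding AE_all_countable by blast
  then show ?thesis
  proof eventually_elim
    case (elim \<zeta>)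
    have "\<zeta> \<in> (\<Union>n::nat. box (- (real n *\<^sub>R One)) (real n *\<^sub>R One))" unfolding UN_box_eq_UNIV by simp
    with elim show ?case by blast
  qed
qed

section \<open>Hoelder functions\<close>

lemma hoelderI:
  "(\<And>z w. z \<in> S \<Longrightarrow> w \<in> S \<Longrightarrow> dist (f z) (f w) \<le> C * dist z w powr \<epsilon>) \<Longrightarrow> f \<in> hoelder \<epsilon> S"
  unfolding hoelder_def by blast

lemma hoelderD:
  assumes "f \<in> hoelder \<epsilon> S"
  shows "\<exists>C\<ge>0. \<forall>z w. z \<in> S \<longrightarrow> w \<in> S \<longrightarrow> dist (f z) (f w) \<le> C * dist z w powr \<epsilon>"
proof -
  obtain C where C: "\<forall>z\<in>S. \<forall>w\<in>S. dist (f z) (f w) \<le> C * dist z w powr \<epsilon>"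
    using assms unfolding hoelder_def by blast
  have "dist (f z) (f w) \<le> max 0 C * dist z w powr \<epsilon>" if "z \<in> S" "w \<in> S" for z w
  proof -
    have "dist (f z) (f w) \<le> C * dist z w powr \<epsilon>" using C that by blast
    also have "\<dots> \<le> max 0 C * dist z w powr \<epsilon>" by (intro mult_right_mono) auto
    finally show ?thesis .
  qed
  then show ?thesis by (intro exI[of _ "max 0 C"]) simp
qed

lemma hoelder_subset: "f \<in> hoelder \<epsilon> S \<Longrightarrow> T \<subseteq> S \<Longrightarrow> f \<in> hoelder \<epsilon> T"
  unfolding hoelder_def by blast

lemma hoelder_bounded:
  assumes "f \<in> hoelder \<epsilon> S" "bounded S" "\<epsilon> > 0"
  shows "\<exists>B. \<forall>z\<in>S. norm (f z) \<le> B"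
proof (cases "S = {}")
  case False
  then obtain a where a: "a \<in> S" by blast
  obtain D where D: "\<And>z. z \<in> S \<Longrightarrow> dist z a \<le> D"
    using assms(2) unfolding bounded_any_center[of S a] dist_commute[of a] by blast
  obtain C where C: "C \<ge> 0" "\<And>z w. z \<in> S \<Longrightarrow> w \<in> S \<Longrightarrow> dist (f z) (f w) \<le> C * dist z w powr \<epsilon>"
    using hoelderD[OF assms(1)] by blast
  have "norm (f z) \<le> norm (f a) + C * D powr \<epsilon>" if "z \<in> S" for z
  proof -
    have "norm (f z) \<le> norm (f a) + dist (f z) (f a)"
      using norm_triangle_sub[of "f z" "f a"] by (simp add: dist_norm)
    also have "dist (f z) (f a) \<le> C * dist z a powr \<epsilon>" using C(2) that a by blast
    also have "\<dots> \<le> C * D powr \<epsilon>" using C(1) D[OF that] assms(3) by (intro mult_left_mono powr_mono2) auto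
    finally show ?thesis by simp
  qed
  then show ?thesis by blast
qed simp

lemma hoelder_add:
  assumes "f \<in> hoelder \<epsilon> S" "g \<in> hoelder \<epsilon> S"
  shows "(\<lambda>z. f z + g z) \<in> hoelder \<epsilon> S"
proof -
  obtain C where C: "C \<ge> 0" "\<And>z w. z \<in> S \<Longrightarrow> w \<in> S \<Longrightarrow> dist (f z) (f w) \<le> C * dist z w powr \<epsilon>"
    using hoelderD[OF assms(1)] by blast
  obtain D where D: "D \<ge> 0" "\<And>z w. z \<in> S \<Longrightarrow> w \<in> S \<Longrightarrow> dist (g z) (g w) \<le> D * dist z w powr \<epsilon>"
    using hoelderD[OF assms(2)] by blast
  show ?thesis
  proof (rule hoelderI[where C = "C + D"])
    fix z w assume zw: "z \<in> S" "w \<in> S"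
    show "dist (f z + g z) (f w + g w) \<le> (C + D) * dist z w powr \<epsilon>"
      unfolding distrib_right by (rule order_trans[OF dist_triangle_add add_mono[OF C(2)[OF zw] D(2)[OF zw]]])
  qed
qed

lemma hoelder_mult:
  assumes f: "f \<in> hoelder \<epsilon> S" and g: "g \<in> hoelder \<epsilon> S" and "bounded S" "\<epsilon> > 0"
  shows "(\<lambda>z. f z * g z) \<in> hoelder \<epsilon> S"
proof -
  obtain C where C: "C \<ge> 0" "\<And>z w. z \<in> S \<Longrightarrow> w \<in> S \<Longrightarrow> dist (f z) (f w) \<le> C * dist z w powr \<epsilon>"
    using hoelderD[OF f] by blast
  obtain D where D: "D \<ge> 0" "\<And>z w. z \<in> S \<Longrightarrow> w \<in> S \<Longrightarrow> dist (g z) (g w) \<le> D * dist z w powr \<epsilon>"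
    using hoelderD[OF g] by blast
  obtain A where A: "\<And>z. z \<in> S \<Longrightarrow> norm (f z) \<le> A" using hoelder_bounded[OF f assms(3,4)] by blast
  obtain B where B: "\<And>z. z \<in> S \<Longrightarrow> norm (g z) \<le> B" using hoelder_bounded[OF g assms(3,4)] by blast
  show ?thesis
  proof (rule hoelderI[where C = "A * D + C * B"])
    fix z w assume zw: "z \<in> S" "w \<in> S"
    have "dist (f z * g z) (f w * g w) = norm (f z * (g z - g w) + (f z - f w) * g w)"
      by (simp add: dist_norm algebra_simps)
    also have "\<dots> \<le> norm (f z) * dist (g z) (g w) + dist (f z) (f w) * norm (g w)"
      by (rule norm_triangle_le) (simp add: norm_mult dist_norm)
    also have "\<dots> \<le> A * (D * dist z w powr \<epsilon>) + (C * dist z w powr \<epsilon>) * B"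
      using A B C D zw by (intro add_mono mult_mono) (auto intro: order_trans[OF norm_ge_zero])
    finally show "dist (f z * g z) (f w * g w) \<le> (A * D + C * B) * dist z w powr \<epsilon>"
      by (simp add: algebra_simps)
  qed
qed

lemma hoelder_const: "(\<lambda>_. k) \<in> hoelder \<epsilon> S"
  by (rule hoelderI[where C = 0]) auto

lemma dist_cnj: "dist (cnj a) (cnj b) = dist a b"
  using complex_mod_cnj[of "a - b"] by (simp add: dist_norm)

lemma hoelder_cnj: "f \<in> hoelder \<epsilon> S \<Longrightarrow> (\<lambda>z. cnj (f z)) \<in> hoelder \<epsilon> S"
  by (simp add: hoelder_def dist_cnj)

lemma hoelder_inverse:
  assumes f: "f \<in> hoelder \<epsilon> S" and \<delta>: "\<delta> > 0" "\<And>z. z \<in> S \<Longrightarrow> norm (f z) \<ge> \<delta>"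
  shows "(\<lambda>z. inverse (f z)) \<in> hoelder \<epsilon> S"
proof -
  obtain C where C: "C \<ge> 0" "\<And>z w. z \<in> S \<Longrightarrow> w \<in> S \<Longrightarrow> dist (f z) (f w) \<le> C * dist z w powr \<epsilon>"
    using hoelderD[OF f] by blast
  show ?thesis
  proof (rule hoelderI[where C = "C / (\<delta> * \<delta>)"])
    fix z w assume zw: "z \<in> S" "w \<in> S"
    have n: "norm (f z) \<ge> \<delta>" "norm (f w) \<ge> \<delta>" using \<delta> zw by auto
    then have "f z \<noteq> 0" "f w \<noteq> 0" using \<delta>(1) by auto
    then have "dist (inverse (f z)) (inverse (f w)) = dist (f z) (f w) / (norm (f z) * norm (f w))"
      by (simp add: dist_norm inverse_diff_inverse norm_mult norm_inverse divide_inverse)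
    also have "\<dots> \<le> (C * dist z w powr \<epsilon>) / (\<delta> * \<delta>)"
      using C(1) C(2)[OF zw] \<delta>(1) n by (intro frac_le mult_mono) auto
    finally show "dist (inverse (f z)) (inverse (f w)) \<le> C / (\<delta> * \<delta>) * dist z w powr \<epsilon>" by simp
  qed
qed

lemma hoelder_lipschitz:
  assumes "\<And>z w. z \<in> S \<Longrightarrow> w \<in> S \<Longrightarrow> dist (f z) (f w) \<le> B * dist z w" and "bounded S" and "\<epsilon> \<le> 1"
  shows "f \<in> hoelder \<epsilon> S"
proof -
  obtain D where D: "\<And>z w. z \<in> S \<Longrightarrow> w \<in> S \<Longrightarrow> dist z w \<le> D"
    using assms(2) unfolding bounded_two_points by blast
  show ?thesis
  proof (rule hoelderI[where C = "\<bar>B\<bar> * D powr (1 - \<epsilon>)"])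
    fix z w assume zw: "z \<in> S" "w \<in> S"
    have "dist (f z) (f w) \<le> B * dist z w" using assms(1) zw by blast
    also have "\<dots> \<le> \<bar>B\<bar> * dist z w" by (intro mult_right_mono) auto
    also have "\<dots> \<le> \<bar>B\<bar> * (D powr (1 - \<epsilon>) * dist z w powr \<epsilon>)"
    proof (rule mult_left_mono)
      have "dist z w powr 1 = dist z w powr (1 - \<epsilon>) * dist z w powr \<epsilon>"
        by (subst powr_add[symmetric]) simp
      also have "\<dots> \<le> D powr (1 - \<epsilon>) * dist z w powr \<epsilon>"
        using D[OF zw] assms(3) by (intro mult_right_mono powr_mono2) auto
      finally show "dist z w \<le> D powr (1 - \<epsilon>) * dist z w powr \<epsilon>" by simp
    qed simp
    finally show "dist (f z) (f w) \<le> \<bar>B\<bar> * D powr (1 - \<epsilon>) * dist z w powr \<epsilon>" by (simp only: mult.assoc)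
  qed
qed

lemma hoelder_continuous_on:
  assumes "f \<in> hoelder \<epsilon> S" "\<epsilon> > 0"
  shows "continuous_on S f"
  unfolding continuous_on_def
proof
  fix a assume a: "a \<in> S"
  obtain C where C: "C \<ge> 0" "\<forall>z w. z \<in> S \<longrightarrow> w \<in> S \<longrightarrow> dist (f z) (f w) \<le> C * dist z w powr \<epsilon>"
    using hoelderD[OF assms(1)] by blast
  show "(f \<longlongrightarrow> f a) (at a within S)"
  proof (rule tendsto_dist_iff[THEN iffD2], rule tendsto_sandwich[where f = "\<lambda>_. 0" and h = "\<lambda>z. C * dist z a powr \<epsilon>"])
    show "eventually (\<lambda>z. 0 \<le> dist (f z) (f a)) (at a within S)" by (intro always_eventually allI zero_le_dist)
    show "eventually (\<lambda>z. dist (f z) (f a) \<le> C * dist z a powr \<epsilon>) (at a within S)"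
      unfolding eventually_at_filter using C(2) a by (intro always_eventually) blast
    have "((\<lambda>z. dist z a) \<longlongrightarrow> dist a a) (at a within S)"
      by (rule tendsto_dist[OF tendsto_ident_at tendsto_const])
    then have 0: "((\<lambda>z. dist z a) \<longlongrightarrow> 0) (at a within S)" by (simp only: dist_self)
    have "((\<lambda>z. dist z a powr \<epsilon>) \<longlongrightarrow> 0) (at a within S)"
      by (rule tendsto_zero_powrI[OF 0 tendsto_const _ assms(2)]) simp
    from tendsto_mult[OF tendsto_const[of C] this]
    show "((\<lambda>z. C * dist z a powr \<epsilon>) \<longlongrightarrow> 0) (at a within S)" by (simp only: mult_zero_right)
  qed (rule tendsto_const)
qed

section \<open>Lower bound and Hoelder estimate for the cutoff\<close>

lemma isCont_expinv: "isCont (expinv m) t"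
  using expinv_has_derivative DERIV_isCont by blast

lemma continuous_on_expinv [continuous_intros]:
  "continuous_on S f \<Longrightarrow> continuous_on S (\<lambda>x. expinv m (f x))"
  by (rule continuous_on_compose2[OF continuous_at_imp_continuous_on[of UNIV]]) (auto simp: isCont_expinv)

lemma continuous_on_cutoff: "continuous_on S (cutoff c R)"
  unfolding cutoff_def[abs_def] by (intro continuous_intros)

text \<open>A positive continuous function on a compact set. This is the reason why every regularity
  statement passes to a smaller concentric disk: only there may one divide by the cutoff with
  control.\<close>

lemma cutoff_lower_bound:
  assumes "0 \<le> R'" "R' < R"
  shows "\<exists>\<delta>>0. \<forall>z\<in>cball c R'. cutoff c R z \<ge> \<delta>"
proof -
  have "\<exists>x\<in>cball c R'. \<forall>y\<in>cball c R'. cutoff c R x \<le> cutoff c R y"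
    using assms by (intro continuous_attains_inf continuous_on_cutoff) auto
  then obtain x where x: "x \<in> cball c R'" "\<And>y. y \<in> cball c R' \<Longrightarrow> cutoff c R x \<le> cutoff c R y" by blast
  have "(norm (x - c))\<^sup>2 \<le> R'\<^sup>2" using x(1) by (intro power_mono) (auto simp: dist_norm norm_minus_commute)
  also have "\<dots> < R\<^sup>2" using assms by (intro power_strict_mono) auto
  finally have "cutoff c R x > 0" unfolding cutoff_def by (intro expinv_pos) simp
  with x(2) show ?thesis by blast
qed

text \<open>The gradient is continuous, hence bounded on the compact convex disk, which makes the
  cutoff Lipschitz; on a bounded set this gives every exponent up to 1.\<close>

lemma hoelder_cutoff:
  assumes "\<epsilon> \<le> 1"
  shows "(\<lambda>z. of_real (cutoff c R z)) \<in> hoelder \<epsilon> (cball c R')"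
proof -
  \<comment> \<open>Left unsimplified so that it matches \<open>bump_has_derivative\<close> at
    \<open>m = 0\<close> literally.\<close>
  let ?d = "\<lambda>z. real 0 * expinv (0 + 1) (R\<^sup>2 - (norm (z - c))\<^sup>2) - expinv (0 + 2) (R\<^sup>2 - (norm (z - c))\<^sup>2)"
  let ?a = "\<lambda>z. of_real (2 * (Re z - Re c)) * of_real (?d z) :: complex"
  let ?b = "\<lambda>z. of_real (2 * (Im z - Im c)) * of_real (?d z) :: complex"
  have "compact ((\<lambda>z. norm (?a z) + norm (?b z)) ` cball c R')"
    by (intro compact_continuous_image continuous_intros compact_cball)
  then have "bdd_above ((\<lambda>z. norm (?a z) + norm (?b z)) ` cball c R')"
    by (intro bounded_imp_bdd_above compact_imp_bounded)
  then obtain B where B: "norm (?a z) + norm (?b z) \<le> B" if "z \<in> cball c R'" for z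
    unfolding bdd_above_def by blast
  show ?thesis
  proof (rule hoelder_lipschitz[OF _ bounded_cball assms])
    fix z w assume zw: "z \<in> cball c R'" "w \<in> cball c R'"
    have "norm (complex_of_real (cutoff c R z) - of_real (cutoff c R w)) \<le> B * norm (z - w)"
    proof (rule differentiable_bound[of "cball c R'"])
      fix x assume x: "x \<in> cball c R'"
      show "((\<lambda>z. complex_of_real (cutoff c R z)) has_derivative (\<lambda>h. of_real (Re h) * ?a x + of_real (Im h) * ?b x)) (at x within cball c R')"
        unfolding cutoff_def by (rule has_derivative_at_withinI, rule bump_has_derivative)
      show "onorm (\<lambda>h. of_real (Re h) * ?a x + of_real (Im h) * ?b x) \<le> B"
      proof (rule onorm_le)
        fix h :: complex
        have "norm (of_real (Re h) * ?a x + of_real (Im h) * ?b x) \<le> norm (of_real (Re h) * ?a x) + norm (of_real (Im h) * ?b x)"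
          by (rule norm_triangle_ineq)
        also have "\<dots> = \<bar>Re h\<bar> * norm (?a x) + \<bar>Im h\<bar> * norm (?b x)"
          by (simp only: norm_mult norm_of_real)
        also have "\<dots> \<le> norm h * norm (?a x) + norm h * norm (?b x)"
          by (intro add_mono mult_right_mono abs_Re_le_cmod abs_Im_le_cmod) auto
        also have "\<dots> = (norm (?a x) + norm (?b x)) * norm h"
          by (simp only: distrib_right mult.commute[of "norm h"])
        also have "\<dots> \<le> B * norm h" by (intro mult_right_mono B x) auto
        finally show "norm (of_real (Re h) * ?a x + of_real (Im h) * ?b x) \<le> B * norm h" .
      qed
    qed (use zw in auto)
    then show "dist (complex_of_real (cutoff c R z)) (of_real (cutoff c R w)) \<le> B * dist z w"
      by (simp add: dist_norm)
  qed
qed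

section \<open>Weak solutions of the scalar equation\<close>

lemma lebesgue_borel_representative:
  fixes f :: "complex \<Rightarrow> complex"
  assumes "f \<in> borel_measurable lebesgue"
  shows "\<exists>g\<in>borel_measurable borel. AE z in lebesgue. f z = g z"
proof -
  have "(\<lambda>z. Re (f z)) \<in> borel_measurable (completion lborel)" "(\<lambda>z. Im (f z)) \<in> borel_measurable (completion lborel)"
    using assms by measurable
  from this[THEN completion_ex_borel_measurable_real]
  obtain u v where uv: "u \<in> borel_measurable lborel" "v \<in> borel_measurable lborel"
    and AE: "AE z in lborel. Re (f z) = u z" "AE z in lborel. Im (f z) = v z"
    by blast
  from AE have "AE z in lborel. f z = Complex (u z) (v z)"
    by eventually_elim (simp add: complex_eq_iff)
  moreover have "(\<lambda>z. Complex (u z) (v z)) \<in> borel_measurable borel"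
    using uv unfolding Complex_eq by simp
  ultimately show ?thesis
    by (intro bexI[of _ "\<lambda>z. Complex (u z) (v z)"] AE_completion) auto
qed

text \<open>Passing to a Borel representative supported in the ball lets all further integrals be
  taken over \<open>lborel\<close>, where Fubini is available.\<close>
lemma L_space_borel_representative:
  fixes f :: "complex \<Rightarrow> complex"
  assumes f: "f \<in> L_space s (cball c R)"
  shows "\<exists>g. g \<in> borel_measurable borel \<and> (\<forall>z. z \<notin> ball c R \<longrightarrow> g z = 0) \<and>
    integrable lborel (\<lambda>z. norm (g z) powr s) \<and> (AE z in lebesgue. z \<in> ball c R \<longrightarrow> f z = g z) \<and>
    (\<forall>D \<Omega>. D \<in> borel_measurable borel \<longrightarrow> (\<forall>z. z \<notin> ball c R \<longrightarrow> D z = 0) \<longrightarrow> \<Omega> \<in> sets lebesgue \<longrightarrow> cball c R \<subseteq> \<Omega> \<longrightarrow>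
       (\<integral>z. f z * D z \<partial>lebesgue_on \<Omega>) = (\<integral>z. g z * D z \<partial>lborel))"
proof -
  define F where "F z = (if z \<in> cball c R then f z else 0)" for z
  have fm: "f \<in> borel_measurable (lebesgue_on (cball c R))" and fi: "integrable (lebesgue_on (cball c R)) (\<lambda>z. norm (f z) powr s)"
    using f by (auto simp: L_space_def)
  have Fm: "F \<in> borel_measurable lebesgue"
    unfolding F_def using fm by (subst borel_measurable_if) auto
  obtain g' where g': "g' \<in> borel_measurable borel" "AE z in lebesgue. F z = g' z"
    using lebesgue_borel_representative[OF Fm] by blast
  define g where "g z = (if z \<in> ball c R then g' z else 0)" for z
  have gm[measurable]: "g \<in> borel_measurable borel" unfolding g_def using g'(1) by measurable
  have ae: "AE z in lebesgue. z \<in> ball c R \<longrightarrow> f z = g z"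
    using g'(2) by eventually_elim (auto simp: F_def g_def)
  have mc: "h \<in> borel_measurable lebesgue" if "h \<in> borel_measurable borel" for h :: "complex \<Rightarrow> 'b::topological_space"
    using that by (intro measurable_completion) simp
  have "integrable lebesgue (\<lambda>z. indicator (cball c R) z *\<^sub>R (norm (f z) powr s))"
    using fi by (subst (asm) integrable_restrict_space) auto
  then have "integrable lebesgue (\<lambda>z. norm (g z) powr s)"
  proof (rule Bochner_Integration.integrable_bound)
    show "(\<lambda>z. norm (g z) powr s) \<in> borel_measurable lebesgue" by (intro mc) measurable
    show "AE z in lebesgue. norm (norm (g z) powr s) \<le> norm (indicator (cball c R) z *\<^sub>R (norm (f z) powr s))"
      using ae by eventually_elim (auto simp: g_def)
  qed
  then have gi: "integrable lborel (\<lambda>z. norm (g z) powr s)"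
    by (subst (asm) integrable_completion) auto
  have "(\<integral>z. f z * D z \<partial>lebesgue_on \<Omega>) = (\<integral>z. g z * D z \<partial>lborel)"
    if D: "D \<in> borel_measurable borel" "\<forall>z. z \<notin> ball c R \<longrightarrow> D z = 0" and \<Omega>: "\<Omega> \<in> sets lebesgue" "cball c R \<subseteq> \<Omega>" for D \<Omega>
  proof -
    have "(\<integral>z. f z * D z \<partial>lebesgue_on \<Omega>) = (\<integral>z. indicator \<Omega> z *\<^sub>R (f z * D z) \<partial>lebesgue)"
      using \<Omega>(1) by (intro integral_restrict_space) auto
    also have "\<dots> = (\<integral>z. F z * D z \<partial>lebesgue)"
    proof (rule Bochner_Integration.integral_cong[OF refl])
      fix z
      show "indicator \<Omega> z *\<^sub>R (f z * D z) = F z * D z"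
      proof (cases "z \<in> ball c R")
        case True
        then have "z \<in> cball c R" "z \<in> \<Omega>" using \<Omega>(2) ball_subset_cball by blast+
        then show ?thesis by (simp add: F_def)
      qed (use D(2) in simp)
    qed
    also have "\<dots> = (\<integral>z. g z * D z \<partial>lebesgue)"
    proof (rule integral_cong_AE)
      show "(\<lambda>z. F z * D z) \<in> borel_measurable lebesgue" using Fm mc[OF D(1)] by measurable
      show "(\<lambda>z. g z * D z) \<in> borel_measurable lebesgue" using mc[OF gm] mc[OF D(1)] by measurable
      show "AE z in lebesgue. F z * D z = g z * D z"
        using g'(2)
      proof eventually_elim
        case (elim z)
        then show ?case using D(2) by (cases "z \<in> ball c R") (auto simp: g_def)
      qed
    qed
    also have "\<dots> = (\<integral>z. g z * D z \<partial>lborel)"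
      by (rule integral_completion) (use D(1) in measurable)
    finally show ?thesis .
  qed
  then show ?thesis
    using gm gi ae by (intro exI[of _ g]) (auto simp: g_def)
qed

text \<open>Integrability is kept out of the relation, so that the same equation can be reused while
  the exponent of \<open>f\<close> and \<open>g\<close> improves.\<close>

definition weak_cdbar :: "complex set \<Rightarrow> (complex \<Rightarrow> complex) \<Rightarrow> (complex \<Rightarrow> complex) \<Rightarrow> bool" where
  "weak_cdbar \<Omega> f g \<longleftrightarrow> (\<forall>\<phi>\<in>test_functions \<Omega>.
     (\<integral>z. f z * ((partial_x \<phi> z + \<i> * partial_y \<phi> z) / 2) \<partial>lebesgue_on \<Omega>) = - (\<integral>z. g z * \<phi> z \<partial>lebesgue_on \<Omega>))"

lemma integrable_powr_mult_continuous:
  fixes g m :: "complex \<Rightarrow> complex"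
  assumes [measurable]: "g \<in> borel_measurable borel" and supp: "\<And>z. z \<notin> ball c R \<Longrightarrow> g z = 0"
    and g: "integrable lborel (\<lambda>z. norm (g z) powr s)" and m: "continuous_on UNIV m" and s: "s \<ge> 0"
  shows "integrable lborel (\<lambda>z. norm (g z * m z) powr s)"
proof -
  have [measurable]: "m \<in> borel_measurable borel" using m by (rule borel_measurable_continuous_onI)
  have "compact (m ` cball c R)"
    by (intro compact_continuous_image continuous_on_subset[OF m] compact_cball subset_UNIV)
  then have "bounded (m ` cball c R)" by (rule compact_imp_bounded)
  then obtain B where B: "\<forall>x\<in>m ` cball c R. norm x \<le> B"
    unfolding bounded_iff by blast
  have "integrable lborel (\<lambda>z. norm (g z) powr s * \<bar>B\<bar> powr s)" using g by simp
  then show ?thesis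
  proof (rule Bochner_Integration.integrable_bound)
    show "AE z in lborel. norm (norm (g z * m z) powr s) \<le> norm (norm (g z) powr s * \<bar>B\<bar> powr s)"
    proof (rule AE_I2)
      fix z
      show "norm (norm (g z * m z) powr s) \<le> norm (norm (g z) powr s * \<bar>B\<bar> powr s)"
      proof (cases "z \<in> ball c R")
        case True
        then have "m z \<in> m ` cball c R" using ball_subset_cball by blast
        with B have "norm (m z) \<le> B" by blast
        then have "norm (m z) \<le> \<bar>B\<bar>" by linarith
        then have "norm (m z) powr s \<le> \<bar>B\<bar> powr s" using s by (intro powr_mono2) auto
        then have "norm (g z) powr s * norm (m z) powr s \<le> norm (g z) powr s * \<bar>B\<bar> powr s"
          by (rule mult_left_mono) simp
        then show ?thesis by (simp add: norm_mult powr_mult)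
      qed (simp add: supp)
    qed
  qed simp
qed

lemma integrable_powr_add:
  fixes f g :: "complex \<Rightarrow> complex"
  assumes [measurable]: "f \<in> borel_measurable M" "g \<in> borel_measurable M"
    and f: "integrable M (\<lambda>z. norm (f z) powr s)" and g: "integrable M (\<lambda>z. norm (g z) powr s)" and s: "s \<ge> 0"
  shows "integrable M (\<lambda>z. norm (f z + g z) powr s)"
proof (rule Bochner_Integration.integrable_bound)
  show "integrable M (\<lambda>z. 2 powr s * (norm (f z) powr s + norm (g z) powr s))"
    using f g by simp
  show "AE z in M. norm (norm (f z + g z) powr s) \<le> norm (2 powr s * (norm (f z) powr s + norm (g z) powr s))"
  proof (rule AE_I2)
    fix z
    have "norm (f z + g z) \<le> 2 * max (norm (f z)) (norm (g z))"
      using norm_triangle_ineq[of "f z" "g z"] by simp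
    then have "norm (f z + g z) powr s \<le> (2 * max (norm (f z)) (norm (g z))) powr s"
      using s by (intro powr_mono2) auto
    also have "\<dots> = 2 powr s * max (norm (f z)) (norm (g z)) powr s" by (simp add: powr_mult)
    also have "\<dots> \<le> 2 powr s * (norm (f z) powr s + norm (g z) powr s)"
      by (intro mult_left_mono) (auto simp: max_def)
    finally show "norm (norm (f z + g z) powr s) \<le> norm (2 powr s * (norm (f z) powr s + norm (g z) powr s))" by simp
  qed
qed simp

lemma integrable_of_powr:
  fixes g :: "complex \<Rightarrow> complex"
  assumes [measurable]: "g \<in> borel_measurable borel" and supp: "\<And>z. z \<notin> ball c R \<Longrightarrow> g z = 0"
    and g: "integrable lborel (\<lambda>z. norm (g z) powr s)" and s: "s \<ge> 1"
  shows "integrable lborel g"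
proof (rule Bochner_Integration.integrable_bound)
  show "integrable lborel (\<lambda>z. indicator (ball c R) z + norm (g z) powr s)"
    using g emeasure_lborel_ball_finite[of c R] by (intro Bochner_Integration.integrable_add) auto
  show "AE z in lborel. norm (g z) \<le> norm (indicator (ball c R) z + norm (g z) powr s)"
  proof (rule AE_I2)
    fix z
    have "norm (g z) \<le> 1 + norm (g z) powr s"
    proof (cases "norm (g z) \<le> 1")
      case True
      then show ?thesis using powr_ge_zero[of "norm (g z)" s] by linarith
    next
      case False
      then have "norm (g z) powr 1 \<le> norm (g z) powr s" using s by (intro powr_mono) auto
      then show ?thesis by simp
    qed
    then show "norm (g z) \<le> norm (indicator (ball c R) z + norm (g z) powr s)"
      using supp[of z] by (cases "z \<in> ball c R") simp_all
  qed
qed simp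

text \<open>Evaluated on the two-parameter family of localised kernels, the weak equation is exactly
  the hypothesis \<open>eq\<close> of \<open>cauchy_potential_representation\<close> for
  \<open>f0 z * X z\<close> in the role of \<open>h\<close>. The exponent \<open>s\<close> is
  arbitrary from 1 on, so the formula serves both the integrability gain and the Hoelder
  estimate.\<close>

lemma weak_cdbar_representation:
  assumes \<Omega>: "open \<Omega>" "cball c R \<subseteq> \<Omega>" "R > 0" and weak: "weak_cdbar \<Omega> f g" and s: "s \<ge> 1"
    and f: "f \<in> L_space s (cball c R)" and g: "g \<in> L_space s (cball c R)"
  shows "\<exists>H. H \<in> borel_measurable borel \<and> (\<forall>z. z \<notin> ball c R \<longrightarrow> H z = 0) \<and>
    integrable lborel (\<lambda>z. norm (H z) powr s) \<and>
    (AE z in lebesgue. z \<in> ball c R \<longrightarrow> f z = cauchy_potential H z * inverse (of_real (poisson_mass * cutoff c R z)))"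
proof -
  obtain f0 where f0[measurable]: "f0 \<in> borel_measurable borel" and f0s: "\<And>z. z \<notin> ball c R \<Longrightarrow> f0 z = 0"
    and f0i: "integrable lborel (\<lambda>z. norm (f0 z) powr s)" and f0ae: "AE z in lebesgue. z \<in> ball c R \<longrightarrow> f z = f0 z"
    and f0I: "\<And>D \<Omega>. D \<in> borel_measurable borel \<Longrightarrow> (\<forall>z. z \<notin> ball c R \<longrightarrow> D z = 0) \<Longrightarrow> \<Omega> \<in> sets lebesgue \<Longrightarrow> cball c R \<subseteq> \<Omega> \<Longrightarrow>
       (\<integral>z. f z * D z \<partial>lebesgue_on \<Omega>) = (\<integral>z. f0 z * D z \<partial>lborel)"
    using L_space_borel_representative[OF f] by blast
  obtain g0 where g0[measurable]: "g0 \<in> borel_measurable borel" and g0s: "\<And>z. z \<notin> ball c R \<Longrightarrow> g0 z = 0"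
    and g0i: "integrable lborel (\<lambda>z. norm (g0 z) powr s)"
    and g0I: "\<And>D \<Omega>. D \<in> borel_measurable borel \<Longrightarrow> (\<forall>z. z \<notin> ball c R \<longrightarrow> D z = 0) \<Longrightarrow> \<Omega> \<in> sets lebesgue \<Longrightarrow> cball c R \<subseteq> \<Omega> \<Longrightarrow>
       (\<integral>z. g z * D z \<partial>lebesgue_on \<Omega>) = (\<integral>z. g0 z * D z \<partial>lborel)"
    using L_space_borel_representative[OF g] by blast
  define E where "E z = complex_of_real (expinv 2 (R\<^sup>2 - (norm (z - c))\<^sup>2))" for z
  define X where "X z = complex_of_real (cutoff c R z)" for z
  \<comment> \<open>As \<open>(c - z) * E z\<close> is the dbar derivative of the cutoff,
    \<open>H\<close> is the formal dbar derivative of the product of the cutoff and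
    \<open>f\<close>.\<close>
  define H where "H z = g0 z * X z + f0 z * ((c - z) * E z)" for z
  have cE: "continuous_on UNIV E" unfolding E_def by (intro continuous_intros)
  have cX: "continuous_on UNIV X" unfolding X_def by (intro continuous_intros continuous_on_cutoff)
  have cE': "continuous_on UNIV (\<lambda>z. (c - z) * E z)" by (intro continuous_intros cE)
  have [measurable]: "E \<in> borel_measurable borel" "X \<in> borel_measurable borel"
    using cE cX by (auto intro: borel_measurable_continuous_onI)
  have Hm[measurable]: "H \<in> borel_measurable borel" unfolding H_def by measurable
  have Hs: "H z = 0" if "z \<notin> ball c R" for z using that by (simp add: H_def f0s g0s)
  have Hi: "integrable lborel (\<lambda>z. norm (H z) powr s)"
    unfolding H_def using s
    by (intro integrable_powr_add integrable_powr_mult_continuous[OF f0 f0s f0i cE']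
        integrable_powr_mult_continuous[OF g0 g0s g0i cX]) auto
  have H1: "integrable lborel H" by (rule integrable_of_powr[OF Hm Hs Hi s])
  have h1: "integrable lborel (\<lambda>z. f0 z * X z)"
    by (rule integrable_of_powr[OF _ _ integrable_powr_mult_continuous[OF f0 f0s f0i cX] s]) (use s f0s in auto)
  have f1: "integrable lborel (\<lambda>z. f0 z * ((c - z) * E z))"
    by (rule integrable_of_powr[OF _ _ integrable_powr_mult_continuous[OF f0 f0s f0i cE'] s]) (use s f0s in auto)
  have g1: "integrable lborel (\<lambda>z. g0 z * X z)"
    by (rule integrable_of_powr[OF _ _ integrable_powr_mult_continuous[OF g0 g0s g0i cX] s]) (use s g0s in auto)
  have zX: "X z = 0" "E z = 0" if "z \<notin> ball c R" for z
  proof -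
    have "R \<le> norm (z - c)" using that by (simp add: dist_norm norm_minus_commute)
    then have "R\<^sup>2 \<le> (norm (z - c))\<^sup>2" using \<Omega>(3) by (intro power_mono) auto
    then show "X z = 0" "E z = 0" by (simp_all add: X_def E_def cutoff_def expinv_def)
  qed
  \<comment> \<open>In the tested equation, the term in which dbar falls on the kernel yields the
    left side; the term in which it falls on the cutoff joins the right-hand side in
    \<open>H\<close>.\<close>
  have key: "(\<integral>z. f0 z * X z * of_real (e\<^sup>2 / ((norm (z - \<zeta>))\<^sup>2 + e\<^sup>2)\<^sup>2) \<partial>lborel)
      = (\<integral>z. H z * cauchy_reg e (\<zeta> - z) \<partial>lborel)" if e: "e > 0" for \<zeta> e
  proof -
    define K where "K z = cauchy_reg e (\<zeta> - z)" for z
    define P where "P z = complex_of_real (e\<^sup>2 / ((norm (z - \<zeta>))\<^sup>2 + e\<^sup>2)\<^sup>2)" for z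
    define \<phi> where "\<phi> z = of_real (cutoff c R z) * cauchy_reg e (\<zeta> - z)" for z
    have pos: "(norm w)\<^sup>2 + e\<^sup>2 \<noteq> 0" for w :: complex using e by (simp add: sum_power2_eq_zero_iff)
    have cP: "continuous_on UNIV P" unfolding P_def using pos by (intro continuous_intros) auto
    have cK: "continuous_on UNIV K" unfolding K_def cauchy_reg_def using pos by (intro continuous_intros) (auto simp flip: of_real_power of_real_add)
    have [measurable]: "P \<in> borel_measurable borel" "K \<in> borel_measurable borel"
      using cP cK by (auto intro: borel_measurable_continuous_onI)
    have int: "integrable lborel (\<lambda>z. k z * m z)" if "integrable lborel k" "continuous_on UNIV m" "\<And>z. z \<notin> ball c R \<Longrightarrow> k z = 0" for k m :: "complex \<Rightarrow> complex"
    proof -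
      have "k \<in> borel_measurable borel" using that(1) by simp
      then have "integrable lborel (\<lambda>z. norm (k z * m z) powr 1)"
        using that by (intro integrable_powr_mult_continuous[of k c R 1 m]) auto
      then have "integrable lborel (\<lambda>z. norm (k z * m z))" by simp
      moreover have "(\<lambda>z. k z * m z) \<in> borel_measurable lborel"
        using that(1) borel_measurable_continuous_onI[OF that(2)] by simp
      ultimately show ?thesis by (simp add: integrable_norm_iff)
    qed
    have \<phi>: "\<phi> \<in> test_functions \<Omega>"
      unfolding \<phi>_def by (rule test_function_cutoff[OF e \<Omega>(3,2)])
    have d: "(partial_x \<phi> z + \<i> * partial_y \<phi> z) / 2 = (c - z) * E z * K z - X z * P z" for z
      using dbar_cutoff[OF e, of c R \<zeta> z] by (simp add: \<phi>_def[abs_def] E_def K_def X_def P_def)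
    have oS: "\<Omega> \<in> sets lebesgue" using \<Omega>(1) by simp
    have "(\<integral>z. f0 z * ((c - z) * E z * K z - X z * P z) \<partial>lborel) = (\<integral>z. f z * ((c - z) * E z * K z - X z * P z) \<partial>lebesgue_on \<Omega>)"
      by (rule f0I[symmetric]) (use zX \<Omega> oS in auto)
    also have "\<dots> = - (\<integral>z. g z * \<phi> z \<partial>lebesgue_on \<Omega>)"
      using weak \<phi> unfolding weak_cdbar_def d[symmetric] by blast
    also have "(\<integral>z. g z * \<phi> z \<partial>lebesgue_on \<Omega>) = (\<integral>z. g z * (X z * K z) \<partial>lebesgue_on \<Omega>)"
      by (simp add: \<phi>_def X_def K_def)
    also have "\<dots> = (\<integral>z. g0 z * (X z * K z) \<partial>lborel)"
      by (rule g0I) (use zX \<Omega> oS in auto)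
    finally have eq: "(\<integral>z. f0 z * ((c - z) * E z * K z - X z * P z) \<partial>lborel) = - (\<integral>z. g0 z * (X z * K z) \<partial>lborel)" .
    have i1: "integrable lborel (\<lambda>z. f0 z * ((c - z) * E z) * K z)" by (rule int[OF f1 cK]) (simp add: f0s)
    have i2: "integrable lborel (\<lambda>z. f0 z * X z * P z)" by (rule int[OF h1 cP]) (simp add: f0s)
    have i3: "integrable lborel (\<lambda>z. g0 z * X z * K z)" by (rule int[OF g1 cK]) (simp add: g0s)
    have "(\<integral>z. f0 z * ((c - z) * E z * K z - X z * P z) \<partial>lborel)
      = (\<integral>z. f0 z * ((c - z) * E z) * K z - f0 z * X z * P z \<partial>lborel)"
      by (simp only: right_diff_distrib mult.assoc)
    also have "\<dots> = (\<integral>z. f0 z * ((c - z) * E z) * K z \<partial>lborel) - (\<integral>z. f0 z * X z * P z \<partial>lborel)"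
      by (rule Bochner_Integration.integral_diff[OF i1 i2])
    also have "(\<integral>z. f0 z * ((c - z) * E z * K z - X z * P z) \<partial>lborel) = - (\<integral>z. g0 z * X z * K z \<partial>lborel)"
      unfolding eq by (simp only: mult.assoc)
    finally have "(\<integral>z. f0 z * X z * P z \<partial>lborel) = (\<integral>z. g0 z * X z * K z \<partial>lborel) + (\<integral>z. f0 z * ((c - z) * E z) * K z \<partial>lborel)"
      by (simp add: eq_diff_eq diff_eq_eq add.commute)
    also have "\<dots> = (\<integral>z. g0 z * X z * K z + f0 z * ((c - z) * E z) * K z \<partial>lborel)"
      by (rule Bochner_Integration.integral_add[OF i3 i1, symmetric])
    also have "\<dots> = (\<integral>z. H z * K z \<partial>lborel)"
      by (simp only: H_def distrib_right)
    finally show ?thesis by (simp add: P_def K_def)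
  qed
  have "AE z in lborel. of_real poisson_mass * (f0 z * X z) = cauchy_potential H z"
    by (rule cauchy_potential_representation[OF h1 H1 key])
  then have "AE z in lebesgue. of_real poisson_mass * (f0 z * X z) = cauchy_potential H z"
    by (rule AE_completion)
  with f0ae have "AE z in lebesgue. z \<in> ball c R \<longrightarrow> f z = cauchy_potential H z * inverse (of_real (poisson_mass * cutoff c R z))"
  proof eventually_elim
    case (elim z)
    show ?case
    proof
      assume z: "z \<in> ball c R"
      then have "(norm (z - c))\<^sup>2 < R\<^sup>2"
        by (intro power_strict_mono) (auto simp: dist_norm norm_minus_commute)
      then have "cutoff c R z > 0" by (simp add: cutoff_def expinv_pos)
      moreover have "f z = f0 z" using elim z by simp
      ultimately show "f z = cauchy_potential H z * inverse (of_real (poisson_mass * cutoff c R z))"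
        using elim(2)[symmetric] poisson_mass_pos by (simp add: X_def divide_inverse[symmetric])
    qed
  qed
  then show ?thesis using Hm Hs Hi by blast
qed

section \<open>Closure properties of the Lebesgue spaces\<close>

lemma L_space_D:
  assumes "f \<in> L_space p S"
  shows "f \<in> borel_measurable (lebesgue_on S)" "integrable (lebesgue_on S) (\<lambda>z. norm (f z) powr p)"
  using assms by (auto simp: L_space_def)

lemma integrable_lebesgue_on_subset:
  fixes f :: "complex \<Rightarrow> 'b::{banach,second_countable_topology}"
  assumes "integrable (lebesgue_on S) f" "T \<subseteq> S" "T \<in> sets lebesgue" "S \<in> sets lebesgue"
  shows "integrable (lebesgue_on T) f"
proof -
  have "integrable lebesgue (\<lambda>z. indicator S z *\<^sub>R f z)"
    using assms by (subst (asm) integrable_restrict_space) auto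
  then have "integrable lebesgue (\<lambda>z. indicator T z *\<^sub>R (indicator S z *\<^sub>R f z))"
    using assms by (intro integrable_mult_indicator[of T]) auto
  moreover have "indicator T z *\<^sub>R (indicator S z *\<^sub>R f z) = indicator T z *\<^sub>R f z" for z
    using assms(2) by (auto simp: indicator_def)
  ultimately have "integrable lebesgue (\<lambda>z. indicator T z *\<^sub>R f z)" by (simp only:)
  then show ?thesis
    using assms(3) by (subst integrable_restrict_space) auto
qed

text \<open>Pointwise the power \<open>r\<close> is at most \<open>1 +\<close> the power
  \<open>p\<close>, and constants are integrable because \<open>T\<close> has finite
  measure.\<close>

lemma L_space_mono:
  assumes f: "f \<in> L_space p S" and T: "T \<subseteq> S" "T \<in> lmeasurable" "S \<in> sets lebesgue" and r: "0 \<le> r" "r \<le> p"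
  shows "f \<in> L_space r T"
proof -
  have Ts: "T \<in> sets lebesgue" using T(2) by (rule fmeasurableD)
  have m: "f \<in> borel_measurable (lebesgue_on T)"
    using L_space_D(1)[OF f] T(1) by (rule measurable_restrict_mono)
  interpret finite_measure "lebesgue_on T" by (rule finite_measure_lebesgue_on[OF T(2)])
  have "integrable (lebesgue_on T) (\<lambda>z. 1 + norm (f z) powr p)"
    using integrable_lebesgue_on_subset[OF L_space_D(2)[OF f] T(1) Ts T(3)]
    by (intro Bochner_Integration.integrable_add) auto
  then have "integrable (lebesgue_on T) (\<lambda>z. norm (f z) powr r)"
  proof (rule Bochner_Integration.integrable_bound)
    show "AE z in lebesgue_on T. norm (norm (f z) powr r) \<le> norm (1 + norm (f z) powr p)"
    proof (rule AE_I2)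
      fix z
      show "norm (norm (f z) powr r) \<le> norm (1 + norm (f z) powr p)"
      proof (cases "norm (f z) \<le> 1")
        case True
        then have "norm (f z) powr r \<le> 1"
          using r powr_mono2[of r "norm (f z)" 1] by simp
        then show ?thesis by (simp add: add_increasing2)
      next
        case False
        then have "norm (f z) powr r \<le> norm (f z) powr p" using r by (intro powr_mono) auto
        then show ?thesis by simp
      qed
    qed
    show "(\<lambda>z. norm (f z) powr r) \<in> borel_measurable (lebesgue_on T)" using m by measurable
  qed
  with m show ?thesis by (simp add: L_space_def)
qed

lemma L_space_add:
  assumes "f \<in> L_space p S" "g \<in> L_space p S" "p \<ge> 0"
  shows "(\<lambda>z. f z + g z) \<in> L_space p S"
proof -
  note [measurable] = L_space_D(1)[OF assms(1)] L_space_D(1)[OF assms(2)]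
  have "(\<lambda>z. f z + g z) \<in> borel_measurable (lebesgue_on S)" by measurable
  then show ?thesis
    using integrable_powr_add[OF _ _ L_space_D(2)[OF assms(1)] L_space_D(2)[OF assms(2)] assms(3)] L_space_D(1)[OF assms(1)] L_space_D(1)[OF assms(2)]
    by (simp add: L_space_def)
qed

lemma L_space_cmult:
  assumes "f \<in> L_space p S"
  shows "(\<lambda>z. k * f z) \<in> L_space p S"
proof -
  note [measurable] = L_space_D(1)[OF assms]
  have "(\<lambda>z. k * f z) \<in> borel_measurable (lebesgue_on S)" by measurable
  then show ?thesis using L_space_D(2)[OF assms] by (simp add: L_space_def norm_mult powr_mult)
qed

lemma L_space_cnj:
  assumes "f \<in> L_space p S"
  shows "(\<lambda>z. cnj (f z)) \<in> L_space p S"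
proof -
  have "(\<lambda>z. cnj (f z)) \<in> borel_measurable (lebesgue_on S)"
    by (rule measurable_compose[OF L_space_D(1)[OF assms]]) (intro borel_measurable_continuous_onI continuous_intros)
  then show ?thesis using L_space_D(2)[OF assms] by (simp add: L_space_def)
qed

lemma L_space_dominated:
  assumes U: "U \<in> borel_measurable (lebesgue_on S)" and f: "f \<in> L_space p S" and p: "p \<ge> 0"
    and le: "AE z in lebesgue_on S. norm (U z) \<le> norm (f z)"
  shows "U \<in> L_space p S"
proof -
  have "integrable (lebesgue_on S) (\<lambda>z. norm (U z) powr p)"
  proof (rule Bochner_Integration.integrable_bound[OF L_space_D(2)[OF f]])
    show "AE z in lebesgue_on S. norm (norm (U z) powr p) \<le> norm (norm (f z) powr p)"
      using le by eventually_elim (simp add: powr_mono2 p)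
    show "(\<lambda>z. norm (U z) powr p) \<in> borel_measurable (lebesgue_on S)" using U by measurable
  qed
  with U show ?thesis by (simp add: L_space_def)
qed

lemma L_space_bounded_mult:
  assumes f: "f \<in> L_space p S" and a: "a \<in> L_inf S" and p: "p \<ge> 0"
  shows "(\<lambda>z. a z * f z) \<in> L_space p S"
proof -
  obtain C where C: "AE z in lebesgue_on S. norm (a z) \<le> C" and am: "a \<in> borel_measurable (lebesgue_on S)"
    using a unfolding L_inf_def by blast
  show ?thesis
  proof (rule L_space_dominated[OF _ L_space_cmult[OF f, of "of_real \<bar>C\<bar>"] p])
    show "(\<lambda>z. a z * f z) \<in> borel_measurable (lebesgue_on S)"
      using am L_space_D(1)[OF f] by measurable
    show "AE z in lebesgue_on S. norm (a z * f z) \<le> norm (complex_of_real \<bar>C\<bar> * f z)"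
      using C
    proof eventually_elim
      case (elim z)
      then have "norm (a z) \<le> \<bar>C\<bar>" by linarith
      then show ?case by (simp add: norm_mult mult_right_mono)
    qed
  qed
qed

lemma AE_lebesgue_on:
  assumes "S \<in> sets lebesgue"
  shows "(AE z in lebesgue_on S. P z) \<longleftrightarrow> (AE z in lebesgue. z \<in> S \<longrightarrow> P z)"
  using assms by (intro AE_restrict_space_iff) auto

lemma L_inf_mono:
  assumes "a \<in> L_inf S" "T \<subseteq> S" "S \<in> sets lebesgue" "T \<in> sets lebesgue"
  shows "a \<in> L_inf T"
proof -
  obtain C where C: "AE z in lebesgue_on S. norm (a z) \<le> C" and am: "a \<in> borel_measurable (lebesgue_on S)"
    using assms unfolding L_inf_def by blast
  have "AE z in lebesgue_on T. norm (a z) \<le> C"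
    using C unfolding AE_lebesgue_on[OF assms(3)] AE_lebesgue_on[OF assms(4)]
    by eventually_elim (use assms(2) in blast)
  moreover have "a \<in> borel_measurable (lebesgue_on T)"
    using am assms(2) by (rule measurable_restrict_mono)
  ultimately show ?thesis unfolding L_inf_def by blast
qed

text \<open>On the smaller disk \<open>f\<close> is the potential times a bounded factor, the
  reciprocal of the cutoff, so it inherits the better exponent of the potential.\<close>

lemma weak_cdbar_gain:
  assumes \<Omega>: "open \<Omega>" "cball c R \<subseteq> \<Omega>" and R: "0 \<le> R'" "R' < R" and weak: "weak_cdbar \<Omega> f g"
    and s: "1 < s" "s < 2" "s < t" "t < 2 * s / (2 - s)"
    and f: "f \<in> L_space s (cball c R)" and g: "g \<in> L_space s (cball c R)"
  shows "f \<in> L_space t (cball c R')"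
proof -
  have "R > 0" "s \<ge> 1" using R s by auto
  obtain H where H: "H \<in> borel_measurable borel" "\<And>z. z \<notin> ball c R \<Longrightarrow> H z = 0"
      "integrable lborel (\<lambda>z. norm (H z) powr s)"
    and fH: "AE z in lebesgue. z \<in> ball c R \<longrightarrow> f z = cauchy_potential H z * inverse (of_real (poisson_mass * cutoff c R z))"
    using weak_cdbar_representation[OF \<Omega> \<open>R > 0\<close> weak \<open>s \<ge> 1\<close> f g] by blast
  obtain \<delta> where \<delta>: "\<delta> > 0" "\<forall>z\<in>cball c R'. cutoff c R z \<ge> \<delta>"
    using cutoff_lower_bound[OF R] by blast
  have fm: "f \<in> borel_measurable (lebesgue_on (cball c R'))"
    by (rule measurable_restrict_mono[OF L_space_D(1)[OF f]]) (use R in auto)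
  have [measurable]: "cauchy_potential H \<in> borel_measurable borel"
    by (rule cauchy_potential_measurable[OF H(1)])
  have "integrable lborel (\<lambda>z. indicator (cball c R) z * norm (cauchy_potential H z) powr t)"
    by (rule cauchy_potential_gain[OF s H])
  then have "integrable lebesgue (\<lambda>z. indicator (cball c R) z *\<^sub>R (norm (cauchy_potential H z) powr t))"
    by (subst integrable_completion) auto
  then have "integrable (lebesgue_on (cball c R)) (\<lambda>z. norm (cauchy_potential H z) powr t)"
    by (subst integrable_restrict_space) auto
  then have "integrable (lebesgue_on (cball c R')) (\<lambda>z. norm (cauchy_potential H z) powr t)"
    by (rule integrable_lebesgue_on_subset) (use R in auto)
  then have "integrable (lebesgue_on (cball c R')) (\<lambda>z. norm (cauchy_potential H z) powr t * (1 / (poisson_mass * \<delta>)) powr t)"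
    by (rule integrable_mult_left)
  then have "integrable (lebesgue_on (cball c R')) (\<lambda>z. norm (f z) powr t)"
  proof (rule Bochner_Integration.integrable_bound)
    show "(\<lambda>z. norm (f z) powr t) \<in> borel_measurable (lebesgue_on (cball c R'))"
      using fm by measurable
    have "AE z in lebesgue. z \<in> cball c R' \<longrightarrow> norm (norm (f z) powr t)
        \<le> norm (norm (cauchy_potential H z) powr t * (1 / (poisson_mass * \<delta>)) powr t)"
      using fH
    proof eventually_elim
      case (elim z)
      show ?case
      proof
        assume z: "z \<in> cball c R'"
        then have "z \<in> ball c R" using R by auto
        then have fz: "f z = cauchy_potential H z * inverse (of_real (poisson_mass * cutoff c R z))"
          using elim by blast
        have cz: "cutoff c R z \<ge> \<delta>" using \<delta> z by blast
        then have c0: "cutoff c R z > 0" using \<delta>(1) by linarith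
        have le: "poisson_mass * \<delta> \<le> poisson_mass * cutoff c R z"
          using cz poisson_mass_pos by (intro mult_left_mono) auto
        have p0: "0 < poisson_mass * \<delta>" using \<delta>(1) poisson_mass_pos by (rule mult_pos_pos[rotated])
        have "norm (f z) = norm (cauchy_potential H z) * (1 / (poisson_mass * cutoff c R z))"
          unfolding fz norm_mult norm_inverse norm_of_real using le p0 by (simp add: divide_inverse)
        also have "\<dots> \<le> norm (cauchy_potential H z) * (1 / (poisson_mass * \<delta>))"
          using le p0 c0 \<delta>(1) poisson_mass_pos by (intro mult_left_mono[OF divide_left_mono] mult_pos_pos) auto
        finally have "norm (f z) powr t \<le> (norm (cauchy_potential H z) * (1 / (poisson_mass * \<delta>))) powr t"
          using s by (intro powr_mono2) auto
        also have "\<dots> = norm (cauchy_potential H z) powr t * (1 / (poisson_mass * \<delta>)) powr t"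
          by (rule powr_mult)
        finally show "norm (norm (f z) powr t) \<le> norm (norm (cauchy_potential H z) powr t * (1 / (poisson_mass * \<delta>)) powr t)"
          by simp
      qed
    qed
    then show "AE z in lebesgue_on (cball c R'). norm (norm (f z) powr t)
        \<le> norm (norm (cauchy_potential H z) powr t * (1 / (poisson_mass * \<delta>)) powr t)"
      by (subst AE_lebesgue_on) simp_all
  qed
  with fm show ?thesis by (simp add: L_space_def)
qed

text \<open>On the smaller disk the reciprocal of the cutoff is Hoelder continuous, being the
  inverse of such a function bounded away from 0, and Hoelder functions on a bounded set are closed
  under products.\<close>

lemma weak_cdbar_hoelder:
  assumes \<Omega>: "open \<Omega>" "cball c R \<subseteq> \<Omega>" and R: "0 \<le> R'" "R' < R" and weak: "weak_cdbar \<Omega> f g"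
    and q: "2 < q"
    and f: "f \<in> L_space q (cball c R)" and g: "g \<in> L_space q (cball c R)"
  shows "\<exists>G\<in>hoelder (1 - 2 / q) (cball c R'). AE z in lebesgue. z \<in> cball c R' \<longrightarrow> f z = G z"
proof -
  have "R > 0" "q \<ge> 1" and e: "0 < 1 - 2 / q" "1 - 2 / q \<le> 1" using R q by auto
  obtain H where H: "H \<in> borel_measurable borel" "\<And>z. z \<notin> ball c R \<Longrightarrow> H z = 0"
      "integrable lborel (\<lambda>z. norm (H z) powr q)"
    and fH: "AE z in lebesgue. z \<in> ball c R \<longrightarrow> f z = cauchy_potential H z * inverse (of_real (poisson_mass * cutoff c R z))"
    using weak_cdbar_representation[OF \<Omega> \<open>R > 0\<close> weak \<open>q \<ge> 1\<close> f g] by blast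
  obtain \<delta> where \<delta>: "\<delta> > 0" "\<forall>z\<in>cball c R'. cutoff c R z \<ge> \<delta>"
    using cutoff_lower_bound[OF R] by blast
  obtain C where C: "\<forall>\<zeta>1 \<zeta>2. norm (cauchy_potential H \<zeta>1 - cauchy_potential H \<zeta>2) \<le> C * norm (\<zeta>1 - \<zeta>2) powr (1 - 2 / q)"
    using cauchy_potential_hoelder[OF q H] by blast
  have h1: "cauchy_potential H \<in> hoelder (1 - 2 / q) (cball c R')"
    unfolding hoelder_def dist_norm using C by blast
  have "(\<lambda>z. of_real poisson_mass * of_real (cutoff c R z)) \<in> hoelder (1 - 2 / q) (cball c R')"
    by (rule hoelder_mult[OF hoelder_const hoelder_cutoff[OF e(2)] bounded_cball e(1)])
  then have "(\<lambda>z. of_real (poisson_mass * cutoff c R z)) \<in> hoelder (1 - 2 / q) (cball c R')"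
    by simp
  then have h2': "(\<lambda>z. complex_of_real (poisson_mass * cutoff c R z)) \<in> hoelder (1 - 2 / q) (cball c R')" .
  have h2: "(\<lambda>z. inverse (of_real (poisson_mass * cutoff c R z))) \<in> hoelder (1 - 2 / q) (cball c R')"
  proof (rule hoelder_inverse[OF h2', where \<delta> = "poisson_mass * \<delta>"])
    show "poisson_mass * \<delta> > 0" using \<delta>(1) poisson_mass_pos by (rule mult_pos_pos[rotated])
    fix z assume "z \<in> cball c R'"
    then have cz: "\<delta> \<le> cutoff c R z" using \<delta>(2) by blast
    have "poisson_mass * \<delta> \<le> poisson_mass * cutoff c R z"
      using cz poisson_mass_pos by (intro mult_left_mono) auto
    also have "\<dots> \<le> norm (complex_of_real (poisson_mass * cutoff c R z))"
      by (simp only: norm_of_real abs_ge_self)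
    finally show "poisson_mass * \<delta> \<le> norm (complex_of_real (poisson_mass * cutoff c R z))" .
  qed
  have "(\<lambda>z. cauchy_potential H z * inverse (of_real (poisson_mass * cutoff c R z))) \<in> hoelder (1 - 2 / q) (cball c R')"
    by (rule hoelder_mult[OF h1 h2 bounded_cball e(1)])
  moreover have "AE z in lebesgue. z \<in> cball c R' \<longrightarrow> f z = cauchy_potential H z * inverse (of_real (poisson_mass * cutoff c R z))"
    using fH
  proof (rule eventually_mono, intro impI)
    fix z assume *: "z \<in> ball c R \<longrightarrow> f z = cauchy_potential H z * inverse (of_real (poisson_mass * cutoff c R z))" and z: "z \<in> cball c R'"
    have "z \<in> ball c R" using R z by simp
    with * show "f z = cauchy_potential H z * inverse (of_real (poisson_mass * cutoff c R z))" by (rule mp)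
  qed
  ultimately show ?thesis by (intro bexI[where x = "\<lambda>z. cauchy_potential H z * inverse (of_real (poisson_mass * cutoff c R z))"])
qed

section \<open>Reduction of the bicomplex equation to scalar ones\<close>

text \<open>Conjugation is real linear and so commutes with real partial derivatives. Needed for the
  second scalar component, where the test function is conjugated.\<close>

lemma C_k_cnj: "C_k k \<phi> \<Longrightarrow> C_k k (\<lambda>z. cnj (\<phi> z))"
  and partial_cnj: "\<phi> differentiable (at z) \<Longrightarrow> partial_x (\<lambda>z. cnj (\<phi> z)) z = cnj (partial_x \<phi> z)"
    "\<phi> differentiable (at z) \<Longrightarrow> partial_y (\<lambda>z. cnj (\<phi> z)) z = cnj (partial_y \<phi> z)"
proof -
  have d: "((\<lambda>z. cnj (\<phi> z)) has_derivative (\<lambda>h. cnj (frechet_derivative \<phi> (at z) h))) (at z)"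
    if "\<phi> differentiable (at z)" for \<phi> :: "complex \<Rightarrow> complex" and z
    using that unfolding frechet_derivative_works by (rule has_derivative_cnj)
  have x: "partial_x (\<lambda>z. cnj (\<phi> z)) z = cnj (partial_x \<phi> z)" if "\<phi> differentiable (at z)" for \<phi> :: "complex \<Rightarrow> complex" and z
    unfolding partial_x_def frechet_derivative_at[OF d[OF that], symmetric] ..
  have y: "partial_y (\<lambda>z. cnj (\<phi> z)) z = cnj (partial_y \<phi> z)" if "\<phi> differentiable (at z)" for \<phi> :: "complex \<Rightarrow> complex" and z
    unfolding partial_y_def frechet_derivative_at[OF d[OF that], symmetric] ..
  show "C_k k \<phi> \<Longrightarrow> C_k k (\<lambda>z. cnj (\<phi> z))"
  proof (induction k arbitrary: \<phi>)
    case 0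
    then show ?case by (simp add: continuous_on_cnj)
  next
    case (Suc k)
    then have diff: "\<phi> differentiable (at z)" for z by simp
    have "partial_x (\<lambda>z. cnj (\<phi> z)) = (\<lambda>z. cnj (partial_x \<phi> z))" "partial_y (\<lambda>z. cnj (\<phi> z)) = (\<lambda>z. cnj (partial_y \<phi> z))"
      using x[OF diff] y[OF diff] by (simp_all add: fun_eq_iff)
    moreover have "(\<lambda>z. cnj (\<phi> z)) differentiable (at z)" for z
      by (rule differentiableI[OF d[OF diff]])
    ultimately show ?case using Suc.prems Suc.IH[of "partial_x \<phi>"] Suc.IH[of "partial_y \<phi>"] by simp
  qed
  show "\<phi> differentiable (at z) \<Longrightarrow> partial_x (\<lambda>z. cnj (\<phi> z)) z = cnj (partial_x \<phi> z)" by (rule x)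
  show "\<phi> differentiable (at z) \<Longrightarrow> partial_y (\<lambda>z. cnj (\<phi> z)) z = cnj (partial_y \<phi> z)" by (rule y)
qed

section \<open>Test functions and the integrability of tested products\<close>

lemma test_functions_cnj: "\<phi> \<in> test_functions \<Omega> \<Longrightarrow> (\<lambda>z. cnj (\<phi> z)) \<in> test_functions \<Omega>"
  by (simp add: test_functions_def C_k_cnj)

lemma test_functions_zero: "(\<lambda>_. 0) \<in> test_functions \<Omega>"
proof -
  have "C_k k (\<lambda>_. 0)" for k
    by (rule C_k_coinduct[of "{\<lambda>_. 0}"]) auto
  then show ?thesis by (simp add: test_functions_def)
qed

lemma test_functionD:
  assumes "\<phi> \<in> test_functions \<Omega>"
  shows "\<phi> differentiable (at z)" "continuous_on UNIV \<phi>" "continuous_on UNIV (partial_x \<phi>)" "continuous_on UNIV (partial_y \<phi>)"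
proof -
  have C: "C_k k \<phi>" for k using assms by (simp add: test_functions_def)
  show "\<phi> differentiable (at z)" using C[of "Suc 0"] by simp
  show "continuous_on UNIV \<phi>" using C[of 0] by simp
  show "continuous_on UNIV (partial_x \<phi>)" "continuous_on UNIV (partial_y \<phi>)" using C[of "Suc 0"] by simp_all
qed

lemma partial_outside_support:
  assumes "z \<notin> closure {z. \<phi> z \<noteq> (0::complex)}"
  shows "partial_x \<phi> z = 0" "partial_y \<phi> z = 0"
proof -
  have z0: "\<phi> x = 0" if "x \<in> - closure {z. \<phi> z \<noteq> 0}" for x
    using that closure_subset[of "{z. \<phi> z \<noteq> 0}"] by blast
  have "open (- closure {z. \<phi> z \<noteq> 0})" by (rule open_Compl[OF closed_closure])
  then have "(\<phi> has_derivative (\<lambda>_. 0)) (at z)"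
    by (rule has_derivative_transform_within_open[OF has_derivative_const])
       (use assms in simp, rule z0[symmetric])
  from frechet_derivative_at[OF this, symmetric]
  show "partial_x \<phi> z = 0" "partial_y \<phi> z = 0" by (simp_all add: partial_x_def partial_y_def)
qed

text \<open>The Bochner integral of a non-integrable function is 0 by convention, so the weak
  identity can be split into components only once each product is known to be integrable. The
  compact support of the test function reduces this to local integrability.\<close>

lemma integrable_L_loc_mult:
  assumes u: "u \<in> L_loc 1 \<Omega>" and \<Omega>: "\<Omega> \<in> sets lebesgue" and K: "compact K" "K \<subseteq> \<Omega>"
    and m: "continuous_on UNIV m" "\<And>z. z \<notin> K \<Longrightarrow> m z = 0"
  shows "integrable (lebesgue_on \<Omega>) (\<lambda>z. u z * m z)"
proof -
  have uK: "u \<in> L_space 1 K" using u K by (simp add: L_loc_def)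
  have Ks: "K \<in> sets lebesgue" by (rule fmeasurableD[OF lmeasurable_compact[OF K(1)]])
  have mm: "m \<in> borel_measurable (lebesgue_on K)"
    by (rule continuous_imp_measurable_on_sets_lebesgue[OF continuous_on_subset[OF m(1) subset_UNIV] Ks])
  have um: "u \<in> borel_measurable (lebesgue_on K)" by (rule L_space_D(1)[OF uK])
  have "bounded (m ` K)"
    by (rule compact_imp_bounded[OF compact_continuous_image[OF continuous_on_subset[OF m(1) subset_UNIV] K(1)]])
  then obtain B where B: "\<forall>x\<in>m ` K. norm x \<le> B" unfolding bounded_iff by blast
  have "integrable (lebesgue_on K) (\<lambda>z. norm (u z) powr 1 * \<bar>B\<bar>)"
    by (rule integrable_mult_left[OF L_space_D(2)[OF uK]])
  then have "integrable (lebesgue_on K) (\<lambda>z. u z * m z)"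
  proof (rule Bochner_Integration.integrable_bound)
    show "(\<lambda>z. u z * m z) \<in> borel_measurable (lebesgue_on K)" using um mm by measurable
    show "AE z in lebesgue_on K. norm (u z * m z) \<le> norm (norm (u z) powr 1 * \<bar>B\<bar>)"
    proof (rule AE_I2)
      fix z assume "z \<in> space (lebesgue_on K)"
      then have "m z \<in> m ` K" by simp
      with B have "norm (m z) \<le> B" by blast
      then have "norm (m z) \<le> \<bar>B\<bar>" by linarith
      then have "norm (u z) * norm (m z) \<le> norm (u z) * \<bar>B\<bar>" by (rule mult_left_mono) simp
      then show "norm (u z * m z) \<le> norm (norm (u z) powr 1 * \<bar>B\<bar>)"
        by (simp add: norm_mult)
    qed
  qed
  then have "integrable lebesgue (\<lambda>z. indicator K z *\<^sub>R (u z * m z))"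
    using Ks by (subst (asm) integrable_restrict_space) auto
  moreover have "indicator K z *\<^sub>R (u z * m z) = indicator \<Omega> z *\<^sub>R (u z * m z)" for z
  proof (cases "z \<in> K")
    case True
    then have "z \<in> \<Omega>" using K(2) by blast
    with True show ?thesis by simp
  qed (simp add: m(2))
  ultimately have "integrable lebesgue (\<lambda>z. indicator \<Omega> z *\<^sub>R (u z * m z))" by (simp only:)
  then show ?thesis
    using \<Omega> by (subst integrable_restrict_space) auto
qed

lemma integral_bicomplex:
  fixes f g :: "complex \<Rightarrow> complex"
  assumes "integrable M f" "integrable M g"
  shows "(\<integral>z. (f z, g z) \<partial>M) = (\<integral>z. f z \<partial>M, \<integral>z. g z \<partial>M)"
proof -
  have "integrable M (\<lambda>z. (f z, 0) + (0, g z) :: bicomplex)"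
    by (intro Bochner_Integration.integrable_add
        integrable_bounded_linear[OF bounded_linear_Pair[OF bounded_linear_ident bounded_linear_zero]]
        integrable_bounded_linear[OF bounded_linear_Pair[OF bounded_linear_zero bounded_linear_ident]] assms)
  then have "integrable M (\<lambda>z. (f z, g z))" by simp
  from integral_fst[OF this] integral_snd[OF this] show ?thesis
    by (simp add: prod_eq_iff)
qed

text \<open>Multiplying by \<open>(1 - i j)/2\<close> or \<open>(1 + i j)/2\<close> replaces \<open>j\<close> by \<open>i\<close> or \<open>-i\<close>; a complex conjugation reduces the
  second case to the first.\<close>
lemma weak_dbar_components:
  assumes \<Omega>: "open \<Omega>" and W: "(\<lambda>z. Sc (W z)) \<in> L_loc 1 \<Omega>" "(\<lambda>z. Vec (W z)) \<in> L_loc 1 \<Omega>"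
    and weak: "weak_dbar p \<Omega> W U"
  shows "weak_cdbar \<Omega> (\<lambda>z. Sc (W z) + \<i> * Vec (W z)) (\<lambda>z. Sc (U z) + \<i> * Vec (U z))"
    and "weak_cdbar \<Omega> (\<lambda>z. cnj (Sc (W z) - \<i> * Vec (W z))) (\<lambda>z. cnj (Sc (U z) - \<i> * Vec (U z)))"
proof -
  let ?M = "lebesgue_on \<Omega>"
  have U: "(\<lambda>z. Sc (U z)) \<in> L_loc 1 \<Omega>" "(\<lambda>z. Vec (U z)) \<in> L_loc 1 \<Omega>"
    using weak by (simp_all add: weak_dbar_def bc_space_def)
  have oS: "\<Omega> \<in> sets lebesgue" using \<Omega> by simp
  \<comment> \<open>For any square root \<open>k\<close> of -1, replacing \<open>j\<close> by
    \<open>k\<close> is an algebra homomorphism from the bicomplex to the complex numbers; both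
    scalar equations are instances, with \<open>k\<close> equal to \<i> and to its negative.\<close>
  have key: "(\<integral>z. (Sc (W z) + k * Vec (W z)) * ((partial_x \<phi> z + k * partial_y \<phi> z) / 2) \<partial>?M)
      = - (\<integral>z. (Sc (U z) + k * Vec (U z)) * \<phi> z \<partial>?M)"
    if \<phi>: "\<phi> \<in> test_functions \<Omega>" and k: "k * k = -1" for \<phi> k
  proof -
    define K where "K = closure {z. \<phi> z \<noteq> 0}"
    have K: "compact K" "K \<subseteq> \<Omega>" using \<phi> by (auto simp: test_functions_def K_def)
    have p0: "\<phi> z = 0" "partial_x \<phi> z = 0" "partial_y \<phi> z = 0" if "z \<notin> K" for z
      using that partial_outside_support[of z \<phi>] closure_subset[of "{z. \<phi> z \<noteq> 0}"] by (auto simp: K_def)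
    have int: "integrable ?M (\<lambda>z. u z * partial_x \<phi> z)" "integrable ?M (\<lambda>z. u z * partial_y \<phi> z)"
        "integrable ?M (\<lambda>z. u z * \<phi> z)" if "u \<in> L_loc 1 \<Omega>" for u
      by (rule integrable_L_loc_mult[OF that oS K test_functionD(3)[OF \<phi>] p0(2)]
               integrable_L_loc_mult[OF that oS K test_functionD(4)[OF \<phi>] p0(3)]
               integrable_L_loc_mult[OF that oS K test_functionD(2)[OF \<phi>] p0(1)]; assumption)+
    \<comment> \<open>Test functions with zero vector part suffice: the two components of one
      bicomplex identity already give both equations in \<open>eqs\<close>.\<close>
    define \<Phi> where "\<Phi> z = (\<phi> z, 0 :: complex)" for z
    have "\<Phi> \<in> bc_space (test_functions \<Omega>)"
      using \<phi> by (simp add: bc_space_def \<Phi>_def test_functions_zero)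
    then have eq: "(\<integral>z. W z *\<^sub>B dbar \<Phi> z \<partial>?M) = - (\<integral>z. U z *\<^sub>B \<Phi> z \<partial>?M)"
      using weak unfolding weak_dbar_def by blast
    have dP: "dbar \<Phi> z = (partial_x \<phi> z / 2, partial_y \<phi> z / 2)" for z
    proof -
      have "(\<phi> has_derivative frechet_derivative \<phi> (at z)) (at z)"
        using test_functionD(1)[OF \<phi>, of z] unfolding frechet_derivative_works .
      then have "(\<Phi> has_derivative (\<lambda>h. (frechet_derivative \<phi> (at z) h, 0))) (at z)"
        unfolding \<Phi>_def by (intro has_derivative_Pair) auto
      from frechet_derivative_at[OF this, symmetric]
      have "partial_x \<Phi> z = (partial_x \<phi> z, 0)" "partial_y \<Phi> z = (partial_y \<phi> z, 0)"
        by (simp_all add: partial_x_def partial_y_def)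
      then show ?thesis by (simp add: dbar_def bc_mult_def bc_j_def scaleR_conv_of_real)
    qed
    define A where "A = (\<lambda>z. Sc (W z) * partial_x \<phi> z)"
    define B where "B = (\<lambda>z. Vec (W z) * partial_y \<phi> z)"
    define C where "C = (\<lambda>z. Sc (W z) * partial_y \<phi> z)"
    define D where "D = (\<lambda>z. Vec (W z) * partial_x \<phi> z)"
    define E where "E = (\<lambda>z. Sc (U z) * \<phi> z)"
    define F where "F = (\<lambda>z. Vec (U z) * \<phi> z)"
    have ints: "integrable ?M A" "integrable ?M B" "integrable ?M C" "integrable ?M D" "integrable ?M E" "integrable ?M F"
      unfolding A_def B_def C_def D_def E_def F_def by (intro int W U)+
    have "(\<integral>z. W z *\<^sub>B dbar \<Phi> z \<partial>?M) = (\<integral>z. ((A z - B z) / 2, (C z + D z) / 2) \<partial>?M)"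
      by (rule Bochner_Integration.integral_cong)
         (simp_all add: bc_mult_def dP A_def B_def C_def D_def diff_divide_distrib add_divide_distrib)
    also have "\<dots> = ((integral\<^sup>L ?M A - integral\<^sup>L ?M B) / 2, (integral\<^sup>L ?M C + integral\<^sup>L ?M D) / 2)"
      using ints by (subst integral_bicomplex) auto
    finally have 1: "(\<integral>z. W z *\<^sub>B dbar \<Phi> z \<partial>?M) = \<dots>" .
    have "(\<integral>z. U z *\<^sub>B \<Phi> z \<partial>?M) = (\<integral>z. (E z, F z) \<partial>?M)"
      by (rule Bochner_Integration.integral_cong) (simp_all add: bc_mult_def \<Phi>_def E_def F_def)
    also have "\<dots> = (integral\<^sup>L ?M E, integral\<^sup>L ?M F)"
      using ints by (subst integral_bicomplex) auto
    finally have 2: "(\<integral>z. U z *\<^sub>B \<Phi> z \<partial>?M) = \<dots>" .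
    have eqs: "(integral\<^sup>L ?M A - integral\<^sup>L ?M B) / 2 = - integral\<^sup>L ?M E"
      "(integral\<^sup>L ?M C + integral\<^sup>L ?M D) / 2 = - integral\<^sup>L ?M F"
      using eq unfolding 1 2 by simp_all
    have "(\<integral>z. (Sc (W z) + k * Vec (W z)) * ((partial_x \<phi> z + k * partial_y \<phi> z) / 2) \<partial>?M)
       = (\<integral>z. (A z - B z) / 2 + k * ((C z + D z) / 2) \<partial>?M)"
    proof (rule Bochner_Integration.integral_cong[OF refl])
      fix z
      have "(Sc (W z) + k * Vec (W z)) * (partial_x \<phi> z + k * partial_y \<phi> z) = A z + (k * k) * B z + k * (C z + D z)"
        unfolding A_def B_def C_def D_def by (simp add: algebra_simps)
      then show "(Sc (W z) + k * Vec (W z)) * ((partial_x \<phi> z + k * partial_y \<phi> z) / 2) = (A z - B z) / 2 + k * ((C z + D z) / 2)"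
        unfolding k times_divide_eq_right by (simp only: add_divide_distrib[symmetric]) simp
    qed
    also have "\<dots> = (integral\<^sup>L ?M A - integral\<^sup>L ?M B) / 2 + k * ((integral\<^sup>L ?M C + integral\<^sup>L ?M D) / 2)"
      using ints by simp
    also have "\<dots> = - (integral\<^sup>L ?M E + k * integral\<^sup>L ?M F)" unfolding eqs by simp
    also have "integral\<^sup>L ?M E + k * integral\<^sup>L ?M F = (\<integral>z. E z + k * F z \<partial>?M)" using ints by simp
    also have "\<dots> = (\<integral>z. (Sc (U z) + k * Vec (U z)) * \<phi> z \<partial>?M)"
      by (simp only: E_def F_def distrib_right mult.assoc)
    finally show ?thesis .
  qed
  show "weak_cdbar \<Omega> (\<lambda>z. Sc (W z) + \<i> * Vec (W z)) (\<lambda>z. Sc (U z) + \<i> * Vec (U z))"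
    unfolding weak_cdbar_def using key[of _ \<i>] by simp
  show "weak_cdbar \<Omega> (\<lambda>z. cnj (Sc (W z) - \<i> * Vec (W z))) (\<lambda>z. cnj (Sc (U z) - \<i> * Vec (U z)))"
    unfolding weak_cdbar_def
  proof
    fix \<phi> assume \<phi>: "\<phi> \<in> test_functions \<Omega>"
    \<comment> \<open>Conjugating the whole integral moves the conjugation onto the test function,
      which stays admissible, and turns the operator with \<i> into the one with its
      negative.\<close>
    have "(\<integral>z. cnj (Sc (W z) - \<i> * Vec (W z)) * ((partial_x \<phi> z + \<i> * partial_y \<phi> z) / 2) \<partial>?M)
      = cnj (\<integral>z. (Sc (W z) + (-\<i>) * Vec (W z)) * ((partial_x (\<lambda>z. cnj (\<phi> z)) z + (-\<i>) * partial_y (\<lambda>z. cnj (\<phi> z)) z) / 2) \<partial>?M)"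
      unfolding Bochner_Integration.integral_cnj[symmetric]
      by (rule Bochner_Integration.integral_cong) (simp_all add: partial_cnj[OF test_functionD(1)[OF \<phi>]])
    also have "\<dots> = cnj (- (\<integral>z. (Sc (U z) + (-\<i>) * Vec (U z)) * cnj (\<phi> z) \<partial>?M))"
      by (subst key[OF test_functions_cnj[OF \<phi>]]) simp_all
    also have "\<dots> = - (\<integral>z. cnj (Sc (U z) - \<i> * Vec (U z)) * \<phi> z \<partial>?M)"
      unfolding complex_cnj_minus Bochner_Integration.integral_cnj[symmetric]
      by (intro arg_cong[where f = uminus] Bochner_Integration.integral_cong) simp_all
    finally show "(\<integral>z. cnj (Sc (W z) - \<i> * Vec (W z)) * ((partial_x \<phi> z + \<i> * partial_y \<phi> z) / 2) \<partial>?M)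
      = - (\<integral>z. cnj (Sc (U z) - \<i> * Vec (U z)) * \<phi> z \<partial>?M)" .
  qed
qed

section \<open>Continuous representatives\<close>

text \<open>Determined pointwise by \<open>f\<close> alone, without reference to a chosen disk. A
  single function thus serves all disks, as \<open>C_locdisk\<close> demands, with no gluing of
  local representatives.\<close>

definition cont_rep :: "(complex \<Rightarrow> complex) \<Rightarrow> complex \<Rightarrow> complex" where
  "cont_rep f z = (THE v. \<exists>\<delta>>0. \<exists>G. continuous_on (ball z \<delta>) G \<and>
     (AE x in lebesgue. x \<in> ball z \<delta> \<longrightarrow> f x = G x) \<and> v = G z)"

text \<open>Two continuous functions that agree almost everywhere on an open set agree everywhere on
  it, which makes the description in \<open>cont_rep\<close> unique.\<close>

lemma cont_rep_eq:
  assumes S: "open S" "z \<in> S" and G: "continuous_on S G" "AE x in lebesgue. x \<in> S \<longrightarrow> f x = G x"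
  shows "cont_rep f z = G z"
  unfolding cont_rep_def
proof (rule the_equality)
  obtain \<delta> where \<delta>: "\<delta> > 0" "ball z \<delta> \<subseteq> S"
    using S openE by blast
  have "AE x in lebesgue. x \<in> ball z \<delta> \<longrightarrow> f x = G x"
    using G(2) by (rule eventually_mono) (use \<delta>(2) in blast)
  with \<delta> continuous_on_subset[OF G(1) \<delta>(2)]
  show "\<exists>\<delta>>0. \<exists>G'. continuous_on (ball z \<delta>) G' \<and> (AE x in lebesgue. x \<in> ball z \<delta> \<longrightarrow> f x = G' x) \<and> G z = G' z"
    by blast
next
  fix v
  assume "\<exists>\<delta>>0. \<exists>G. continuous_on (ball z \<delta>) G \<and> (AE x in lebesgue. x \<in> ball z \<delta> \<longrightarrow> f x = G x) \<and> v = G z"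
  then obtain \<delta> G' where \<delta>: "\<delta> > 0" and G': "continuous_on (ball z \<delta>) G'" "AE x in lebesgue. x \<in> ball z \<delta> \<longrightarrow> f x = G' x"
    and v: "v = G' z" by blast
  \<comment> \<open>The open set where the two candidates differ. Its complement is closed and of
    full measure, hence contains every point, in particular \<open>z\<close>.\<close>
  define D where "D = (S \<inter> ball z \<delta>) \<inter> (\<lambda>x. G x - G' x) -` (- {0})"
  have "open D"
    unfolding D_def
  proof (rule continuous_open_preimage)
    show "continuous_on (S \<inter> ball z \<delta>) (\<lambda>x. G x - G' x)"
      by (intro continuous_on_diff continuous_on_subset[OF G(1)] continuous_on_subset[OF G'(1)]) auto
    show "open (S \<inter> ball z \<delta>)" using S(1) by blast
    show "open (- {0 :: complex})" by (simp add: open_Compl)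
  qed
  then have "closed (- D)" by (simp add: closed_Compl)
  moreover have "AE x in lebesgue. x \<in> - D"
    using G(2) G'(2)
  proof eventually_elim
    case (elim x)
    show ?case
    proof
      assume "x \<in> D"
      then have "x \<in> S" "x \<in> ball z \<delta>" "G x - G' x \<noteq> 0" by (auto simp: D_def)
      with elim show False by simp
    qed
  qed
  ultimately have "z \<in> - D" by (rule mem_closed_if_AE_lebesgue)
  then show "v = G z" using S(2) \<delta> v by (simp add: D_def)
qed

text \<open>By compactness a uniform neighbourhood of the disk fits into the open set. It provides
  room for the smaller disks on which one divides by the cutoff.\<close>

lemma enlarge_cball:
  fixes \<Omega> :: "complex set"
  assumes "open \<Omega>" "cball c r \<subseteq> \<Omega>" "r > 0"
  shows "\<exists>e>0. cball c (r + e) \<subseteq> \<Omega>"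
proof -
  obtain e where e: "e > 0" "(\<Union>x\<in>cball c r. cball x e) \<subseteq> \<Omega>"
    using compact_subset_open_imp_cball_epsilon_subset[OF compact_cball assms(1,2)] by blast
  have "cball c (r + e) \<subseteq> (\<Union>x\<in>cball c r. cball x e)"
  proof
    fix z assume z: "z \<in> cball c (r + e)"
    \<comment> \<open>The point of the disk of radius \<open>r\<close> nearest to \<open>z\<close>,
      by radial projection.\<close>
    define x where "x = (if norm (z - c) \<le> r then z else c + (r / norm (z - c)) *\<^sub>R (z - c))"
    have "dist c x \<le> r \<and> dist x z \<le> e"
    proof (cases "norm (z - c) \<le> r")
      case True
      then show ?thesis using e(1) by (simp add: x_def dist_norm norm_minus_commute)
    next
      case False
      then have n: "norm (z - c) > 0" "r < norm (z - c)" using assms(3) by linarith+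
      have "dist c x = r" using False n assms(3) by (simp add: x_def dist_norm)
      moreover have "z - x = (1 - r / norm (z - c)) *\<^sub>R (z - c)"
        using False by (simp add: x_def scaleR_left_diff_distrib)
      then have "dist z x = \<bar>1 - r / norm (z - c)\<bar> * norm (z - c)" by (simp add: dist_norm)
      then have "dist z x = norm (z - c) - r"
        using n by (simp add: left_diff_distrib divide_less_eq abs_of_nonneg)
      ultimately show ?thesis using z by (simp add: dist_commute dist_norm norm_minus_commute)
    qed
    then show "z \<in> (\<Union>x\<in>cball c r. cball x e)" by auto
  qed
  with e show ?thesis by blast
qed

text \<open>On each disk the canonical representative coincides with the local one, so it inherits
  the Hoelder bound. The exceptional null sets of the uncountably many disks are reduced to
  countably many by the Lindelof property.\<close>

lemma cont_rep_hoelder: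
  assumes \<Omega>: "open \<Omega>" and \<epsilon>: "\<epsilon> > 0"
    and loc: "\<And>c r. r > 0 \<Longrightarrow> cball c r \<subseteq> \<Omega> \<Longrightarrow>
      \<exists>G\<in>hoelder \<epsilon> (cball c r). AE z in lebesgue. z \<in> cball c r \<longrightarrow> f z = G z"
  shows "AE z in lebesgue_on \<Omega>. f z = cont_rep f z"
    and "r > 0 \<Longrightarrow> cball c r \<subseteq> \<Omega> \<Longrightarrow> cont_rep f \<in> hoelder \<epsilon> (cball c r)"
proof -
  have rep: "\<exists>G\<in>hoelder \<epsilon> (cball c r). (AE z in lebesgue. z \<in> cball c r \<longrightarrow> f z = G z) \<and> (\<forall>z\<in>ball c r. cont_rep f z = G z)"
    if rc: "r > 0" "cball c r \<subseteq> \<Omega>" for c r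
  proof -
    obtain G where G: "G \<in> hoelder \<epsilon> (cball c r)" "AE z in lebesgue. z \<in> cball c r \<longrightarrow> f z = G z"
      using loc[OF rc] by blast
    have cont: "continuous_on (ball c r) G"
      by (rule continuous_on_subset[OF hoelder_continuous_on[OF G(1) \<epsilon>] ball_subset_cball])
    have ae: "AE z in lebesgue. z \<in> ball c r \<longrightarrow> f z = G z"
      using G(2) by (rule eventually_mono) (use ball_subset_cball in blast)
    have "\<forall>z\<in>ball c r. cont_rep f z = G z"
      by (intro ballI cont_rep_eq[OF open_ball _ cont ae])
    with G show ?thesis by blast
  qed
  show "cont_rep f \<in> hoelder \<epsilon> (cball c r)" if r: "r > 0" "cball c r \<subseteq> \<Omega>"
  proof -
    \<comment> \<open>\<open>cont_rep_eq\<close> applies only at interior points, so the closed disk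
      is first placed inside a larger open one.\<close>
    obtain e where e: "e > 0" "cball c (r + e) \<subseteq> \<Omega>" using enlarge_cball[OF \<Omega> r(2,1)] by blast
    have re: "r + e > 0" using r(1) e(1) by simp
    obtain G where G: "G \<in> hoelder \<epsilon> (cball c (r + e))" "\<forall>z\<in>ball c (r + e). cont_rep f z = G z"
      using rep[OF re e(2)] by blast
    have sub: "cball c r \<subseteq> ball c (r + e)" using e(1) by auto
    have "G \<in> hoelder \<epsilon> (cball c r)"
      by (rule hoelder_subset[OF G(1)]) (use e(1) in auto)
    moreover have "cont_rep f z = G z" if "z \<in> cball c r" for z using G(2) sub that by blast
    ultimately show ?thesis unfolding hoelder_def by simp
  qed
  define \<F> where "\<F> = {ball c r |c r. r > 0 \<and> cball c r \<subseteq> \<Omega>}"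
  have "\<And>S. S \<in> \<F> \<Longrightarrow> open S" by (auto simp: \<F>_def)
  then obtain \<F>' where F: "\<F>' \<subseteq> \<F>" "countable \<F>'" "\<Union>\<F>' = \<Union>\<F>"
    using Lindelof[of \<F>] by blast
  have "AE z in lebesgue. z \<in> S \<longrightarrow> f z = cont_rep f z" if "S \<in> \<F>'" for S
  proof -
    have "S \<in> \<F>" using that F(1) by blast
    then obtain c r where cr: "S = ball c r" "r > 0" "cball c r \<subseteq> \<Omega>"
      unfolding \<F>_def by blast
    obtain G where G: "AE z in lebesgue. z \<in> cball c r \<longrightarrow> f z = G z" "\<forall>z\<in>ball c r. cont_rep f z = G z"
      using rep[OF cr(2,3)] by blast
    show ?thesis
      using G(1) unfolding cr(1)
      by (rule eventually_mono) (use G(2) ball_subset_cball[of c r] in auto)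
  qed
  then have "AE z in lebesgue. \<forall>S\<in>\<F>'. z \<in> S \<longrightarrow> f z = cont_rep f z"
    using F(2) by (subst AE_ball_countable) auto
  then have "AE z in lebesgue. z \<in> \<Omega> \<longrightarrow> f z = cont_rep f z"
  proof (rule eventually_mono, intro impI)
    fix z assume *: "\<forall>S\<in>\<F>'. z \<in> S \<longrightarrow> f z = cont_rep f z" and z: "z \<in> \<Omega>"
    obtain r where "r > 0" "cball z r \<subseteq> \<Omega>" using \<Omega> z open_contains_cball by blast
    then have "ball z r \<in> \<F>" "z \<in> ball z r" unfolding \<F>_def by auto
    then have "z \<in> \<Union>\<F>'" unfolding F(3) by blast
    with * show "f z = cont_rep f z" by blast
  qed
  then show "AE z in lebesgue_on \<Omega>. f z = cont_rep f z"
    using \<Omega> by (subst AE_lebesgue_on) auto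
qed

lemma C_locdiskI:
  assumes \<Omega>: "open \<Omega>" and \<epsilon>: "\<epsilon> > 0"
    and loc: "\<And>c r. r > 0 \<Longrightarrow> cball c r \<subseteq> \<Omega> \<Longrightarrow>
      \<exists>G\<in>hoelder \<epsilon> (cball c r). AE z in lebesgue. z \<in> cball c r \<longrightarrow> Sc (W z) = G z"
      "\<And>c r. r > 0 \<Longrightarrow> cball c r \<subseteq> \<Omega> \<Longrightarrow>
      \<exists>G\<in>hoelder \<epsilon> (cball c r). AE z in lebesgue. z \<in> cball c r \<longrightarrow> Vec (W z) = G z"
  shows "W \<in> C_locdisk \<epsilon> \<Omega>"
proof -
  define W' where "W' z = (cont_rep (\<lambda>z. Sc (W z)) z, cont_rep (\<lambda>z. Vec (W z)) z)" for z
  have "AE z in lebesgue_on \<Omega>. Sc (W z) = cont_rep (\<lambda>z. Sc (W z)) z"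
    by (rule cont_rep_hoelder(1)[OF \<Omega> \<epsilon> loc(1)])
  moreover have "AE z in lebesgue_on \<Omega>. Vec (W z) = cont_rep (\<lambda>z. Vec (W z)) z"
    by (rule cont_rep_hoelder(1)[OF \<Omega> \<epsilon> loc(2)])
  ultimately have "AE z in lebesgue_on \<Omega>. W z = W' z"
    by eventually_elim (simp add: W'_def prod_eq_iff)
  moreover have "W' \<in> bc_space (hoelder \<epsilon> (cball c r))" if "r > 0" "cball c r \<subseteq> \<Omega>" for c r
    using cont_rep_hoelder(2)[OF \<Omega> \<epsilon> loc(1) that] cont_rep_hoelder(2)[OF \<Omega> \<epsilon> loc(2) that]
    by (simp add: bc_space_def W'_def)
  ultimately show ?thesis unfolding C_locdisk_def by blast
qed

section \<open>Regularity\<close>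

text \<open>Solving the equation for \<open>U\<close> expresses its coordinates through
  \<open>V\<close> and bounded multiples of the coordinates of \<open>W\<close>; any exponent gained
  for \<open>W\<close> therefore carries over to the right-hand side, as far as \<open>V\<close>
  permits.\<close>

lemma L_space_weak_solution_dbar:
  assumes W: "(\<lambda>z. Sc (W z)) \<in> L_space p S" "(\<lambda>z. Vec (W z)) \<in> L_space p S"
    and V: "(\<lambda>z. Sc (V z)) \<in> L_space p S" "(\<lambda>z. Vec (V z)) \<in> L_space p S"
    and a: "(\<lambda>z. Sc (a z)) \<in> L_inf S" "(\<lambda>z. Vec (a z)) \<in> L_inf S"
    and b: "(\<lambda>z. Sc (b z)) \<in> L_inf S" "(\<lambda>z. Vec (b z)) \<in> L_inf S"
    and U: "(\<lambda>z. Sc (U z)) \<in> borel_measurable (lebesgue_on S)" "(\<lambda>z. Vec (U z)) \<in> borel_measurable (lebesgue_on S)"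
    and eq: "AE z in lebesgue_on S. U z - a z *\<^sub>B W z - b z *\<^sub>B bc_cnj (W z) = V z" and p: "p \<ge> 0"
  shows "(\<lambda>z. Sc (U z)) \<in> L_space p S" "(\<lambda>z. Vec (U z)) \<in> L_space p S"
proof -
  \<comment> \<open>Differences are written with the factor -1 so that the closure rules for sums
    and multiples apply directly. The signs in the \<open>b\<close> terms come from
    \<open>bc_cnj\<close>.\<close>
  define f where "f z = Sc (V z) + ((Sc (a z) * Sc (W z) + (-1) * (Vec (a z) * Vec (W z)))
      + (Sc (b z) * Sc (W z) + Vec (b z) * Vec (W z)))" for z
  define g where "g z = Vec (V z) + ((Sc (a z) * Vec (W z) + Vec (a z) * Sc (W z))
      + ((-1) * (Sc (b z) * Vec (W z)) + Vec (b z) * Sc (W z)))" for z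
  have f: "f \<in> L_space p S"
    unfolding f_def by (intro L_space_add L_space_cmult L_space_bounded_mult W V a b p)
  have g: "g \<in> L_space p S"
    unfolding g_def by (intro L_space_add L_space_cmult L_space_bounded_mult W V a b p)
  have "AE z in lebesgue_on S. Sc (U z) = f z \<and> Vec (U z) = g z"
    using eq
  proof eventually_elim
    case (elim z)
    then have "U z = V z + (a z *\<^sub>B W z + b z *\<^sub>B bc_cnj (W z))" by (simp add: diff_diff_eq diff_eq_eq)
    then show ?case by (simp add: f_def g_def bc_mult_def bc_cnj_def)
  qed
  note eq' = this
  have 1: "AE z in lebesgue_on S. norm (Sc (U z)) \<le> norm (f z)"
    using eq' by (rule eventually_mono) simp
  have 2: "AE z in lebesgue_on S. norm (Vec (U z)) \<le> norm (g z)"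
    using eq' by (rule eventually_mono) simp
  show "(\<lambda>z. Sc (U z)) \<in> L_space p S" by (rule L_space_dominated[OF U(1) f p 1])
  show "(\<lambda>z. Vec (U z)) \<in> L_space p S" by (rule L_space_dominated[OF U(2) g p 2])
qed

text \<open>All cases of the theorem reduce to this one. The exponent \<open>s\<close> of
  \<open>W\<close> is independent of the \<open>p\<close> recorded in the weak solution, so it may
  be chosen below \<open>p\<close>; the bounds on \<open>s\<close> and \<open>t\<close> are those
  under which a single gain reaches \<open>t\<close>.\<close>

lemma weak_solution_C_locdisk:
  assumes \<Omega>: "open \<Omega>"
    and a: "a \<in> bc_space (L_inf \<Omega>)" and b: "b \<in> bc_space (L_inf \<Omega>)"
    and s: "1 < s" "s < 2" and t: "2 < t" "t < 2 * s / (2 - s)"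
    and W: "W \<in> bc_space (L_space s \<Omega>)" and V: "V \<in> bc_space (L_space t \<Omega>)"
    and sol: "weak_solution p \<Omega> a b V W"
  shows "W \<in> C_locdisk (1 - 2 / t) \<Omega>"
proof -
  have oS: "\<Omega> \<in> sets lebesgue" using \<Omega> by simp
  obtain U where weak: "weak_dbar p \<Omega> W U"
    and eq: "AE z in lebesgue_on \<Omega>. U z - a z *\<^sub>B W z - b z *\<^sub>B bc_cnj (W z) = V z"
    using sol unfolding weak_solution_def by blast
  have W': "(\<lambda>z. Sc (W z)) \<in> L_space s \<Omega>" "(\<lambda>z. Vec (W z)) \<in> L_space s \<Omega>"
    and V': "(\<lambda>z. Sc (V z)) \<in> L_space t \<Omega>" "(\<lambda>z. Vec (V z)) \<in> L_space t \<Omega>"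
    and a': "(\<lambda>z. Sc (a z)) \<in> L_inf \<Omega>" "(\<lambda>z. Vec (a z)) \<in> L_inf \<Omega>"
    and b': "(\<lambda>z. Sc (b z)) \<in> L_inf \<Omega>" "(\<lambda>z. Vec (b z)) \<in> L_inf \<Omega>"
    using W V a b by (simp_all add: bc_space_def)
  have U': "(\<lambda>z. Sc (U z)) \<in> L_loc 1 \<Omega>" "(\<lambda>z. Vec (U z)) \<in> L_loc 1 \<Omega>"
    using weak by (simp_all add: weak_dbar_def bc_space_def)
  have loc1: "u \<in> L_loc 1 \<Omega>" if "u \<in> L_space s \<Omega>" for u
    unfolding L_loc_def using s that oS
    by (auto intro!: L_space_mono[OF that] lmeasurable_compact)
  define f1 where "f1 z = Sc (W z) + \<i> * Vec (W z)" for z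
  define f2 where "f2 z = cnj (Sc (W z) - \<i> * Vec (W z))" for z
  define g1 where "g1 z = Sc (U z) + \<i> * Vec (U z)" for z
  define g2 where "g2 z = cnj (Sc (U z) - \<i> * Vec (U z))" for z
  have wk: "weak_cdbar \<Omega> f1 g1" "weak_cdbar \<Omega> f2 g2"
    unfolding f1_def f2_def g1_def g2_def
    by (rule weak_dbar_components[OF \<Omega> loc1[OF W'(1)] loc1[OF W'(2)] weak])+
  \<comment> \<open>Inverts the splitting: \<open>f1\<close> is \<open>Sc W + \<i> * Vec W\<close>
    and \<open>cnj (f2 z)\<close> is the same with a minus sign.\<close>
  have Wf: "Sc (W z) = (1 / 2) * f1 z + (1 / 2) * cnj (f2 z)" "Vec (W z) = (- \<i> / 2) * f1 z + (\<i> / 2) * cnj (f2 z)" for z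
    by (simp_all add: f1_def f2_def field_simps)
  have fL: "f1 \<in> L_space \<sigma> S" "f2 \<in> L_space \<sigma> S"
    if "(\<lambda>z. Sc (W z)) \<in> L_space \<sigma> S" "(\<lambda>z. Vec (W z)) \<in> L_space \<sigma> S" "\<sigma> \<ge> 0" for \<sigma> S
  proof -
    show "f1 \<in> L_space \<sigma> S" unfolding f1_def by (intro L_space_add L_space_cmult that)
    have "(\<lambda>z. cnj (Sc (W z) + (- \<i>) * Vec (W z))) \<in> L_space \<sigma> S"
      by (intro L_space_cnj L_space_add L_space_cmult that)
    then show "f2 \<in> L_space \<sigma> S" by (simp add: f2_def[abs_def])
  qed
  \<comment> \<open>Used with exponent \<open>s\<close> on the outer disk and with \<open>t\<close>
    on the middle one; the restriction to exponents up to \<open>t\<close> is imposed by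
    \<open>V\<close>.\<close>
  have gL: "g1 \<in> L_space \<sigma> S" "g2 \<in> L_space \<sigma> S"
    if S: "S = cball c R" "S \<subseteq> \<Omega>" and \<sigma>: "0 \<le> \<sigma>" "\<sigma> \<le> t"
      and WS: "(\<lambda>z. Sc (W z)) \<in> L_space \<sigma> S" "(\<lambda>z. Vec (W z)) \<in> L_space \<sigma> S" for \<sigma> S c R
  proof -
    have SS: "S \<in> sets lebesgue" "S \<in> lmeasurable" using S(1) by (simp_all add: fmeasurableD)
    have cS: "compact S" using S(1) by simp
    have VS: "(\<lambda>z. Sc (V z)) \<in> L_space \<sigma> S" "(\<lambda>z. Vec (V z)) \<in> L_space \<sigma> S"
      by (rule L_space_mono[OF V'(1) S(2) SS(2) oS \<sigma>], rule L_space_mono[OF V'(2) S(2) SS(2) oS \<sigma>])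
    note inf = L_inf_mono[OF _ S(2) oS SS(1)]
    have "(\<lambda>z. Sc (U z)) \<in> L_space 1 S" "(\<lambda>z. Vec (U z)) \<in> L_space 1 S"
      using U' cS S(2) by (simp_all add: L_loc_def)
    note Um = this[THEN L_space_D(1)]
    have eqS: "AE z in lebesgue_on S. U z - a z *\<^sub>B W z - b z *\<^sub>B bc_cnj (W z) = V z"
      using eq unfolding AE_lebesgue_on[OF oS] AE_lebesgue_on[OF SS(1)]
      by (rule eventually_mono) (use S(2) in blast)
    note US = L_space_weak_solution_dbar[OF WS VS inf[OF a'(1)] inf[OF a'(2)] inf[OF b'(1)] inf[OF b'(2)] Um eqS \<sigma>(1)]
    show "g1 \<in> L_space \<sigma> S" unfolding g1_def by (intro L_space_add L_space_cmult US \<sigma>)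
    have "(\<lambda>z. cnj (Sc (U z) + (- \<i>) * Vec (U z))) \<in> L_space \<sigma> S"
      by (intro L_space_cnj L_space_add L_space_cmult US \<sigma>)
    then show "g2 \<in> L_space \<sigma> S" by (simp add: g2_def[abs_def])
  qed
  have hoelder: "\<exists>G1\<in>hoelder (1 - 2 / t) (cball c r). \<exists>G2\<in>hoelder (1 - 2 / t) (cball c r).
      AE z in lebesgue. z \<in> cball c r \<longrightarrow> f1 z = G1 z \<and> f2 z = G2 z"
    if rc: "r > 0" "cball c r \<subseteq> \<Omega>" for c r
  proof -
    obtain e where e: "e > 0" "cball c (r + e) \<subseteq> \<Omega>" using enlarge_cball[OF \<Omega> rc(2,1)] by blast
    \<comment> \<open>Three concentric disks: exponent \<open>s\<close> on \<open>S\<close>,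
      exponent \<open>t\<close> on \<open>T\<close>, Hoelder continuity on the disk of radius
      \<open>r\<close>, each passage dividing by a cutoff of the larger disk.\<close>
    define S where "S = cball c (r + e)"
    define T where "T = cball c (r + e / 2)"
    have T: "T \<subseteq> \<Omega>" using e by (auto simp: T_def)
    have Sm: "S \<in> lmeasurable" "S \<subseteq> \<Omega>" using e by (simp_all add: S_def)
    have t0: "0 \<le> s" "s \<le> s" "s \<le> t" "s < t" "0 \<le> t" "t \<le> t" using s t by auto
    have R: "0 \<le> r + e / 2" "r + e / 2 < r + e" "0 \<le> r" "r < r + e / 2" using rc(1) e(1) by auto
    have WS: "(\<lambda>z. Sc (W z)) \<in> L_space s S" "(\<lambda>z. Vec (W z)) \<in> L_space s S"
      by (rule L_space_mono[OF W'(1) Sm(2,1) oS t0(1,2)], rule L_space_mono[OF W'(2) Sm(2,1) oS t0(1,2)])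
    note fS = fL[OF WS t0(1)] and gS = gL[OF S_def Sm(2) t0(1,3) WS]
    have fT: "f1 \<in> L_space t T" "f2 \<in> L_space t T"
      unfolding T_def
      by (rule weak_cdbar_gain[OF \<Omega> e(2) R(1,2) wk(1) s t0(4) t(2) fS(1)[unfolded S_def] gS(1)[unfolded S_def]],
          rule weak_cdbar_gain[OF \<Omega> e(2) R(1,2) wk(2) s t0(4) t(2) fS(2)[unfolded S_def] gS(2)[unfolded S_def]])
    \<comment> \<open>Both components are needed at exponent \<open>t\<close> before either
      right-hand side can be improved, since the lower-order terms couple them.\<close>
    have WT: "(\<lambda>z. Sc (W z)) \<in> L_space t T" "(\<lambda>z. Vec (W z)) \<in> L_space t T"
      unfolding Wf by (intro L_space_add L_space_cmult L_space_cnj fT t0)+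
    note gT = gL[OF T_def T t0(5,6) WT]
    obtain G1 where G1: "G1 \<in> hoelder (1 - 2 / t) (cball c r)" "AE z in lebesgue. z \<in> cball c r \<longrightarrow> f1 z = G1 z"
      using weak_cdbar_hoelder[OF \<Omega> T[unfolded T_def] R(3,4) wk(1) t(1) fT(1)[unfolded T_def] gT(1)[unfolded T_def]] by blast
    obtain G2 where G2: "G2 \<in> hoelder (1 - 2 / t) (cball c r)" "AE z in lebesgue. z \<in> cball c r \<longrightarrow> f2 z = G2 z"
      using weak_cdbar_hoelder[OF \<Omega> T[unfolded T_def] R(3,4) wk(2) t(1) fT(2)[unfolded T_def] gT(2)[unfolded T_def]] by blast
    have "AE z in lebesgue. z \<in> cball c r \<longrightarrow> f1 z = G1 z \<and> f2 z = G2 z"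
      using G1(2) G2(2) by eventually_elim blast
    with G1(1) G2(1) show ?thesis by blast
  qed
  have \<epsilon>: "1 - 2 / t > 0" using t by simp
  have comb: "\<exists>G\<in>hoelder (1 - 2 / t) (cball c r). AE z in lebesgue. z \<in> cball c r \<longrightarrow> k * f1 z + l * cnj (f2 z) = G z"
    if rc: "r > 0" "cball c r \<subseteq> \<Omega>" for c r k l
  proof -
    obtain G1 G2 where G: "G1 \<in> hoelder (1 - 2 / t) (cball c r)" "G2 \<in> hoelder (1 - 2 / t) (cball c r)"
      "AE z in lebesgue. z \<in> cball c r \<longrightarrow> f1 z = G1 z \<and> f2 z = G2 z"
      using hoelder[OF rc] by blast
    have "(\<lambda>z. k * G1 z + l * cnj (G2 z)) \<in> hoelder (1 - 2 / t) (cball c r)"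
      by (rule hoelder_add[OF hoelder_mult[OF hoelder_const G(1) bounded_cball \<epsilon>]
            hoelder_mult[OF hoelder_const hoelder_cnj[OF G(2)] bounded_cball \<epsilon>]])
    moreover have "AE z in lebesgue. z \<in> cball c r \<longrightarrow> k * f1 z + l * cnj (f2 z) = k * G1 z + l * cnj (G2 z)"
      using G(3) by (rule eventually_mono) simp
    ultimately show ?thesis by (intro bexI[where x = "\<lambda>z. k * G1 z + l * cnj (G2 z)"])
  qed
  show ?thesis
    by (rule C_locdiskI[OF \<Omega> \<epsilon>]; unfold Wf; rule comb)
qed

lemma L_space_bounded_domain:
  assumes "open \<Omega>" "bounded \<Omega>" "0 \<le> r" "r \<le> p" "f \<in> bc_space (L_space p \<Omega>)"
  shows "f \<in> bc_space (L_space r \<Omega>)"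
proof -
  have "\<Omega> \<in> lmeasurable" using assms(1,2) by (rule lmeasurable_open[rotated])
  then show ?thesis
    using assms L_space_mono[of _ p \<Omega> \<Omega> r] by (auto simp: bc_space_def fmeasurableD)
qed

theorem proposition18:
  fixes \<Omega> :: "complex set" and a b V W :: "complex \<Rightarrow> bicomplex" and p q :: real
  assumes "open \<Omega>" and "connected \<Omega>" and "\<Omega> \<noteq> {}"
    and "bounded \<Omega>" and "simply_connected \<Omega>"
    and "a \<in> bc_space (L_inf \<Omega>)" and "b \<in> bc_space (L_inf \<Omega>)"
    and "1 < p" and "p \<le> q" and "2 < q"
    and "V \<in> bc_space (L_space q \<Omega>)"
    and "W \<in> D_space p \<Omega>"
    and "weak_solution p \<Omega> a b V W"
  shows "(p < 2 \<longrightarrow> (\<forall>r. 2 < r \<and> r < min (2 * p / (2 - p)) q \<longrightarrow> W \<in> C_locdisk (1 - 2 / r) \<Omega>)) \<and>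
         (2 \<le> p \<longrightarrow> W \<in> C_locdisk (1 - 2 / q) \<Omega>) \<and>
         (p < 2 \<longrightarrow> (\<forall>r. 2 < r \<and> r < 2 * p / (2 - p) \<longrightarrow>
                       vekua_bergman p \<Omega> a b \<subseteq> C_locdisk (1 - 2 / r) \<Omega>)) \<and>
         (2 \<le> p \<longrightarrow> (\<forall>r. p < r \<longrightarrow> vekua_bergman p \<Omega> a b \<subseteq> C_locdisk (1 - 2 / r) \<Omega>))"
proof -
  note reg = weak_solution_C_locdisk[OF assms(1,6,7)]
  \<comment> \<open>For the Vekua-Bergman space the inhomogeneity 0 lies in every Lebesgue space, so
    the exponent \<open>q\<close> sets no upper limit on \<open>r\<close> there.\<close>
  have zero: "(\<lambda>_. 0) \<in> bc_space (L_space r \<Omega>)" for r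
    by (simp add: bc_space_def L_space_def)
  have low: "W \<in> C_locdisk (1 - 2 / r) \<Omega>"
    if "p < 2" "2 < r" "r < 2 * p / (2 - p)" "V \<in> bc_space (L_space r \<Omega>)"
      "W \<in> bc_space (L_space p \<Omega>)" "weak_solution p \<Omega> a b V W" for r V W
    by (rule reg[OF assms(8) that(1,2,3,5,4,6)])
  have high: "W \<in> C_locdisk (1 - 2 / r) \<Omega>"
    if p: "2 \<le> p" and r: "2 < r" and V: "V \<in> bc_space (L_space r \<Omega>)"
      and W: "W \<in> bc_space (L_space p \<Omega>)" and sol: "weak_solution p \<Omega> a b V W" for r V W
  proof -
    \<comment> \<open>The solution of \<open>2 * s / (2 - s) = 2 * r\<close>: it lies strictly
      between 1 and 2, hence below \<open>p\<close>, and leaves a factor 2 of room above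
      \<open>r\<close>.\<close>
    define s where "s = 2 * r / (r + 1)"
    have s: "1 < s" "s < 2" using r by (simp_all add: s_def divide_simps)
    have "2 - s = 2 / (r + 1)" using r by (simp add: s_def field_simps)
    then have "2 * s / (2 - s) = 2 * r" using r by (simp add: s_def)
    then have "r < 2 * s / (2 - s)" using r by simp
    moreover have "W \<in> bc_space (L_space s \<Omega>)"
      by (rule L_space_bounded_domain[OF assms(1,4) _ _ W]) (use s p in auto)
    ultimately show ?thesis using reg[OF s r _ _ V sol] by blast
  qed
  have Wp: "W \<in> bc_space (L_space p \<Omega>)" using assms(12) by (simp add: D_space_def)
  have VB: "w \<in> bc_space (L_space p \<Omega>)" "weak_solution p \<Omega> a b (\<lambda>_. 0) w" if "w \<in> vekua_bergman p \<Omega> a b" for w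
    using that by (simp_all add: vekua_bergman_def)
  show ?thesis
  proof (intro conjI impI allI subsetI)
    fix r assume p: "p < 2" and r: "2 < r \<and> r < min (2 * p / (2 - p)) q"
    have "V \<in> bc_space (L_space r \<Omega>)"
      by (rule L_space_bounded_domain[OF assms(1,4) _ _ assms(11)]) (use r in auto)
    then show "W \<in> C_locdisk (1 - 2 / r) \<Omega>" using low[OF p _ _ _ Wp assms(13)] r by simp
  next
    assume "2 \<le> p"
    then show "W \<in> C_locdisk (1 - 2 / q) \<Omega>" by (rule high[OF _ assms(10,11) Wp assms(13)])
  next
    fix r w assume p: "p < 2" and r: "2 < r \<and> r < 2 * p / (2 - p)" and w: "w \<in> vekua_bergman p \<Omega> a b"
    show "w \<in> C_locdisk (1 - 2 / r) \<Omega>" using low[OF p _ _ zero VB[OF w]] r by simp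
  next
    fix r w assume p: "2 \<le> p" and r: "p < r" and w: "w \<in> vekua_bergman p \<Omega> a b"
    then have "2 < r" by simp
    then show "w \<in> C_locdisk (1 - 2 / r) \<Omega>" by (rule high[OF p _ zero VB[OF w]])
  qed
qed

end
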